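(* Let $(p_k)$, $(\eta_k)$, $(\alpha_k)$, $k=0,1,2,\ldots$, be the iterates, search directions and step sizes of the geometric conjugate gradient algorithm (with exponential map and parallel translation, Dai-Yuan coefficient, and step sizes satisfying the Wolfe conditions, as described in the context) applied to the cost $J$. Suppose that there is a compact subset $\mathcal{D}_c$ of $\mathcal{D}$ such that for every $k=0,1,2,\ldots$, $$\gamma_k(t)=\exp_{p_k}(t\eta_k)\in\mathcal{D}_c\qquad\forall t\in[0,\alpha_k].$$ Let $\nabla$ denote the Riemannian connection on $\mathcal{M}=\mathcal{G}_{n,r}\times\mathcal{G}_{n,r}$. Then, for every $k$, the Lipschitz condition $$\left|D(J\circ\exp_{p_k})(\alpha_k\eta_k)\eta_k-D(J\circ\exp_{p_k})(0)\eta_k\right|\le L_J\,\alpha_k\|\eta_k\|_{p_k}^2$$ holds with $$L_J=\max_{\substack{(p,\xi)\in T\mathcal{M}:\\ p\in\mathcal{D}_c,\ \|\xi\|_p=1}}\big\|(\nabla_\xi\operatorname{grad}J)(p)\big\|_p<\infty,$$ and the algorithm converges in the sense that $$\liminf_{k\to\infty}\|\operatorname{grad}J(p_k)\|_{p_k}=0.$$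
   Context: Setting. Fix integers $1\le r\le n$ and $d,m,L\ge 1$, an initial condition $x_0\in\mathbb{R}^n$, an input signal $u(t)\in\mathbb{R}^d$, and sample times $t_0<\cdots<t_{L-1}$. The full-order model is $\frac{d}{dt}x=f(x,u)$, $x(t_0)=x_0$, $y=g(x)$, with $x\in\mathbb{R}^n$, $y\in\mathbb{R}^m$; its observations are $y_l=y(t_l)$. Standing assumption: $(x,t)\mapsto f(x,u(t))$ and $x\mapsto g(x)$ have continuous partial derivatives with respect to $x$ up to second order (including order zero). $\mathcal{G}_{n,r}$ is the Grassmann manifold of $r$-dimensional subspaces of $\mathbb{R}^n$ and $\mathcal{P}=\{(V,W)\in\mathcal{G}_{n,r}\times\mathcal{G}_{n,r}: V\oplus W^\perp=\mathbb{R}^n\}$. For $(V,W)\in\mathcal{P}$, $P_{V,W}$ is the projection with range $V$ and kernel $W^\perp$. The reduced-order model (ROM) is $\frac{d}{dt}\hat x=P_{V,W}f(\hat x,u)$, $\hat x(t_0)=P_{V,W}x_0$, $\hat y=g(\hat x)$. $\mathcal{D}\subset\mathcal{P}$ is the set of $(V,W)$ for which the ROM has a unique solution $\hat x(t;(V,W))$ over $[t_0,t_{L-1}]$; $\hat y_l(V,W)=g(\hat x(t_l;(V,W)))$. Cost: with $L_y:\mathbb{R}^m\to[0,\infty)$ smooth and $\gamma>0$, $$J(V,W)=\frac1L\sum_{l=0}^{L-1}L_y(\hat y_l(V,W)-y_l)+\gamma\rho(V,W),\qquad (V,W)\in\mathcal{D},$$ where $\rho(V,W)=-\log\frac{\det(\Psi^T\Phi)^2}{\det(\Phi^T\Phi)\det(\Psi^T\Psi)}$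 for any $\Phi,\Psi\in\mathbb{R}^{n\times r}$ with linearly independent columns, $V=\operatorname{Range}\Phi$, $W=\operatorname{Range}\Psi$. Riemannian metric. Let $\mathbb{R}^{n,r}_*$ be the manifold of $n\times r$ real matrices with linearly independent columns and $q:\mathbb{R}^{n,r}_*\to\mathcal{G}_{n,r}$, $q(\Phi)=\operatorname{Range}\Phi$. For $\xi\in T_V\mathcal{G}_{n,r}$ and $\Phi\in q^{-1}(V)$, the horizontal lift $\bar\xi_\Phi\in\mathbb{R}^{n\times r}$ is the unique matrix with $\Phi^T\bar\xi_\Phi=0$ and $Dq(\Phi)\bar\xi_\Phi=\xi$. The metric on $\mathcal{G}_{n,r}$ is $\langle\xi_1,\xi_2\rangle_V=\operatorname{Tr}[(\Phi^T\Phi)^{-1}(\bar{\xi_1}_\Phi)^T\bar{\xi_2}_\Phi]$ (independent of $\Phi$), and $\mathcal{M}=\mathcal{G}_{n,r}\times\mathcal{G}_{n,r}$ carries the product metric. $\exp$, $\operatorname{grad}$, $\nabla$, $\|\cdot\|_p$ refer to this metric. Algorithm. Start from $p_0\in\mathcal{D}$ with $\eta_0=-\operatorname{grad}J(p_0)$, and set $p_{k+1}=\exp_{p_k}(\alpha_k\eta_k)$, where, with $J_k(\alpha)=J(\exp_{p_k}(\alpha\eta_k))$, the step size $\alpha_k\ge0$ satisfies the Wolfe conditions $$J_k(\alpha_k)\le J_k(0)+c_1\alpha_kJ_k'(0),\qquad J_k'(\alpha_k)\ge c_2J_k'(0),$$ for fixed constants $0<c_1<c_2<1$. For $k\ge1$,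 $$\eta_k=-\operatorname{grad}J(p_k)+\beta_k\,\mathcal{T}_{p_{k-1},\alpha_{k-1}\eta_{k-1}}(\eta_{k-1}),$$ where $\mathcal{T}_{p,\eta}:T_p\mathcal{M}\to T_{\exp_p(\eta)}\mathcal{M}$ is parallel translation along the geodesic $t\mapsto\exp_p(t\eta)$, $t\in[0,1]$, and $\beta_k$ is the Riemannian Dai-Yuan coefficient $$\beta_k=\frac{\langle\operatorname{grad}J(p_k),\operatorname{grad}J(p_k)\rangle_{p_k}}{\langle\operatorname{grad}J(p_k),\mathcal{T}_{p_{k-1},\alpha_{k-1}\eta_{k-1}}(\eta_{k-1})\rangle_{p_k}-\langle\operatorname{grad}J(p_{k-1}),\eta_{k-1}\rangle_{p_{k-1}}}.$$ The statement concerns infinite sequences produced by the algorithm, i.e. for which these formulas make sense for all $k$ (the algorithm stops if it reaches a zero gradient). *)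

theory Defs
  imports "HOL-Analysis.Analysis"
begin

section \<open>Continuous partial derivatives\<close>

text \<open>Partial derivatives of order at most \<open>k\<close> in the directions \<open>B\<close> exist on \<open>S\<close> and are
  continuous there. Only used for \<open>S\<close> that are open in the directions \<open>B\<close>.\<close>

primrec C_dirs :: "'a::euclidean_space set \<Rightarrow> nat \<Rightarrow> 'a set \<Rightarrow> ('a \<Rightarrow> 'b::real_normed_vector) \<Rightarrow> bool" where
  "C_dirs B 0 S F \<longleftrightarrow> continuous_on S F"
| "C_dirs B (Suc k) S F \<longleftrightarrow> continuous_on S F \<and>
     (\<forall>b\<in>B. \<exists>F'. (\<forall>x\<in>S. ((\<lambda>s. F (x + s *\<^sub>R b)) has_vector_derivative F' x) (at 0)) \<and> C_dirs B k S F')"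

abbreviation C_k :: "nat \<Rightarrow> 'a::euclidean_space set \<Rightarrow> ('a \<Rightarrow> 'b::real_normed_vector) \<Rightarrow> bool" where
  "C_k \<equiv> C_dirs Basis"

section \<open>The Grassmann manifold\<close>

text \<open>For \<open>CARD('r) \<le> CARD('n)\<close> this is the set of \<open>CARD('r)\<close>-dimensional subspaces; the
  minimum only makes the type nonempty for all index types.\<close>

typedef (overloaded) ('n::finite, 'r::finite) grassmann =
  "{V :: (real ^ 'n) set. subspace V \<and> dim V = min CARD('r) CARD('n)}"
  morphisms space_of Grass
proof -
  have "min CARD('r) CARD('n) \<le> dim (UNIV :: (real ^ 'n) set)"
    by simp
  then obtain V :: "(real ^ 'n) set" where "subspace V" "dim V = min CARD('r) CARD('n)"
    using choose_subspace_of_subspace by metis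
  then show ?thesis by blast
qed

definition full_rank :: "(real ^ 'r ^ 'n) set" where
  "full_rank = {\<Phi>. \<forall>c. (\<Sum>j\<in>UNIV. c j *\<^sub>R column j \<Phi>) = 0 \<longrightarrow> (\<forall>j. c j = (0::real))}"

definition range_of :: "real ^ 'r ^ 'n \<Rightarrow> ('n::finite, 'r::finite) grassmann" where
  "range_of \<Phi> = Grass (range ((*v) \<Phi>))"

text \<open>The quotient topology of \<^const>\<open>range_of\<close> on the full-rank matrices.\<close>

instantiation grassmann :: (finite, finite) topological_space
begin

definition open_grassmann :: "('a, 'b) grassmann set \<Rightarrow> bool" where
  "open_grassmann U \<longleftrightarrow> openin (top_of_set full_rank) {\<Phi> \<in> full_rank. range_of \<Phi> \<in> U}"

instance
proof
  show "open (UNIV :: ('a, 'b) grassmann set)"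
    by (simp add: open_grassmann_def)
next
  fix S T :: "('a, 'b) grassmann set"
  assume "open S" "open T"
  then have "openin (top_of_set full_rank)
      ({\<Phi> \<in> full_rank. range_of \<Phi> \<in> S} \<inter> {\<Phi> \<in> full_rank. range_of \<Phi> \<in> T})"
    by (auto simp only: open_grassmann_def intro: openin_Int)
  moreover have "{\<Phi> \<in> full_rank. range_of \<Phi> \<in> S} \<inter> {\<Phi> \<in> full_rank. range_of \<Phi> \<in> T}
      = {\<Phi> \<in> full_rank. range_of \<Phi> \<in> S \<inter> T}" by auto
  ultimately show "open (S \<inter> T)" by (simp add: open_grassmann_def)
next
  fix K :: "('a, 'b) grassmann set set"
  assume "\<forall>S\<in>K. open S"
  then have "openin (top_of_set full_rank) (\<Union>S\<in>K. {\<Phi> \<in> full_rank. range_of \<Phi> \<in> S})"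
    by (auto simp only: open_grassmann_def intro!: openin_Union)
  moreover have "(\<Union>S\<in>K. {\<Phi> \<in> full_rank. range_of \<Phi> \<in> S}) = {\<Phi> \<in> full_rank. range_of \<Phi> \<in> \<Union>K}"
    by auto
  ultimately show "open (\<Union>K)" by (simp add: open_grassmann_def)
qed

end

definition oblique_proj :: "(real ^ 'n) set \<Rightarrow> (real ^ 'n) set \<Rightarrow> real ^ 'n ^ 'n" where
  "oblique_proj V W = (THE P. P ** P = P \<and> range ((*v) P) = V \<and>
     {x. P *v x = 0} = orthogonal_comp W)"

text \<open>A tangent vector at \<open>V\<close> is represented by its image under the differential of the standard
  embedding of the Grassmann manifold into the matrices, which sends \<open>V\<close> to the orthogonal
  projection onto \<open>V\<close>.\<close>

definition orth_proj :: "('n::finite, 'r::finite) grassmann \<Rightarrow> real ^ 'n ^ 'n" where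
  "orth_proj V = oblique_proj (space_of V) (space_of V)"

definition D_range_of :: "real ^ 'r ^ 'n \<Rightarrow> real ^ 'r ^ 'n \<Rightarrow> real ^ 'n ^ 'n" where
  "D_range_of \<Phi> H = frechet_derivative (\<lambda>\<Phi>. orth_proj (range_of \<Phi>)) (at \<Phi>) H"

definition gtangent :: "('n::finite, 'r::finite) grassmann \<Rightarrow> (real ^ 'n ^ 'n) set" where
  "gtangent V = {D_range_of \<Phi> H |\<Phi> H. \<Phi> \<in> full_rank \<and> range_of \<Phi> = V}"

definition horizontal_lift :: "real ^ 'r ^ 'n \<Rightarrow> real ^ 'n ^ 'n \<Rightarrow> real ^ 'r ^ 'n" where
  "horizontal_lift \<Phi> \<xi> = (THE H. transpose \<Phi> ** H = 0 \<and> D_range_of \<Phi> H = \<xi>)"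

definition some_basis :: "('n::finite, 'r::finite) grassmann \<Rightarrow> real ^ 'r ^ 'n" where
  "some_basis V = (SOME \<Phi>. \<Phi> \<in> full_rank \<and> range_of \<Phi> = V)"

definition gmetric :: "('n::finite, 'r::finite) grassmann \<Rightarrow> real ^ 'n ^ 'n \<Rightarrow> real ^ 'n ^ 'n \<Rightarrow> real" where
  "gmetric V \<xi>1 \<xi>2 = (let \<Phi> = some_basis V in
     trace (matrix_inv (transpose \<Phi> ** \<Phi>) **
       (transpose (horizontal_lift \<Phi> \<xi>1) ** horizontal_lift \<Phi> \<xi>2)))"

section \<open>The product manifold\<close>

type_synonym ('n, 'r) pt = "('n, 'r) grassmann \<times> ('n, 'r) grassmann"
type_synonym 'n tvec = "(real ^ 'n ^ 'n) \<times> (real ^ 'n ^ 'n)"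
type_synonym ('n, 'r) frames = "(real ^ 'r ^ 'n) \<times> (real ^ 'r ^ 'n)"

definition range_of2 :: "('n::finite, 'r::finite) frames \<Rightarrow> ('n::finite, 'r::finite) pt" where
  "range_of2 z = (range_of (fst z), range_of (snd z))"

definition D_range_of2 :: "('n::finite, 'r::finite) frames \<Rightarrow> ('n::finite, 'r::finite) frames \<Rightarrow> 'n tvec" where
  "D_range_of2 z h = (D_range_of (fst z) (fst h), D_range_of (snd z) (snd h))"

definition embed :: "('n::finite, 'r::finite) pt \<Rightarrow> 'n tvec" where
  "embed p = (orth_proj (fst p), orth_proj (snd p))"

definition tangent :: "('n::finite, 'r::finite) pt \<Rightarrow> 'n tvec set" where
  "tangent p = gtangent (fst p) \<times> gtangent (snd p)"

definition metric :: "('n::finite, 'r::finite) pt \<Rightarrow> 'n tvec \<Rightarrow> 'n tvec \<Rightarrow> real" where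
  "metric p \<xi> \<zeta> = gmetric (fst p) (fst \<xi>) (fst \<zeta>) + gmetric (snd p) (snd \<xi>) (snd \<zeta>)"

definition tnorm :: "('n::finite, 'r::finite) pt \<Rightarrow> 'n tvec \<Rightarrow> real" where
  "tnorm p \<xi> = sqrt (metric p \<xi> \<xi>)"

text \<open>The differential of \<open>F\<close> at \<open>p\<close>, given by the chain rule
  \<open>D(F \<circ> q)(z) h = DF(q z) (Dq(z) h)\<close> for the submersion \<open>q\<close> = \<^const>\<open>range_of2\<close>; for \<open>F\<close>
  differentiable at \<open>p\<close> the value does not depend on the choice of \<open>z\<close> and \<open>h\<close>.\<close>

definition mderiv :: "(('n::finite, 'r::finite) pt \<Rightarrow> 'b::real_normed_vector) \<Rightarrow> ('n::finite, 'r::finite) pt \<Rightarrow> 'n tvec \<Rightarrow> 'b" where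
  "mderiv F p \<xi> = (let (z, h) = (SOME (z, h). z \<in> full_rank \<times> full_rank \<and> range_of2 z = p \<and>
       D_range_of2 z h = \<xi>)
     in frechet_derivative (\<lambda>z. F (range_of2 z)) (at z) h)"

definition C_k_near :: "nat \<Rightarrow> ('n::finite, 'r::finite) pt \<Rightarrow> (('n::finite, 'r::finite) pt \<Rightarrow> 'b::real_normed_vector) \<Rightarrow> bool" where
  "C_k_near k p F \<longleftrightarrow> (\<exists>U. open U \<and> p \<in> U \<and>
     C_k k {z \<in> full_rank \<times> full_rank. range_of2 z \<in> U} (\<lambda>z. F (range_of2 z)))"

definition C1_field_near :: "('n::finite, 'r::finite) pt \<Rightarrow> (('n::finite, 'r::finite) pt \<Rightarrow> 'n tvec) \<Rightarrow> bool" where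
  "C1_field_near p X \<longleftrightarrow> C_k_near 1 p X \<and> (\<exists>U. open U \<and> p \<in> U \<and> (\<forall>q\<in>U. X q \<in> tangent q))"

definition grad :: "(('n::finite, 'r::finite) pt \<Rightarrow> real) \<Rightarrow> ('n::finite, 'r::finite) pt \<Rightarrow> 'n tvec" where
  "grad F p = (THE \<xi>. \<xi> \<in> tangent p \<and> (\<forall>\<zeta>\<in>tangent p. metric p \<xi> \<zeta> = mderiv F p \<zeta>))"

section \<open>Riemannian connection, geodesics, parallel translation\<close>

text \<open>\<open>nabla p \<xi> Y\<close> stands for \<open>(\<nabla>\<^sub>\<xi> Y)(p)\<close>. The fields are of class \<open>C\<^sup>1\<close> near \<open>p\<close> only, since
  this is all that holds for the gradient of a \<open>C\<^sup>2\<close> cost defined on an open subset. The last two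
  conditions are vanishing torsion, with the Lie bracket acting on functions, and compatibility
  with the metric; they determine \<open>nabla p \<xi> Y\<close> for \<open>\<xi>\<close> tangent and \<open>Y\<close> of class \<open>C\<^sup>1\<close> near \<open>p\<close>.\<close>

type_synonym ('n, 'r) conn = "('n, 'r) pt \<Rightarrow> 'n tvec \<Rightarrow> (('n, 'r) pt \<Rightarrow> 'n tvec) \<Rightarrow> 'n tvec"

definition riemannian_connection :: "('n::finite, 'r::finite) conn \<Rightarrow> bool" where
  "riemannian_connection nabla \<longleftrightarrow> (\<forall>p.
     (\<forall>\<xi>\<in>tangent p. \<forall>Y. C1_field_near p Y \<longrightarrow> nabla p \<xi> Y \<in> tangent p) \<and>
     (\<forall>\<xi>\<in>tangent p. \<forall>\<zeta>\<in>tangent p. \<forall>a b Y. C1_field_near p Y \<longrightarrow>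
        nabla p (a *\<^sub>R \<xi> + b *\<^sub>R \<zeta>) Y = a *\<^sub>R nabla p \<xi> Y + b *\<^sub>R nabla p \<zeta> Y) \<and>
     (\<forall>\<xi>\<in>tangent p. \<forall>Y Z. C1_field_near p Y \<longrightarrow> C1_field_near p Z \<longrightarrow>
        nabla p \<xi> (\<lambda>q. Y q + Z q) = nabla p \<xi> Y + nabla p \<xi> Z) \<and>
     (\<forall>\<xi>\<in>tangent p. \<forall>\<phi> Y. C_k_near 1 p \<phi> \<longrightarrow> C1_field_near p Y \<longrightarrow>
        nabla p \<xi> (\<lambda>q. \<phi> q *\<^sub>R Y q) = mderiv \<phi> p \<xi> *\<^sub>R Y p + \<phi> p *\<^sub>R nabla p \<xi> Y) \<and>
     (\<forall>X Y (\<phi> :: _ \<Rightarrow> real). C1_field_near p X \<longrightarrow> C1_field_near p Y \<longrightarrow> C_k_near 2 p \<phi> \<longrightarrow>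
        mderiv \<phi> p (nabla p (X p) Y - nabla p (Y p) X) =
          mderiv (\<lambda>q. mderiv \<phi> q (Y q)) p (X p) - mderiv (\<lambda>q. mderiv \<phi> q (X q)) p (Y p)) \<and>
     (\<forall>\<xi>\<in>tangent p. \<forall>Y Z. C1_field_near p Y \<longrightarrow> C1_field_near p Z \<longrightarrow>
        mderiv (\<lambda>q. metric q (Y q) (Z q)) p \<xi> =
          metric p (nabla p \<xi> Y) (Z p) + metric p (Y p) (nabla p \<xi> Z)))"

definition velocity :: "real set \<Rightarrow> (real \<Rightarrow> ('n::finite, 'r::finite) pt) \<Rightarrow> real \<Rightarrow> 'n tvec" where
  "velocity I \<gamma> t = vector_derivative (\<lambda>s. embed (\<gamma> s)) (at t within I)"

text \<open>\<open>v\<close> is the covariant derivative at \<open>t\<close> of the vector field \<open>\<zeta>\<close> along the curve \<open>\<gamma>\<close>: if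
  \<open>\<zeta> = \<Sum>\<^sub>i a\<^sub>i (E\<^sub>i \<circ> \<gamma>)\<close> near \<open>t\<close>, then \<open>v = \<Sum>\<^sub>i (a\<^sub>i' E\<^sub>i + a\<^sub>i \<nabla>\<^bsub>\<gamma>'\<^esub> E\<^sub>i)\<close>.\<close>

definition has_covariant_deriv ::
  "('n::finite, 'r::finite) conn \<Rightarrow> real set \<Rightarrow> (real \<Rightarrow> ('n::finite, 'r::finite) pt) \<Rightarrow> (real \<Rightarrow> 'n tvec) \<Rightarrow> 'n tvec \<Rightarrow> real \<Rightarrow> bool" where
  "has_covariant_deriv nabla I \<gamma> \<zeta> v t \<longleftrightarrow>
     (\<exists>(N::nat) a a' E.
        (\<forall>i<N. C1_field_near (\<gamma> t) (E i) \<and> (a i has_real_derivative a' i) (at t within I)) \<and>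
        (\<exists>\<delta>>0. \<forall>s\<in>I. \<bar>s - t\<bar> < \<delta> \<longrightarrow> \<zeta> s = (\<Sum>i<N. a i s *\<^sub>R E i (\<gamma> s))) \<and>
        v = (\<Sum>i<N. a' i *\<^sub>R E i (\<gamma> t) + a i t *\<^sub>R nabla (\<gamma> t) (velocity I \<gamma> t) (E i)))"

definition geodesic :: "('n::finite, 'r::finite) conn \<Rightarrow> real set \<Rightarrow> (real \<Rightarrow> ('n::finite, 'r::finite) pt) \<Rightarrow> bool" where
  "geodesic nabla I \<gamma> \<longleftrightarrow>
     (\<forall>t\<in>I. (\<lambda>s. embed (\<gamma> s)) differentiable (at t within I) \<and>
        has_covariant_deriv nabla I \<gamma> (velocity I \<gamma>) 0 t)"

definition mexp :: "('n::finite, 'r::finite) conn \<Rightarrow> ('n::finite, 'r::finite) pt \<Rightarrow> 'n tvec \<Rightarrow> ('n::finite, 'r::finite) pt" where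
  "mexp nabla p \<xi> = (THE q. \<exists>\<gamma>. geodesic nabla {0..1} \<gamma> \<and> \<gamma> 0 = p \<and> velocity {0..1} \<gamma> 0 = \<xi> \<and> \<gamma> 1 = q)"

definition parallel_transl :: "('n::finite, 'r::finite) conn \<Rightarrow> ('n::finite, 'r::finite) pt \<Rightarrow> 'n tvec \<Rightarrow> 'n tvec \<Rightarrow> 'n tvec" where
  "parallel_transl nabla p \<eta> \<xi> = (THE v. \<exists>\<zeta>.
     (\<forall>t\<in>{0..1}. \<zeta> t \<in> tangent (mexp nabla p (t *\<^sub>R \<eta>)) \<and>
        has_covariant_deriv nabla {0..1} (\<lambda>s. mexp nabla p (s *\<^sub>R \<eta>)) \<zeta> 0 t) \<and>
     \<zeta> 0 = \<xi> \<and> \<zeta> 1 = v)"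

section \<open>Full-order model, reduced-order model and cost\<close>

definition fom_solution ::
  "(real ^ 'n \<Rightarrow> real ^ 'd \<Rightarrow> real ^ 'n) \<Rightarrow> (real \<Rightarrow> real ^ 'd) \<Rightarrow> real ^ 'n \<Rightarrow> real \<Rightarrow> real \<Rightarrow>
   (real \<Rightarrow> real ^ 'n) \<Rightarrow> bool" where
  "fom_solution f u x0 t0 t1 x \<longleftrightarrow> x t0 = x0 \<and>
     (\<forall>t\<in>{t0..t1}. (x has_vector_derivative f (x t) (u t)) (at t within {t0..t1}))"

definition rom_solution ::
  "(real ^ 'n \<Rightarrow> real ^ 'd \<Rightarrow> real ^ 'n) \<Rightarrow> (real \<Rightarrow> real ^ 'd) \<Rightarrow> real ^ 'n \<Rightarrow> real \<Rightarrow> real \<Rightarrow>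
   ('n::finite, 'r::finite) pt \<Rightarrow> (real \<Rightarrow> real ^ 'n) \<Rightarrow> bool" where
  "rom_solution f u x0 t0 t1 p x \<longleftrightarrow>
     (let P = oblique_proj (space_of (fst p)) (space_of (snd p)) in
       x t0 = P *v x0 \<and>
       (\<forall>t\<in>{t0..t1}. (x has_vector_derivative P *v f (x t) (u t)) (at t within {t0..t1})))"

definition admissible_pairs :: "('n::finite, 'r::finite) pt set" where
  "admissible_pairs = {(V, W). space_of V \<inter> orthogonal_comp (space_of W) = {0} \<and>
     {v + w |v w. v \<in> space_of V \<and> w \<in> orthogonal_comp (space_of W)} = UNIV}"

definition rom_domain ::
  "(real ^ 'n \<Rightarrow> real ^ 'd \<Rightarrow> real ^ 'n) \<Rightarrow> (real \<Rightarrow> real ^ 'd) \<Rightarrow> real ^ 'n \<Rightarrow> real \<Rightarrow> real \<Rightarrow>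
   ('n::finite, 'r::finite) pt set" where
  "rom_domain f u x0 t0 t1 = {p \<in> admissible_pairs.
     \<exists>x. rom_solution f u x0 t0 t1 p x \<and>
       (\<forall>z. rom_solution f u x0 t0 t1 p z \<longrightarrow> (\<forall>t\<in>{t0..t1}. z t = x t))}"

definition rom_state ::
  "(real ^ 'n \<Rightarrow> real ^ 'd \<Rightarrow> real ^ 'n) \<Rightarrow> (real \<Rightarrow> real ^ 'd) \<Rightarrow> real ^ 'n \<Rightarrow> real \<Rightarrow> real \<Rightarrow>
   ('n::finite, 'r::finite) pt \<Rightarrow> real \<Rightarrow> real ^ 'n" where
  "rom_state f u x0 t0 t1 p = (SOME x. rom_solution f u x0 t0 t1 p x)"

definition regularizer :: "('n::finite, 'r::finite) pt \<Rightarrow> real" where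
  "regularizer p = (let \<Phi> = some_basis (fst p); \<Psi> = some_basis (snd p) in
     - ln ((det (transpose \<Psi> ** \<Phi>))\<^sup>2 / (det (transpose \<Phi> ** \<Phi>) * det (transpose \<Psi> ** \<Psi>))))"

text \<open>Only the values on \<^const>\<open>rom_domain\<close> are meaningful.\<close>

definition cost ::
  "(real ^ 'n \<Rightarrow> real ^ 'd \<Rightarrow> real ^ 'n) \<Rightarrow> (real ^ 'n \<Rightarrow> real ^ 'm) \<Rightarrow> (real \<Rightarrow> real ^ 'd) \<Rightarrow> real ^ 'n \<Rightarrow>
   nat \<Rightarrow> (nat \<Rightarrow> real) \<Rightarrow> (nat \<Rightarrow> real ^ 'm) \<Rightarrow> (real ^ 'm \<Rightarrow> real) \<Rightarrow> real \<Rightarrow> ('n::finite, 'r::finite) pt \<Rightarrow> real" where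
  "cost f g u x0 L ts y Ly \<kappa> p =
     1 / real L * (\<Sum>l<L. Ly (g (rom_state f u x0 (ts 0) (ts (L - 1)) p (ts l)) - y l)) +
     \<kappa> * regularizer p"

section \<open>The conjugate gradient algorithm\<close>

definition wolfe :: "real \<Rightarrow> real \<Rightarrow> (real \<Rightarrow> real) \<Rightarrow> real \<Rightarrow> bool" where
  "wolfe c1 c2 j \<alpha> \<longleftrightarrow> j \<alpha> \<le> j 0 + c1 * \<alpha> * deriv j 0 \<and> deriv j \<alpha> \<ge> c2 * deriv j 0"

definition dai_yuan_denom ::
  "('n::finite, 'r::finite) conn \<Rightarrow> (('n::finite, 'r::finite) pt \<Rightarrow> real) \<Rightarrow> ('n::finite, 'r::finite) pt \<Rightarrow> 'n tvec \<Rightarrow> real \<Rightarrow> ('n::finite, 'r::finite) pt \<Rightarrow> real" where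
  "dai_yuan_denom nabla J p \<eta> \<alpha> p' =
     metric p' (grad J p') (parallel_transl nabla p (\<alpha> *\<^sub>R \<eta>) \<eta>) - metric p (grad J p) \<eta>"

definition dai_yuan ::
  "('n::finite, 'r::finite) conn \<Rightarrow> (('n::finite, 'r::finite) pt \<Rightarrow> real) \<Rightarrow> ('n::finite, 'r::finite) pt \<Rightarrow> 'n tvec \<Rightarrow> real \<Rightarrow> ('n::finite, 'r::finite) pt \<Rightarrow> real" where
  "dai_yuan nabla J p \<eta> \<alpha> p' = metric p' (grad J p') (grad J p') / dai_yuan_denom nabla J p \<eta> \<alpha> p'"

text \<open>The nonzero denominators express that the algorithm does not stop; they rule out vanishing
  gradients, since \<open>grad J (p k) = 0\<close> gives \<open>\<eta> k = 0\<close> and hence a zero denominator in step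
  \<open>k + 1\<close>.\<close>

definition geometric_cg ::
  "('n::finite, 'r::finite) conn \<Rightarrow> (('n::finite, 'r::finite) pt \<Rightarrow> real) \<Rightarrow> ('n::finite, 'r::finite) pt set \<Rightarrow> real \<Rightarrow> real \<Rightarrow>
   (nat \<Rightarrow> ('n::finite, 'r::finite) pt) \<Rightarrow> (nat \<Rightarrow> 'n tvec) \<Rightarrow> (nat \<Rightarrow> real) \<Rightarrow> bool" where
  "geometric_cg nabla J D c1 c2 p \<eta> \<alpha> \<longleftrightarrow>
     p 0 \<in> D \<and> \<eta> 0 = - grad J (p 0) \<and>
     (\<forall>k. \<alpha> k \<ge> 0 \<and> wolfe c1 c2 (\<lambda>a. J (mexp nabla (p k) (a *\<^sub>R \<eta> k))) (\<alpha> k) \<and>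
        p (Suc k) = mexp nabla (p k) (\<alpha> k *\<^sub>R \<eta> k) \<and>
        dai_yuan_denom nabla J (p k) (\<eta> k) (\<alpha> k) (p (Suc k)) \<noteq> 0 \<and>
        \<eta> (Suc k) = - grad J (p (Suc k)) +
          dai_yuan nabla J (p k) (\<eta> k) (\<alpha> k) (p (Suc k)) *\<^sub>R
            parallel_transl nabla (p k) (\<alpha> k *\<^sub>R \<eta> k) (\<eta> k))"

definition hess_norms ::
  "('n::finite, 'r::finite) conn \<Rightarrow> (('n::finite, 'r::finite) pt \<Rightarrow> real) \<Rightarrow> ('n::finite, 'r::finite) pt set \<Rightarrow> real set" where
  "hess_norms nabla J K = {tnorm p (nabla p \<xi> (grad J)) |p \<xi>. p \<in> K \<and> \<xi> \<in> tangent p \<and> tnorm p \<xi> = 1}"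

end

theory Submission
  imports Defs
begin

text \<open>A subspace is identified with its orthogonal projector \<open>P\<close>. Tangent vectors at \<open>P\<close> are then
  the symmetric matrices \<open>\<xi>\<close> with \<open>\<xi> P + P \<xi> = \<xi>\<close>, the metric is half the Frobenius inner
  product, and the Riemannian connection is the orthogonal projection of the ordinary derivative
  onto the tangent space. Hence \<open>[\<gamma>', \<gamma>]\<close> is constant along a geodesic, which is therefore
  the orbit of \<open>\<gamma>(0)\<close> under the rotations \<open>exp (t \<Omega>)\<close> with \<open>\<Omega> = [\<gamma>'(0), \<gamma>(0)]\<close>, and its
  velocity is the parallel translate of \<open>\<gamma>'(0)\<close>.

  The cost is \<open>C\<^sup>2\<close> near every point of its domain, because solutions of an initial value problem
  depend on the data as smoothly as the right-hand side does. On the compact set, the Hessian attains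
  its maximal norm, which bounds the change of the slope along a geodesic. With the Wolfe conditions
  this gives Zoutendijk's condition \<open>\<Sum> \<langle>g\<^sub>k, \<eta>\<^sub>k\<rangle>\<^sup>2 / |\<eta>\<^sub>k|\<^sup>2 < \<infinity>\<close>. For the Dai-Yuan
  coefficient and isometric transport, \<open>|\<eta>\<^sub>k|\<^sup>2 / \<langle>g\<^sub>k, \<eta>\<^sub>k\<rangle>\<^sup>2 \<le> \<Sum>\<^bsub>i\<le>k\<^esub> 1 / |g\<^sub>i|\<^sup>2\<close>, and
  gradients bounded away from zero would contradict the divergence of the harmonic series.\<close>

section \<open>Calculus of continuous directional derivatives\<close>

text \<open>The manifold notions are defined through frames, through choices (\<open>THE\<close>,
  \<open>SOME\<close>) and an abstract connection, so the description by matrices must first be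
  shown to agree with them. The link is a local inverse of \<open>range_of2\<close>: projecting a
  fixed frame pair \<open>z\<close> onto nearby subspaces gives a frame pair
  \<open>act (embed q) z\<close> of \<open>q\<close>. Through it, regularity and derivatives on the
  manifold become those of functions of matrices, whatever frames were chosen. Two obstacles shape
  the analysis. The right-hand side of the model is differentiable in the state but only known to be
  continuous in time, whence derivatives along prescribed directions. Geodesics live on
  \<open>{0..1}\<close> with one-sided derivatives at the ends, while the slopes in the Wolfe
  conditions are two-sided even at step size 0; therefore the rotations are shown to be
  differentiable in their generator. Parameters, such as the projector of the reduced model or the
  generator of a rotation, are adjoined to the state as constant components, so that one theorem on
  initial values covers them.\<close>

lemma C_dirs_imp_continuous_on: "C_dirs B k S F \<Longrightarrow> continuous_on S F"
  by (cases k) auto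

lemma C_dirs_SucD: "C_dirs B (Suc k) S F \<Longrightarrow> C_dirs B k S F"
proof (induction k arbitrary: F)
  case (Suc k)
  show ?case
    unfolding C_dirs.simps(2)[of B k]
  proof (intro conjI ballI)
    show "continuous_on S F" using Suc.prems by simp
    fix b assume "b \<in> B"
    then obtain F' where "\<forall>x\<in>S. ((\<lambda>s. F (x + s *\<^sub>R b)) has_vector_derivative F' x) (at 0)"
      "C_dirs B (Suc k) S F'"
      using Suc.prems unfolding C_dirs.simps(2)[of B "Suc k"] by blast
    then show "\<exists>F'. (\<forall>x\<in>S. ((\<lambda>s. F (x + s *\<^sub>R b)) has_vector_derivative F' x) (at 0)) \<and> C_dirs B k S F'"
      using Suc.IH by blast
  qed
qed auto

lemma C_dirs_le: "C_dirs B k S F \<Longrightarrow> j \<le> k \<Longrightarrow> C_dirs B j S F"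
  by (induction k) (auto simp: le_Suc_eq dest: C_dirs_SucD simp del: C_dirs.simps)

lemma C_dirs_subset: "C_dirs B k S F \<Longrightarrow> T \<subseteq> S \<Longrightarrow> C_dirs B k T F"
proof (induction k arbitrary: F)
  case 0
  then show ?case by (auto intro: continuous_on_subset)
next
  case (Suc k)
  show ?case
    unfolding C_dirs.simps(2)
  proof (intro conjI ballI)
    show "continuous_on T F" using Suc.prems by (auto intro: continuous_on_subset)
    fix b assume "b \<in> B"
    then obtain F' where "\<forall>x\<in>S. ((\<lambda>s. F (x + s *\<^sub>R b)) has_vector_derivative F' x) (at 0)"
      "C_dirs B k S F'"
      using Suc.prems unfolding C_dirs.simps(2) by blast
    then show "\<exists>F'. (\<forall>x\<in>T. ((\<lambda>s. F (x + s *\<^sub>R b)) has_vector_derivative F' x) (at 0)) \<and> C_dirs B k T F'"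
      using Suc.IH Suc.prems(2) by blast
  qed
qed

lemma C_dirs_SucI:
  assumes "continuous_on S F"
    and "\<And>b. b \<in> B \<Longrightarrow> \<exists>F'. (\<forall>x\<in>S. ((\<lambda>s. F (x + s *\<^sub>R b)) has_vector_derivative F' x) (at 0)) \<and> C_dirs B k S F'"
  shows "C_dirs B (Suc k) S F"
  using assms by simp

lemma C_dirs_SucE:
  assumes "C_dirs B (Suc k) S F" "b \<in> B"
  obtains F' where "\<And>x. x \<in> S \<Longrightarrow> ((\<lambda>s. F (x + s *\<^sub>R b)) has_vector_derivative F' x) (at 0)"
    "C_dirs B k S F'"
  using assms unfolding C_dirs.simps(2) by blast

text \<open>Derivatives depend on values near a point, and openness of \<open>S\<close> makes
  equality on \<open>S\<close> enough: the line \<open>x + s *\<^sub>R b\<close> stays in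
  \<open>S\<close> for small \<open>s\<close>. The derivative of \<open>F\<close> then serves for
  \<open>G\<close> unchanged, without an induction.\<close>

lemma C_dirs_cong:
  assumes "open S" "\<And>x. x \<in> S \<Longrightarrow> F x = G x" "C_dirs B k S F"
  shows "C_dirs B k S G"
proof (cases k)
  case 0
  then show ?thesis using assms continuous_on_cong[of S S F G] by auto
next
  case (Suc j)
  show ?thesis
    unfolding Suc
  proof (rule C_dirs_SucI)
    show "continuous_on S G"
      using assms continuous_on_cong[of S S F G] C_dirs_imp_continuous_on by blast
    fix b assume "b \<in> B"
    obtain F' where F': "\<And>x. x \<in> S \<Longrightarrow> ((\<lambda>s. F (x + s *\<^sub>R b)) has_vector_derivative F' x) (at 0)"
      "C_dirs B j S F'"
      using C_dirs_SucE[OF assms(3)[unfolded Suc] \<open>b \<in> B\<close>] by blast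
    have "((\<lambda>s. G (x + s *\<^sub>R b)) has_vector_derivative F' x) (at 0)" if "x \<in> S" for x
    proof (rule has_vector_derivative_transform_within_open[OF F'(1)[OF that], of "(\<lambda>s. x + s *\<^sub>R b) -` S"])
      show "open ((\<lambda>s. x + s *\<^sub>R b) -` S)"
        by (intro continuous_open_vimage assms(1) allI continuous_intros)
    qed (use that assms(2) in auto)
    then show "\<exists>F'. (\<forall>x\<in>S. ((\<lambda>s. G (x + s *\<^sub>R b)) has_vector_derivative F' x) (at 0)) \<and> C_dirs B j S F'"
      using F'(2) by blast
  qed
qed

lemma C_dirs_const: "C_dirs B k S (\<lambda>x. c)"
proof (induction k arbitrary: c)
  case (Suc k)
  then show ?case by (intro C_dirs_SucI exI[of _ "\<lambda>x. 0"]) (auto intro: derivative_eq_intros)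
qed simp

lemma C_dirs_add: "C_dirs B k S F \<Longrightarrow> C_dirs B k S G \<Longrightarrow> C_dirs B k S (\<lambda>x. F x + G x)"
proof (induction k arbitrary: F G)
  case 0
  then show ?case by (auto intro: continuous_intros)
next
  case (Suc k)
  show ?case
  proof (rule C_dirs_SucI)
    show "continuous_on S (\<lambda>x. F x + G x)"
      using Suc.prems by (auto intro: continuous_intros)
    fix b assume b: "b \<in> B"
    obtain F' where F': "\<And>x. x \<in> S \<Longrightarrow> ((\<lambda>s. F (x + s *\<^sub>R b)) has_vector_derivative F' x) (at 0)"
      "C_dirs B k S F'" using C_dirs_SucE[OF Suc.prems(1) b] by blast
    obtain G' where G': "\<And>x. x \<in> S \<Longrightarrow> ((\<lambda>s. G (x + s *\<^sub>R b)) has_vector_derivative G' x) (at 0)"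
      "C_dirs B k S G'" using C_dirs_SucE[OF Suc.prems(2) b] by blast
    show "\<exists>H. (\<forall>x\<in>S. ((\<lambda>s. F (x + s *\<^sub>R b) + G (x + s *\<^sub>R b)) has_vector_derivative H x) (at 0)) \<and> C_dirs B k S H"
      using Suc.IH[OF F'(2) G'(2)] F'(1) G'(1)
      by (intro exI[of _ "\<lambda>x. F' x + G' x"]) (auto intro: has_vector_derivative_add)
  qed
qed

lemma C_dirs_sum: "(\<And>i. i \<in> I \<Longrightarrow> C_dirs B k S (F i)) \<Longrightarrow> C_dirs B k S (\<lambda>x. \<Sum>i\<in>I. F i x)"
  by (induction I rule: infinite_finite_induct) (auto simp del: C_dirs.simps intro: C_dirs_const C_dirs_add)

lemma C_dirs_linear_comp:
  assumes "bounded_linear A"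
  shows "C_dirs B k S F \<Longrightarrow> C_dirs B k S (\<lambda>x. A (F x))"
proof (induction k arbitrary: F)
  case 0
  then show ?case using assms by (auto intro: bounded_linear.continuous_on)
next
  case (Suc k)
  show ?case
  proof (rule C_dirs_SucI)
    show "continuous_on S (\<lambda>x. A (F x))"
      using Suc.prems assms by (auto intro: bounded_linear.continuous_on)
    fix b assume b: "b \<in> B"
    obtain F' where F': "\<And>x. x \<in> S \<Longrightarrow> ((\<lambda>s. F (x + s *\<^sub>R b)) has_vector_derivative F' x) (at 0)"
      "C_dirs B k S F'" using C_dirs_SucE[OF Suc.prems(1) b] by blast
    show "\<exists>H. (\<forall>x\<in>S. ((\<lambda>s. A (F (x + s *\<^sub>R b))) has_vector_derivative H x) (at 0)) \<and> C_dirs B k S H"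
      using Suc.IH[OF F'(2)] F'(1) bounded_linear.has_vector_derivative[OF assms]
      by (intro exI[of _ "\<lambda>x. A (F' x)"]) auto
  qed
qed

lemma C_dirs_bilinear:
  assumes "bounded_bilinear m"
  shows "C_dirs B k S F \<Longrightarrow> C_dirs B k S G \<Longrightarrow> C_dirs B k S (\<lambda>x. m (F x) (G x))"
proof (induction k arbitrary: F G)
  case 0
  then show ?case using assms by (auto intro: bounded_bilinear.continuous_on)
next
  case (Suc k)
  show ?case
  proof (rule C_dirs_SucI)
    show "continuous_on S (\<lambda>x. m (F x) (G x))"
      using Suc.prems assms by (auto intro: bounded_bilinear.continuous_on)
    fix b assume b: "b \<in> B"
    obtain F' where F': "\<And>x. x \<in> S \<Longrightarrow> ((\<lambda>s. F (x + s *\<^sub>R b)) has_vector_derivative F' x) (at 0)"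
      "C_dirs B k S F'" using C_dirs_SucE[OF Suc.prems(1) b] by blast
    obtain G' where G': "\<And>x. x \<in> S \<Longrightarrow> ((\<lambda>s. G (x + s *\<^sub>R b)) has_vector_derivative G' x) (at 0)"
      "C_dirs B k S G'" using C_dirs_SucE[OF Suc.prems(2) b] by blast
    have "((\<lambda>s. m (F (x + s *\<^sub>R b)) (G (x + s *\<^sub>R b))) has_vector_derivative m (F x) (G' x) + m (F' x) (G x)) (at 0)"
      if "x \<in> S" for x
      using bounded_bilinear.has_vector_derivative[OF assms F'(1)[OF that] G'(1)[OF that]] by simp
    moreover have "C_dirs B k S (\<lambda>x. m (F x) (G' x) + m (F' x) (G x))"
      using Suc.IH F'(2) G'(2) Suc.prems[THEN C_dirs_SucD] by (intro C_dirs_add) auto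
    ultimately show "\<exists>H. (\<forall>x\<in>S. ((\<lambda>s. m (F (x + s *\<^sub>R b)) (G (x + s *\<^sub>R b))) has_vector_derivative H x) (at 0)) \<and> C_dirs B k S H"
      by (intro exI[of _ "\<lambda>x. m (F x) (G' x) + m (F' x) (G x)"]) auto
  qed
qed

lemmas C_dirs_mult = C_dirs_bilinear[OF bounded_bilinear_mult]
  and C_dirs_scaleR = C_dirs_bilinear[OF bounded_bilinear_scaleR]

lemma C_dirs_minus: "C_dirs B k S F \<Longrightarrow> C_dirs B k S (\<lambda>x. - F x)"
  by (rule C_dirs_linear_comp[OF bounded_linear_minus[OF bounded_linear_ident]])

lemma C_dirs_diff: "C_dirs B k S F \<Longrightarrow> C_dirs B k S G \<Longrightarrow> C_dirs B k S (\<lambda>x. F x - G x)"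
  using C_dirs_add[OF _ C_dirs_minus, of B k S F G] by simp

lemma C_dirs_bounded_linear: "bounded_linear A \<Longrightarrow> C_dirs B k S A"
proof (cases k)
  case (Suc j)
  assume A: "bounded_linear A"
  show ?thesis
    unfolding Suc
  proof (rule C_dirs_SucI)
    show "continuous_on S A" using A by (rule linear_continuous_on)
    fix b
    interpret bounded_linear A by fact
    have "((\<lambda>s. A x + s *\<^sub>R A b) has_vector_derivative A b) (at 0)" for x
      by (auto intro!: derivative_eq_intros)
    then show "\<exists>F'. (\<forall>x\<in>S. ((\<lambda>s. A (x + s *\<^sub>R b)) has_vector_derivative F' x) (at 0)) \<and> C_dirs B j S F'"
      by (intro exI[of _ "\<lambda>x. A b"]) (auto simp: add scaleR intro: C_dirs_const)
  qed
qed (auto intro: linear_continuous_on)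

text \<open>Changes the set of differentiation directions: each one in \<open>C\<close> is either
  carried to a direction in \<open>B\<close> or does not move \<open>A x\<close> at all, and then
  the derivative is 0. This moves a vector field to a state space with further components and
  freezes components of initial values.\<close>

lemma C_dirs_affine_comp:
  assumes A: "continuous_on T A" "A ` T \<subseteq> S"
    and lin: "\<And>x s c. c \<in> C \<Longrightarrow> A (x + s *\<^sub>R c) = A x + s *\<^sub>R A' c"
    and dir: "\<And>c. c \<in> C \<Longrightarrow> A' c \<in> B \<or> A' c = 0"
  shows "C_dirs B k S F \<Longrightarrow> C_dirs C k T (\<lambda>x. F (A x))"
proof (induction k arbitrary: F)
  case 0
  then show ?case using A by (auto intro: continuous_on_compose2)
next
  case (Suc k)
  show ?case
  proof (rule C_dirs_SucI)
    show "continuous_on T (\<lambda>x. F (A x))"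
      using Suc.prems A by (auto intro: continuous_on_compose2)
    fix c assume c: "c \<in> C"
    show "\<exists>F'. (\<forall>x\<in>T. ((\<lambda>s. F (A (x + s *\<^sub>R c))) has_vector_derivative F' x) (at 0)) \<and> C_dirs C k T F'"
    proof (cases "A' c = 0")
      case True
      then show ?thesis by (intro exI[of _ "\<lambda>x. 0"]) (auto simp: lin[OF c] intro: C_dirs_const)
    next
      case False
      then have "A' c \<in> B" using dir c by auto
      then obtain F' where F': "\<And>x. x \<in> S \<Longrightarrow> ((\<lambda>s. F (x + s *\<^sub>R A' c)) has_vector_derivative F' x) (at 0)"
        "C_dirs B k S F'" using C_dirs_SucE[OF Suc.prems(1)] by blast
      then show ?thesis using Suc.IH[OF F'(2)] A(2)
        by (intro exI[of _ "\<lambda>x. F' (A x)"]) (auto simp: lin[OF c])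
    qed
  qed
qed

lemma C_dirs_inverse:
  fixes F :: "'a::euclidean_space \<Rightarrow> real"
  assumes nz: "\<And>x. x \<in> S \<Longrightarrow> F x \<noteq> 0"
  shows "C_dirs B k S F \<Longrightarrow> C_dirs B k S (\<lambda>x. inverse (F x))"
proof (induction k)
  case 0
  then show ?case using nz by (auto intro: continuous_intros)
next
  case (Suc k)
  show ?case
  proof (rule C_dirs_SucI)
    show "continuous_on S (\<lambda>x. inverse (F x))"
      using Suc.prems nz by (auto intro: continuous_intros)
    fix b assume b: "b \<in> B"
    obtain F' where F': "\<And>x. x \<in> S \<Longrightarrow> ((\<lambda>s. F (x + s *\<^sub>R b)) has_vector_derivative F' x) (at 0)"
      "C_dirs B k S F'" using C_dirs_SucE[OF Suc.prems(1) b] by blast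
    have "((\<lambda>s. inverse (F (x + s *\<^sub>R b))) has_vector_derivative - (inverse (F x) * F' x * inverse (F x))) (at 0)"
      if "x \<in> S" for x
      using DERIV_inverse'[OF F'(1)[OF that, folded has_real_derivative_iff_has_vector_derivative]] nz[OF that]
      by (simp add: has_real_derivative_iff_has_vector_derivative)
    moreover have "C_dirs B k S (\<lambda>x. - (inverse (F x) * F' x * inverse (F x)))"
      using Suc.IH Suc.prems F'(2) by (intro C_dirs_minus C_dirs_mult) (auto dest: C_dirs_SucD simp del: C_dirs.simps)
    ultimately show "\<exists>H. (\<forall>x\<in>S. ((\<lambda>s. inverse (F (x + s *\<^sub>R b))) has_vector_derivative H x) (at 0)) \<and> C_dirs B k S H"
      by (intro exI[of _ "\<lambda>x. - (inverse (F x) * F' x * inverse (F x))"]) auto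
  qed
qed

lemma C_dirs_divide:
  fixes F G :: "'a::euclidean_space \<Rightarrow> real"
  assumes "\<And>x. x \<in> S \<Longrightarrow> G x \<noteq> 0" "C_dirs B k S F" "C_dirs B k S G"
  shows "C_dirs B k S (\<lambda>x. F x / G x)"
  unfolding divide_inverse using assms by (intro C_dirs_mult C_dirs_inverse)

lemma C_dirs_ln:
  fixes F :: "'a::euclidean_space \<Rightarrow> real"
  assumes pos: "\<And>x. x \<in> S \<Longrightarrow> F x > 0" and F: "C_dirs B k S F"
  shows "C_dirs B k S (\<lambda>x. ln (F x))"
proof -
  have "F x \<noteq> 0" if "x \<in> S" for x
    using pos[OF that] by simp
  then have cont: "continuous_on S (\<lambda>x. ln (F x))"
    using C_dirs_imp_continuous_on[OF F] by (intro continuous_on_ln) auto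
  show ?thesis
  proof (cases k)
    case 0
    then show ?thesis using cont by simp
  next
    case (Suc j)
    show ?thesis
      unfolding Suc
    proof (rule C_dirs_SucI)
      show "continuous_on S (\<lambda>x. ln (F x))" by (rule cont)
      fix b assume b: "b \<in> B"
      obtain F' where F': "\<And>x. x \<in> S \<Longrightarrow> ((\<lambda>s. F (x + s *\<^sub>R b)) has_vector_derivative F' x) (at 0)"
        "C_dirs B j S F'" using C_dirs_SucE[OF F[unfolded Suc] b] by blast
      have "((\<lambda>s. ln (F (x + s *\<^sub>R b))) has_vector_derivative F' x / F x) (at 0)"
        if "x \<in> S" for x
        using DERIV_chain2[OF DERIV_ln F'(1)[OF that, folded has_real_derivative_iff_has_vector_derivative]] pos[OF that]
        by (simp add: has_real_derivative_iff_has_vector_derivative divide_inverse mult.commute)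
      moreover have "C_dirs B j S (\<lambda>x. F' x / F x)"
        using F'(2) C_dirs_SucD[OF F[unfolded Suc]] pos by (intro C_dirs_divide) force+
      ultimately show "\<exists>H. (\<forall>x\<in>S. ((\<lambda>s. ln (F (x + s *\<^sub>R b))) has_vector_derivative H x) (at 0)) \<and> C_dirs B j S H"
        by (intro exI[of _ "\<lambda>x. F' x / F x"]) auto
    qed
  qed
qed

lemma C_dirs_prod:
  fixes F :: "'i \<Rightarrow> 'a::euclidean_space \<Rightarrow> real"
  shows "(\<And>i. i \<in> I \<Longrightarrow> C_dirs B k S (F i)) \<Longrightarrow> C_dirs B k S (\<lambda>x. \<Prod>i\<in>I. F i x)"
  by (induction I rule: infinite_finite_induct) (auto simp del: C_dirs.simps intro: C_dirs_const C_dirs_mult)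

lemma C_dirs_euclideanI:
  fixes F :: "'a::euclidean_space \<Rightarrow> 'b::euclidean_space"
  assumes "\<And>b. b \<in> Basis \<Longrightarrow> C_dirs B k S (\<lambda>x. F x \<bullet> b)"
  shows "C_dirs B k S F"
proof -
  have "C_dirs B k S (\<lambda>x. \<Sum>b\<in>Basis. (F x \<bullet> b) *\<^sub>R b)"
    using assms by (intro C_dirs_sum C_dirs_scaleR C_dirs_const)
  then show ?thesis by (simp add: euclidean_representation)
qed

lemma C_dirs_Pair:
  assumes "C_dirs B k S F" "C_dirs B k S G"
  shows "C_dirs B k S (\<lambda>x. (F x, G x))"
proof -
  have "C_dirs B k S (\<lambda>x. (F x, 0) + (0, G x))"
    using C_dirs_linear_comp[OF bounded_linear_Pair[OF bounded_linear_ident bounded_linear_zero] assms(1)]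
      C_dirs_linear_comp[OF bounded_linear_Pair[OF bounded_linear_zero bounded_linear_ident] assms(2)]
    by (intro C_dirs_add) auto
  then show ?thesis by simp
qed

lemmas C_dirs_fst = C_dirs_linear_comp[OF bounded_linear_fst]
  and C_dirs_snd = C_dirs_linear_comp[OF bounded_linear_snd]

section \<open>Determinants and inverse matrices\<close>

lemma C_dirs_det:
  fixes F :: "'a::euclidean_space \<Rightarrow> real ^ 'n ^ 'n"
  assumes "\<And>i j. C_dirs B k S (\<lambda>x. F x $ i $ j)"
  shows "C_dirs B k S (\<lambda>x. det (F x))"
  unfolding det_def using assms by (intro C_dirs_sum C_dirs_mult C_dirs_const C_dirs_prod)

lemma bounded_linear_entry: "bounded_linear (\<lambda>A::real ^ 'n ^ 'm. A $ i $ j)"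
  using bounded_linear_compose[OF bounded_linear_vec_nth bounded_linear_vec_nth] .

lemma C_dirs_matrixI:
  fixes F :: "'a::euclidean_space \<Rightarrow> real ^ 'n ^ 'm"
  assumes "\<And>i j. C_dirs B k S (\<lambda>x. F x $ i $ j)"
  shows "C_dirs B k S F"
proof (rule C_dirs_euclideanI)
  fix b :: "real ^ 'n ^ 'm" assume "b \<in> Basis"
  then obtain i j where "b = axis i (axis j 1)" by (auto simp: Basis_vec_def)
  then show "C_dirs B k S (\<lambda>x. F x \<bullet> b)" using assms[of i j] by (simp add: inner_axis)
qed

lemma matrix_inv_det:
  fixes A :: "real ^ 'n ^ 'n"
  assumes "det A \<noteq> 0"
  shows "A ** matrix_inv A = mat 1" "matrix_inv A ** A = mat 1"
proof -
  have "\<exists>A'. A ** A' = mat 1 \<and> A' ** A = mat 1"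
    using assms by (simp add: invertible_det_nz[symmetric] invertible_def)
  then have "A ** matrix_inv A = mat 1 \<and> matrix_inv A ** A = mat 1"
    unfolding matrix_inv_def by (rule someI_ex)
  then show "A ** matrix_inv A = mat 1" "matrix_inv A ** A = mat 1" by auto
qed

text \<open>By Cramer's rule the entries of the inverse are quotients of determinants, hence
  rational functions of the entries with denominator \<open>det (F x)\<close>.\<close>

lemma C_dirs_matrix_inv:
  fixes F :: "'a::euclidean_space \<Rightarrow> real ^ 'n ^ 'n"
  assumes "open S" and F: "C_dirs B k S F" and nz: "\<And>x. x \<in> S \<Longrightarrow> det (F x) \<noteq> 0"
  shows "C_dirs B k S (\<lambda>x. matrix_inv (F x))"
proof -
  have inv: "matrix_inv A $ l $ m = det (\<chi> i j. if j = l then axis m 1 $ i else A $ i $ j) / det A"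
    if "det A \<noteq> 0" for A :: "real ^ 'n ^ 'n" and l m
  proof -
    have "A ** matrix_inv A = mat 1"
      using that by (rule matrix_inv_det)
    then have "A *v (matrix_inv A *v axis m 1) = axis m 1"
      by (simp add: matrix_vector_mul_assoc)
    then have "matrix_inv A *v axis m 1 = (\<chi> l. det (\<chi> i j. if j = l then axis m 1 $ i else A $ i $ j) / det A)"
      using cramer[OF that] by blast
    then show ?thesis
      by (metis (no_types, lifting) column_def matrix_vector_mult_basis vec_lambda_beta)
  qed
  have entry: "C_dirs B k S (\<lambda>x. F x $ i $ j)" for i j
    by (rule C_dirs_linear_comp[OF bounded_linear_entry F])
  have *: "C_dirs B k S (\<lambda>x. (\<chi> i j. if j = l then axis m 1 $ i else F x $ i $ j) $ i $ j)" for l m i j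
    by (cases "j = l") (simp_all add: C_dirs_const entry del: C_dirs.simps)
  show ?thesis
  proof (rule C_dirs_matrixI)
    fix l m
    have "C_dirs B k S (\<lambda>x. det (\<chi> i j. if j = l then axis m 1 $ i else F x $ i $ j) / det (F x))"
      by (intro C_dirs_divide C_dirs_det nz * entry)
    then show "C_dirs B k S (\<lambda>x. matrix_inv (F x) $ l $ m)"
      by (rule C_dirs_cong[OF \<open>open S\<close>, rotated]) (simp add: inv nz)
  qed
qed

text \<open>The coordinates of \<open>h\<close> are added one after another. Each step moves along
  an axis, where the mean value inequality compares the increment with the partial derivative at
  \<open>x\<close>, using continuity of the partial derivatives.\<close>

lemma has_derivative_partials:
  fixes F :: "'a::euclidean_space \<Rightarrow> 'b::real_normed_vector"
  assumes S: "open S" "x \<in> S"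
    and F': "\<And>b y. b \<in> Basis \<Longrightarrow> y \<in> S \<Longrightarrow> ((\<lambda>s. F (y + s *\<^sub>R b)) has_vector_derivative F' b y) (at 0)"
    and cont: "\<And>b. b \<in> Basis \<Longrightarrow> continuous_on S (F' b)"
  shows "(F has_derivative (\<lambda>h. \<Sum>b\<in>Basis. (h \<bullet> b) *\<^sub>R F' b x)) (at x)"
proof -
  let ?T = "\<lambda>C h. x + (\<Sum>b\<in>C. (h \<bullet> b) *\<^sub>R b)"
  let ?D = "\<lambda>C h. \<Sum>b\<in>C. (h \<bullet> b) *\<^sub>R F' b x"
  have near: "\<exists>d>0. \<forall>h. norm h < d \<longrightarrow> norm (F (x + h) - F x - ?D Basis h) \<le> e * norm h" if "e > 0" for e
  proof -
    \<comment> \<open>The errors of \<open>DIM('a)\<close> coordinate steps add up to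
      \<open>e\<close>.\<close>
    define e' where "e' = e / DIM('a)"
    have "e' > 0" using that by (simp add: e'_def)
    have "\<forall>\<^sub>F y in nhds x. y \<in> S \<and> (\<forall>b\<in>Basis. norm (F' b y - F' b x) < e')"
    proof (intro eventually_conj eventually_ball_finite ballI)
      show "\<forall>\<^sub>F y in nhds x. y \<in> S" using S by (rule eventually_nhds_in_open)
      fix b :: 'a assume "b \<in> Basis"
      then have "(F' b \<longlongrightarrow> F' b x) (nhds x)"
        using cont[of b] S by (metis continuous_on_eq_continuous_at isContD tendsto_at_iff_tendsto_nhds)
      from tendstoD[OF this \<open>e' > 0\<close>] show "\<forall>\<^sub>F y in nhds x. norm (F' b y - F' b x) < e'"
        by (simp add: dist_norm)
    qed simp
    then obtain d where d: "d > 0" "\<And>y b. dist y x < d \<Longrightarrow> y \<in> S" 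
      "\<And>y b. dist y x < d \<Longrightarrow> b \<in> Basis \<Longrightarrow> norm (F' b y - F' b x) < e'"
      unfolding eventually_nhds_metric by blast
    \<comment> \<open>\<open>C\<close> is the set of coordinates already moved. The bound on
      \<open>h\<close> keeps all intermediate points within \<open>d\<close> of
      \<open>x\<close>.\<close>
    have step: "norm (F (?T C h) - F x - ?D C h) \<le> e' * (\<Sum>b\<in>C. \<bar>h \<bullet> b\<bar>)"
      if "C \<subseteq> Basis" and h: "norm h < d / DIM('a)" for C and h :: 'a
      using finite_subset[OF that(1) finite_Basis] that(1)
    proof (induction C rule: finite_induct)
      case (insert c C)
      let ?y = "?T C h"
      have seg: "dist (?y + s *\<^sub>R c) x < d" if s: "s \<in> closed_segment 0 (h \<bullet> c)" for s
      proof -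
        have sb: "\<bar>s\<bar> \<le> norm h"
          using s insert.prems Basis_le_norm[of c h] by (auto simp: closed_segment_eq_real_ivl split: if_splits)
        have "dist (?y + s *\<^sub>R c) x = norm ((\<Sum>b\<in>C. (h \<bullet> b) *\<^sub>R b) + s *\<^sub>R c)"
          by (simp add: dist_norm algebra_simps)
        also have "\<dots> \<le> (\<Sum>b\<in>C. norm ((h \<bullet> b) *\<^sub>R b)) + norm (s *\<^sub>R c)"
          by (intro norm_triangle_mono norm_sum order_refl)
        also have "\<dots> \<le> (\<Sum>b\<in>C. norm h) + norm h"
          using insert.prems Basis_le_norm[of _ h] sb by (intro add_mono sum_mono) auto
        also have "\<dots> = card (insert c C) * norm h"
          using insert.hyps by (simp add: algebra_simps)
        also have "\<dots> \<le> DIM('a) * norm h"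
          using insert.prems by (intro mult_right_mono) (auto intro!: card_mono)
        also have "\<dots> < d" using h by (simp add: field_simps)
        finally show ?thesis .
      qed
      have der: "((\<lambda>s. F (?y + s *\<^sub>R c)) has_vector_derivative F' c (?y + s *\<^sub>R c)) (at s within closed_segment 0 (h \<bullet> c))"
        if s: "s \<in> closed_segment 0 (h \<bullet> c)" for s
      proof -
        have "((\<lambda>r. F ((?y + s *\<^sub>R c) + r *\<^sub>R c)) has_vector_derivative F' c (?y + s *\<^sub>R c)) (at (s - s))"
          using F'[of c "?y + s *\<^sub>R c"] seg[OF s] d(2) insert.prems by simp
        then have "((\<lambda>r. F ((?y + s *\<^sub>R c) + (r - s) *\<^sub>R c)) has_vector_derivative 1 *\<^sub>R F' c (?y + s *\<^sub>R c)) (at s)"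
          using vector_diff_chain_at[of "\<lambda>r. r - s" 1 s "\<lambda>r. F ((?y + s *\<^sub>R c) + r *\<^sub>R c)"]
          by (fastforce simp: o_def intro!: derivative_eq_intros)
        then show ?thesis by (auto simp: algebra_simps intro: has_vector_derivative_at_within)
      qed
      have bnd: "norm (F' c (?y + s *\<^sub>R c) - F' c x) \<le> e'" if "s \<in> closed_segment 0 (h \<bullet> c)" for s
        using d(3)[OF seg[OF that], of c] insert.prems by force
      have der2: "((\<lambda>s. F (?y + s *\<^sub>R c) - s *\<^sub>R F' c x) has_derivative (\<lambda>r. r *\<^sub>R (F' c (?y + s *\<^sub>R c) - F' c x))) (at s within closed_segment 0 (h \<bullet> c))"
        if "s \<in> closed_segment 0 (h \<bullet> c)" for s
        using der[OF that] unfolding has_vector_derivative_def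
        by (auto intro!: derivative_eq_intros simp: algebra_simps)
      \<comment> \<open>Subtracting the linear part before applying the mean value inequality leaves
        a function with derivative at most \<open>e'\<close>.\<close>
      have "norm ((F (?y + (h \<bullet> c) *\<^sub>R c) - (h \<bullet> c) *\<^sub>R F' c x) - (F (?y + 0 *\<^sub>R c) - 0 *\<^sub>R F' c x)) \<le> e' * norm (h \<bullet> c - 0)"
      proof (rule differentiable_bound[OF _ der2])
        fix s assume "s \<in> closed_segment 0 (h \<bullet> c)"
        have "onorm (\<lambda>r. r *\<^sub>R (F' c (?y + s *\<^sub>R c) - F' c x)) \<le> norm (F' c (?y + s *\<^sub>R c) - F' c x)"
          by (rule onorm_le) (simp add: mult.commute)
        then show "onorm (\<lambda>r. r *\<^sub>R (F' c (?y + s *\<^sub>R c) - F' c x)) \<le> e'"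
          using bnd[OF \<open>s \<in> _\<close>] by linarith
      qed auto
      then have *: "norm (F (?y + (h \<bullet> c) *\<^sub>R c) - F ?y - (h \<bullet> c) *\<^sub>R F' c x) \<le> e' * \<bar>h \<bullet> c\<bar>"
        by (simp add: algebra_simps)
      have T: "?T (insert c C) h = ?y + (h \<bullet> c) *\<^sub>R c" using insert.hyps by (simp add: algebra_simps)
      have "norm (F (?T (insert c C) h) - F x - ?D (insert c C) h)
          = norm ((F (?y + (h \<bullet> c) *\<^sub>R c) - F ?y - (h \<bullet> c) *\<^sub>R F' c x) + (F ?y - F x - ?D C h))"
        unfolding T using insert.hyps by (simp add: algebra_simps)
      also have "\<dots> \<le> e' * \<bar>h \<bullet> c\<bar> + e' * (\<Sum>b\<in>C. \<bar>h \<bullet> b\<bar>)"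
        using * insert.IH insert.prems by (intro norm_triangle_mono) auto
      finally show ?case using insert.hyps by (simp add: algebra_simps)
    qed simp
    show ?thesis
    proof (intro exI[of _ "d / DIM('a)"] conjI allI impI)
      fix h :: 'a assume "norm h < d / DIM('a)"
      then have "norm (F (x + h) - F x - ?D Basis h) \<le> e' * (\<Sum>b\<in>Basis. \<bar>h \<bullet> b\<bar>)"
        using step[of Basis h] by (simp add: euclidean_representation)
      also have "\<dots> \<le> e' * (\<Sum>b\<in>(Basis::'a set). norm h)"
        using \<open>e' > 0\<close> by (intro mult_left_mono sum_mono) (auto simp: Basis_le_norm)
      also have "\<dots> = e * norm h" by (simp add: e'_def)
      finally show "norm (F (x + h) - F x - ?D Basis h) \<le> e * norm h" .
    qed (use d in simp)
  qed
  show ?thesis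
    unfolding has_derivative_at_alt
  proof (intro conjI allI impI)
    show "bounded_linear (\<lambda>h. ?D Basis h)"
      by (intro bounded_linear_sum bounded_linear_scaleR_const bounded_linear_inner_left)
    fix e :: real assume "0 < e"
    then obtain d where "d > 0" "\<forall>h. norm h < d \<longrightarrow> norm (F (x + h) - F x - ?D Basis h) \<le> e * norm h"
      using near by blast
    then show "\<exists>d>0. \<forall>y. norm (y - x) < d \<longrightarrow> norm (F y - F x - ?D Basis (y - x)) \<le> e * norm (y - x)"
      by (intro exI[of _ d]) (metis add.commute diff_add_cancel)
  qed
qed

lemma C_k_SucE:
  fixes F :: "'a::euclidean_space \<Rightarrow> 'b::real_normed_vector"
  assumes "C_k (Suc k) S F" "open S"
  obtains F' where "\<And>b. b \<in> Basis \<Longrightarrow> C_k k S (F' b)"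
    "\<And>x. x \<in> S \<Longrightarrow> (F has_derivative (\<lambda>h. \<Sum>b\<in>Basis. (h \<bullet> b) *\<^sub>R F' b x)) (at x)"
proof -
  have "\<forall>b\<in>Basis. \<exists>F'. (\<forall>x\<in>S. ((\<lambda>s. F (x + s *\<^sub>R b)) has_vector_derivative F' x) (at 0)) \<and> C_k k S F'"
    using assms(1) unfolding C_dirs.simps(2) by blast
  then obtain F' where F': "\<forall>b\<in>Basis. (\<forall>x\<in>S. ((\<lambda>s. F (x + s *\<^sub>R b)) has_vector_derivative F' b x) (at 0)) \<and> C_k k S (F' b)"
    unfolding bchoice_iff by blast
  show ?thesis
  proof (rule that)
    fix x assume "x \<in> S"
    with F' assms(2) show "(F has_derivative (\<lambda>h. \<Sum>b\<in>Basis. (h \<bullet> b) *\<^sub>R F' b x)) (at x)"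
      by (intro has_derivative_partials[where S = S]) (auto intro: C_dirs_imp_continuous_on)
  qed (use F' in blast)
qed

lemma C_k_SucI:
  fixes F :: "'a::euclidean_space \<Rightarrow> 'b::real_normed_vector"
  assumes der: "\<And>x. x \<in> S \<Longrightarrow> (F has_derivative F' x) (at x)"
    and F': "\<And>b. b \<in> Basis \<Longrightarrow> C_k k S (\<lambda>x. F' x b)"
  shows "C_k (Suc k) S F"
proof (rule C_dirs_SucI)
  show "continuous_on S F"
    using der by (meson continuous_at_imp_continuous_on has_derivative_continuous)
  fix b :: 'a assume "b \<in> Basis"
  have "((\<lambda>s. F (x + s *\<^sub>R b)) has_vector_derivative F' x b) (at 0)" if "x \<in> S" for x
  proof -
    interpret bounded_linear "F' x" using der[OF that] by (rule has_derivative_bounded_linear)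
    have "((\<lambda>s::real. x + s *\<^sub>R b) has_derivative (\<lambda>s. s *\<^sub>R b)) (at 0)"
      by (auto intro!: derivative_eq_intros)
    from has_derivative_compose[OF this, of F "F' x"] der[OF that]
    show ?thesis by (simp add: has_vector_derivative_def scaleR)
  qed
  with F'[OF \<open>b \<in> Basis\<close>]
  show "\<exists>F'. (\<forall>x\<in>S. ((\<lambda>s. F (x + s *\<^sub>R b)) has_vector_derivative F' x) (at 0)) \<and> C_k k S F'"
    by (intro exI[of _ "\<lambda>x. F' x b"]) auto
qed

text \<open>The inner function may move in any direction, so the outer one needs all its partial
  derivatives, while the inner one needs only those along \<open>B\<close>. The induction varies
  \<open>G\<close>, because the chain rule composes the partial derivatives of \<open>G\<close> with
  the same \<open>F\<close>.\<close>

lemma C_dirs_compose: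
  fixes F :: "'a::euclidean_space \<Rightarrow> 'b::euclidean_space"
  assumes "open T" "F ` S \<subseteq> T"
  shows "C_k k T G \<Longrightarrow> C_dirs B k S F \<Longrightarrow> C_dirs B k S (\<lambda>x. G (F x))"
proof (induction k arbitrary: G)
  case 0
  then show ?case using assms by (auto intro: continuous_on_compose2)
next
  case (Suc k)
  obtain G' where G': "\<And>b. b \<in> Basis \<Longrightarrow> C_k k T (G' b)"
    "\<And>x. x \<in> T \<Longrightarrow> (G has_derivative (\<lambda>h. \<Sum>b\<in>Basis. (h \<bullet> b) *\<^sub>R G' b x)) (at x)"
    using C_k_SucE[OF Suc.prems(1) assms(1)] by blast
  show ?case
  proof (rule C_dirs_SucI)
    show "continuous_on S (\<lambda>x. G (F x))"
      using Suc.prems[THEN C_dirs_imp_continuous_on] assms by (auto intro: continuous_on_compose2)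
    fix c assume "c \<in> B"
    obtain F' where F': "\<And>x. x \<in> S \<Longrightarrow> ((\<lambda>s. F (x + s *\<^sub>R c)) has_vector_derivative F' x) (at 0)"
      "C_dirs B k S F'" using C_dirs_SucE[OF Suc.prems(2) \<open>c \<in> B\<close>] by blast
    have "((\<lambda>s. G (F (x + s *\<^sub>R c))) has_vector_derivative (\<Sum>b\<in>Basis. (F' x \<bullet> b) *\<^sub>R G' b (F x))) (at 0)"
      if "x \<in> S" for x
    proof -
      have "((\<lambda>s. F (x + s *\<^sub>R c)) has_derivative (\<lambda>s. s *\<^sub>R F' x)) (at 0)"
        using F'(1)[OF that] by (simp add: has_vector_derivative_def)
      moreover have "(G has_derivative (\<lambda>h. \<Sum>b\<in>Basis. (h \<bullet> b) *\<^sub>R G' b (F x))) (at (F (x + 0 *\<^sub>R c)))"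
        using G'(2)[of "F x"] that assms(2) by auto
      ultimately have "((\<lambda>s. G (F (x + s *\<^sub>R c))) has_derivative
          (\<lambda>s. \<Sum>b\<in>Basis. ((s *\<^sub>R F' x) \<bullet> b) *\<^sub>R G' b (F x))) (at 0)"
        by (rule has_derivative_compose)
      then show ?thesis by (simp add: has_vector_derivative_def scaleR_sum_right)
    qed
    moreover have "C_dirs B k S (\<lambda>x. \<Sum>b\<in>Basis. (F' x \<bullet> b) *\<^sub>R G' b (F x))"
      using F'(2) G'(1) Suc.IH C_dirs_SucD[OF Suc.prems(2)]
      by (intro C_dirs_sum C_dirs_scaleR C_dirs_linear_comp[OF bounded_linear_inner_left]) auto
    ultimately show "\<exists>H. (\<forall>x\<in>S. ((\<lambda>s. G (F (x + s *\<^sub>R c))) has_vector_derivative H x) (at 0)) \<and> C_dirs B k S H"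
      by (intro exI[of _ "\<lambda>x. \<Sum>b\<in>Basis. (F' x \<bullet> b) *\<^sub>R G' b (F x)"]) auto
  qed
qed

section \<open>Initial value problems\<close>

text \<open>The square root of the constant in an estimate for the squared norm: the exponential
  comes from the growth rate \<open>2 * M + 1\<close>, the factor \<open>1 + d\<close> absorbs the
  contribution of the inhomogeneity over time \<open>d\<close>.\<close>

definition gronwall_const :: "real \<Rightarrow> real \<Rightarrow> real" where
  "gronwall_const M d = sqrt ((1 + d) * exp ((2 * M + 1) * d))"

lemma gronwall_const_nonneg: "0 \<le> d \<Longrightarrow> 0 \<le> gronwall_const M d"
  by (simp add: gronwall_const_def)

text \<open>\<open>|u|\<^sup>2 exp (- (2 M + 1) (t - a)) - e\<^sup>2 (t - a)\<close> is nonincreasing, because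
  \<open>2 e |u| \<le> |u|\<^sup>2 + e\<^sup>2\<close>.\<close>

lemma gronwall:
  fixes u :: "real \<Rightarrow> 'a::real_inner"
  assumes u': "\<And>t. t \<in> {a..b} \<Longrightarrow> (u has_vector_derivative u' t) (at t within {a..b})"
    and bnd: "\<And>t. t \<in> {a..b} \<Longrightarrow> norm (u' t) \<le> M * norm (u t) + e"
    and M: "0 \<le> M" and e: "0 \<le> e" and t: "t \<in> {a..b}"
  shows "norm (u t) \<le> gronwall_const M (b - a) * (norm (u a) + e)"
proof -
  define K where "K = 2 * M + 1"
  define \<phi> where "\<phi> s = (u s \<bullet> u s) * exp (- K * (s - a)) - e\<^sup>2 * (s - a)" for s
  define \<phi>' where "\<phi>' s = (2 * (u s \<bullet> u' s) - K * (u s \<bullet> u s)) * exp (- K * (s - a)) - e\<^sup>2" for s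
  have der: "(\<phi> has_derivative (\<lambda>h. h * \<phi>' s)) (at s within {a..t})" if "a \<le> s" "s \<le> t" for s
  proof -
    have "(u has_derivative (\<lambda>h. h *\<^sub>R u' s)) (at s within {a..t})"
      using u'[of s] t that has_vector_derivative_within_subset[of u "u' s" s "{a..b}" "{a..t}"]
      by (auto simp: has_vector_derivative_def)
    then show ?thesis
      unfolding \<phi>_def
      by (auto intro!: derivative_eq_intros simp: \<phi>'_def algebra_simps inner_commute)
  qed
  obtain s where s: "s \<in> {a..t}" "\<phi> t - \<phi> a = (t - a) * \<phi>' s"
    using mvt_very_simple[of a t \<phi> "\<lambda>s h. h * \<phi>' s"] der t by auto
  have "2 * (u s \<bullet> u' s) \<le> 2 * (norm (u s) * norm (u' s))"
    using norm_cauchy_schwarz[of "u s" "u' s"] by simp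
  also have "\<dots> \<le> 2 * (norm (u s) * (M * norm (u s) + e))"
    using bnd[of s] s t by (intro mult_left_mono) auto
  also have "\<dots> = 2 * M * (norm (u s))\<^sup>2 + 2 * norm (u s) * e"
    by (simp add: algebra_simps power2_eq_square)
  also have "\<dots> \<le> 2 * M * (norm (u s))\<^sup>2 + ((norm (u s))\<^sup>2 + e\<^sup>2)"
    using sum_squares_bound[of "norm (u s)" e] by simp
  finally have *: "2 * (u s \<bullet> u' s) - K * (u s \<bullet> u s) \<le> e\<^sup>2"
    by (simp add: K_def algebra_simps power2_norm_eq_inner)
  have "(2 * (u s \<bullet> u' s) - K * (u s \<bullet> u s)) * exp (- K * (s - a)) \<le> e\<^sup>2 * exp (- K * (s - a))"
    using * by (intro mult_right_mono) auto
  also have "\<dots> \<le> e\<^sup>2 * 1"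
    using s M by (intro mult_left_mono) (auto simp: K_def intro!: mult_nonpos_nonneg)
  finally have "\<phi>' s \<le> 0" by (simp add: \<phi>'_def)
  then have "\<phi> t \<le> \<phi> a"
    using s t by (smt (verit) atLeastAtMost_iff mult_nonneg_nonpos)
  then have "(norm (u t))\<^sup>2 * exp (- K * (t - a)) \<le> (norm (u a))\<^sup>2 + e\<^sup>2 * (t - a)"
    by (simp add: \<phi>_def power2_norm_eq_inner)
  then have "(norm (u t))\<^sup>2 * exp (- K * (t - a)) * exp (K * (t - a)) \<le> ((norm (u a))\<^sup>2 + e\<^sup>2 * (t - a)) * exp (K * (t - a))"
    by (intro mult_right_mono) auto
  then have "(norm (u t))\<^sup>2 \<le> ((norm (u a))\<^sup>2 + e\<^sup>2 * (t - a)) * exp (K * (t - a))"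
    by (simp add: mult.assoc flip: exp_add)
  also have "\<dots> \<le> ((norm (u a) + e)\<^sup>2 * (1 + (b - a))) * exp (K * (b - a))"
  proof (rule mult_mono)
    have "(norm (u a))\<^sup>2 + e\<^sup>2 * (t - a) \<le> (norm (u a))\<^sup>2 * (1 + (b - a)) + e\<^sup>2 * (1 + (b - a))"
    proof (rule add_mono)
      show "(norm (u a))\<^sup>2 \<le> (norm (u a))\<^sup>2 * (1 + (b - a))"
        using t mult_left_mono[of 1 "1 + (b - a)" "(norm (u a))\<^sup>2"] by auto
    qed (use t in \<open>auto intro: mult_left_mono\<close>)
    also have "\<dots> \<le> (norm (u a) + e)\<^sup>2 * (1 + (b - a))"
      unfolding distrib_right[symmetric] using t e
      by (intro mult_right_mono) (auto simp: power2_eq_square algebra_simps)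
    finally show "(norm (u a))\<^sup>2 + e\<^sup>2 * (t - a) \<le> (norm (u a) + e)\<^sup>2 * (1 + (b - a))" .
  qed (use t M in \<open>auto simp: K_def intro!: mult_left_mono mult_nonneg_nonneg add_nonneg_nonneg\<close>)
  finally have "norm (u t) \<le> sqrt ((norm (u a) + e)\<^sup>2 * ((1 + (b - a)) * exp (K * (b - a))))"
    by (intro real_le_rsqrt) (simp add: algebra_simps)
  also have "\<dots> = gronwall_const M (b - a) * (norm (u a) + e)"
    using e by (simp add: real_sqrt_mult gronwall_const_def K_def mult.commute)
  finally show ?thesis .
qed

text \<open>State and time form one pair, so that \<open>C_dirs\<close> with the directions of the
  state alone can express the regularity of the right-hand side.\<close>

definition solves_ivp :: "('a::real_normed_vector \<times> real \<Rightarrow> 'a) \<Rightarrow> real \<Rightarrow> real \<Rightarrow> 'a \<Rightarrow> (real \<Rightarrow> 'a) \<Rightarrow> bool" where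
  "solves_ivp H a b y0 x \<longleftrightarrow> x a = y0 \<and>
     (\<forall>t\<in>{a..b}. (x has_vector_derivative H (x t, t)) (at t within {a..b}))"

lemma solves_ivpD:
  assumes "solves_ivp H a b y0 x"
  shows "x a = y0" "t \<in> {a..b} \<Longrightarrow> (x has_vector_derivative H (x t, t)) (at t within {a..b})"
  using assms by (auto simp: solves_ivp_def)

lemma solves_ivp_continuous: "solves_ivp H a b y0 x \<Longrightarrow> continuous_on {a..b} x"
  unfolding solves_ivp_def continuous_on_eq_continuous_within
  by (blast intro: has_vector_derivative_continuous)

text \<open>Picard iteration in the variable \<open>exp (- 2 K (t - a)) x(t)\<close>, in which it contracts by
  a factor \<open>1/2\<close> on the whole interval.\<close>

lemma picard:
  fixes H :: "'a::euclidean_space \<times> real \<Rightarrow> 'a"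
  assumes ab: "a \<le> b"
    and cont: "continuous_on (UNIV \<times> {a..b}) H"
    and lip: "\<And>t y z. t \<in> {a..b} \<Longrightarrow> norm (H (y, t) - H (z, t)) \<le> M * norm (y - z)"
  shows "\<exists>x. solves_ivp H a b y0 x"
proof -
  define K where "K = max M 1"
  have K: "K > 0" "M \<le> K" by (auto simp: K_def)
  define w where "w s = exp (2 * K * (s - a))" for s :: real
  \<comment> \<open>Clamping the time to \<open>{a..b}\<close> turns functions on the interval into
    bounded continuous functions on the whole line, a complete space as a type.\<close>
  define c where "c s = min b (max a s)" for s :: real
  have c: "c s \<in> {a..b}" for s using ab by (auto simp: c_def)
  have c_id: "s \<in> {a..b} \<Longrightarrow> c s = s" for s by (auto simp: c_def)
  have wpos: "w s > 0" for s by (simp add: w_def)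
  have cont_w: "continuous_on S w" for S unfolding w_def by (intro continuous_intros)
  define I where "I g t = y0 + integral {a..t} (\<lambda>s. H (w s *\<^sub>R g s, s))" for g :: "real \<Rightarrow> 'a" and t
  have cont_H: "continuous_on {a..b} (\<lambda>s. H (w s *\<^sub>R g s, s))" if "continuous_on {a..b} g" for g
    by (rule continuous_on_compose2[OF cont])
      (use that in \<open>auto intro!: continuous_intros cont_w\<close>)
  have I_der: "(I g has_vector_derivative H (w t *\<^sub>R g t, t)) (at t within {a..b})"
    if "continuous_on {a..b} g" "t \<in> {a..b}" for g t
    using integral_has_vector_derivative[OF cont_H[OF that(1)] that(2)]
    unfolding I_def by (auto intro!: derivative_eq_intros)
  define T where "T g t = inverse (w (c t)) *\<^sub>R I g (c t)" for g and t :: real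
  have T_bcontfun: "T (apply_bcontfun g) \<in> bcontfun" for g :: "real \<Rightarrow>\<^sub>C 'a"
  proof -
    let ?h = "\<lambda>t. inverse (w t) *\<^sub>R I g t"
    have "continuous_on {a..b} (I g)"
      unfolding continuous_on_eq_continuous_within
      using I_der[OF continuous_on_apply_bcontfun] by (blast intro: has_vector_derivative_continuous)
    then have h: "continuous_on {a..b} ?h"
      using wpos by (intro continuous_intros cont_w) (auto simp: less_imp_neq[symmetric])
    have "bounded (?h ` {a..b})"
      using h by (intro compact_imp_bounded compact_continuous_image) auto
    then obtain B where "\<forall>t\<in>{a..b}. norm (?h t) \<le> B" by (auto simp: bounded_iff)
    moreover have "continuous_on UNIV c" unfolding c_def by (intro continuous_intros)
    ultimately show ?thesis
      unfolding T_def using c by (intro bcontfun_normI[of _ B] continuous_on_compose2[OF h]) auto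
  qed
  define TB where "TB g = Bcontfun (T (apply_bcontfun g))" for g
  have TB: "apply_bcontfun (TB g) = T g" for g
    unfolding TB_def using T_bcontfun by (simp add: Bcontfun_inverse)
  have contr: "dist (TB g1) (TB g2) \<le> 1/2 * dist g1 g2" for g1 g2
  proof (rule dist_bound)
    fix t
    let ?d = "dist g1 g2" and ?c = "c t"
    have sub: "{a..?c} \<subseteq> {a..b}" using c[of t] by auto
    let ?f = "\<lambda>g s. H (w s *\<^sub>R apply_bcontfun g s, s)"
    have int: "?f g integrable_on {a..?c}" for g
      by (intro integrable_continuous_real continuous_on_subset[OF cont_H sub]) auto
    \<comment> \<open>The weight grows at rate \<open>2 * K\<close> while the right-hand side
      changes at rate \<open>K\<close>; integrating the weight therefore leaves the factor
      1/2.\<close>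
    have "((\<lambda>s. ?d / 2 * w s) has_vector_derivative (K * ?d * w s)) (at s within {a..?c})" for s
      unfolding w_def has_real_derivative_iff_has_vector_derivative[symmetric]
      by (auto intro!: derivative_eq_intros)
    then have hi: "((\<lambda>s. K * ?d * w s) has_integral (?d / 2 * w ?c - ?d / 2 * w a)) {a..?c}"
      using c[of t] by (intro fundamental_theorem_of_calculus) auto
    have "norm (I g1 ?c - I g2 ?c) = norm (integral {a..?c} (\<lambda>s. ?f g1 s - ?f g2 s))"
      unfolding I_def by (simp add: integral_diff[OF int int])
    also have "\<dots> \<le> integral {a..?c} (\<lambda>s. K * ?d * w s)"
    proof (rule integral_norm_bound_integral)
      fix s assume s: "s \<in> {a..?c}"
      have "norm (?f g1 s - ?f g2 s) \<le> M * norm (w s *\<^sub>R apply_bcontfun g1 s - w s *\<^sub>R apply_bcontfun g2 s)"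
        using lip s sub by auto
      also have "\<dots> = M * (w s * dist (apply_bcontfun g1 s) (apply_bcontfun g2 s))"
        using wpos[of s] by (simp add: dist_norm flip: scaleR_diff_right)
      also have "\<dots> \<le> K * (w s * ?d)"
        using K wpos[of s] dist_bounded by (intro mult_mono) auto
      finally show "norm (?f g1 s - ?f g2 s) \<le> K * ?d * w s" by (simp add: algebra_simps)
    qed (use hi int in \<open>auto intro: integrable_diff\<close>)
    also have "\<dots> = ?d / 2 * w ?c - ?d / 2 * w a" using hi by (rule integral_unique)
    also have "\<dots> \<le> ?d / 2 * w ?c" using wpos[of a] by simp
    finally have "norm (I g1 ?c - I g2 ?c) \<le> ?d / 2 * w ?c" .
    moreover have "dist (apply_bcontfun (TB g1) t) (apply_bcontfun (TB g2) t) = inverse (w ?c) * norm (I g1 ?c - I g2 ?c)"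
      using wpos[of ?c] by (simp add: TB T_def dist_norm flip: scaleR_diff_right)
    ultimately have "w ?c * dist (apply_bcontfun (TB g1) t) (apply_bcontfun (TB g2) t) \<le> w ?c * (1/2 * ?d)"
      using wpos[of ?c] by (simp add: field_simps)
    then show "dist (apply_bcontfun (TB g1) t) (apply_bcontfun (TB g2) t) \<le> 1/2 * ?d"
      using wpos[of ?c] by (simp only: mult_le_cancel_left_pos)
  qed
  obtain g where g: "TB g = g"
    using banach_fix_type[of "1/2" TB] contr by auto
  define x where "x t = I g t" for t
  have wg: "w t *\<^sub>R apply_bcontfun g t = x t" if "t \<in> {a..b}" for t
  proof -
    have "apply_bcontfun g t = T g t" using TB[of g] g by simp
    then show ?thesis using that wpos[of t] by (simp add: T_def c_id x_def)
  qed
  have "solves_ivp H a b y0 x"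
    unfolding solves_ivp_def
  proof (intro conjI ballI)
    show "x a = y0" by (simp add: x_def I_def)
    fix t assume t: "t \<in> {a..b}"
    show "(x has_vector_derivative H (x t, t)) (at t within {a..b})"
      using I_der[OF _ t, of g] by (simp add: wg[OF t]) (simp add: x_def[abs_def])
  qed
  then show ?thesis by blast
qed

section \<open>Differentiable dependence on the initial value\<close>

locale C1_ivp =
  fixes H :: "'a::euclidean_space \<times> real \<Rightarrow> 'a" and G :: "'a \<Rightarrow> 'a \<times> real \<Rightarrow> 'a" and a b :: real
  assumes ab: "a \<le> b"
    and cont_H: "continuous_on (UNIV \<times> {a..b}) H"
    and cont_G: "i \<in> Basis \<Longrightarrow> continuous_on (UNIV \<times> {a..b}) (G i)"
    and der_H: "t \<in> {a..b} \<Longrightarrow> ((\<lambda>y. H (y, t)) has_derivative (\<lambda>h. \<Sum>i\<in>Basis. (h \<bullet> i) *\<^sub>R G i (y, t))) (at y)"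
begin

definition A :: "'a \<times> real \<Rightarrow> 'a \<Rightarrow> 'a" where
  "A p h = (\<Sum>i\<in>Basis. (h \<bullet> i) *\<^sub>R G i p)"

lemma A_bounded_linear: "bounded_linear (A p)"
  unfolding A_def by (intro bounded_linear_sum bounded_linear_scaleR_const bounded_linear_inner_left)

lemma der_H': "t \<in> {a..b} \<Longrightarrow> ((\<lambda>y. H (y, t)) has_derivative A (y, t)) (at y)"
  unfolding A_def using der_H .

lemma A_uniform:
  assumes e: "e > 0"
  obtains d where "d > 0" "\<And>t y z h. \<lbrakk>t \<in> {a..b}; y \<in> cball 0 R; z \<in> cball 0 R; dist y z < d\<rbrakk> \<Longrightarrow>
    norm (A (y, t) h - A (z, t) h) \<le> e * norm h"
proof -
  define e' where "e' = e / DIM('a)"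
  have e': "e' > 0" using e by (simp add: e'_def)
  have "\<exists>d>0. \<forall>p\<in>cball 0 R \<times> {a..b}. \<forall>q\<in>cball 0 R \<times> {a..b}. dist p q < d \<longrightarrow> dist (G i p) (G i q) < e'"
    if "i \<in> Basis" for i
  proof -
    have "uniformly_continuous_on (cball 0 R \<times> {a..b}) (G i)"
      by (intro compact_uniformly_continuous compact_Times continuous_on_subset[OF cont_G[OF that]]) auto
    then show ?thesis using e' unfolding uniformly_continuous_on_def by (metis dist_commute)
  qed
  then obtain d where d: "\<And>i. i \<in> Basis \<Longrightarrow> d i > 0"
    "\<And>i p q. i \<in> Basis \<Longrightarrow> p \<in> cball 0 R \<times> {a..b} \<Longrightarrow> q \<in> cball 0 R \<times> {a..b} \<Longrightarrow> dist p q < d i \<Longrightarrow> dist (G i p) (G i q) < e'"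
    by metis
  show thesis
  proof (rule that[of "Min (d ` Basis)"])
    show "Min (d ` Basis) > 0" using d(1) by (subst Min_gr_iff) auto
    fix t and y z h :: 'a assume *: "t \<in> {a..b}" "y \<in> cball 0 R" "z \<in> cball 0 R" "dist y z < Min (d ` Basis)"
    have G: "norm (G i (y, t) - G i (z, t)) \<le> e'" if "i \<in> Basis" for i
    proof -
      have "dist (y, t) (z, t) < d i"
        using *(4) that by (auto simp: dist_Pair_Pair)
      then show ?thesis using d(2)[OF that, of "(y, t)" "(z, t)"] * by (auto simp: dist_norm)
    qed
    have "norm (A (y, t) h - A (z, t) h) = norm (\<Sum>i\<in>Basis. (h \<bullet> i) *\<^sub>R (G i (y, t) - G i (z, t)))"
      unfolding A_def by (simp add: sum_subtractf scaleR_diff_right)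
    also have "\<dots> \<le> (\<Sum>i\<in>(Basis :: 'a set). norm h * e')"
      using G Basis_le_norm[of _ h] by (intro sum_norm_le) (auto intro!: mult_mono)
    also have "\<dots> = e * norm h" by (simp add: e'_def)
    finally show "norm (A (y, t) h - A (z, t) h) \<le> e * norm h" .
  qed
qed

lemma A_bounded:
  obtains M where "M \<ge> 0" "\<And>t y h. \<lbrakk>t \<in> {a..b}; y \<in> cball 0 R\<rbrakk> \<Longrightarrow> norm (A (y, t) h) \<le> M * norm h"
proof -
  have "\<exists>B. \<forall>p\<in>cball 0 R \<times> {a..b}. norm (G i p) \<le> B" if "i \<in> Basis" for i
  proof -
    have "compact (G i ` (cball 0 R \<times> {a..b}))"
      by (intro compact_continuous_image compact_Times continuous_on_subset[OF cont_G[OF that]]) auto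
    then show ?thesis by (auto dest!: compact_imp_bounded simp: bounded_iff)
  qed
  then obtain B where B: "\<And>i p. i \<in> Basis \<Longrightarrow> p \<in> cball 0 R \<times> {a..b} \<Longrightarrow> norm (G i p) \<le> B i"
    by metis
  show thesis
  proof (rule that[of "\<Sum>i\<in>Basis. \<bar>B i\<bar>"])
    fix t and y h :: 'a assume *: "t \<in> {a..b}" "y \<in> cball 0 R"
    have "norm (A (y, t) h) \<le> (\<Sum>i\<in>Basis. norm h * \<bar>B i\<bar>)"
      unfolding A_def using B[of _ "(y, t)"] * Basis_le_norm[of _ h]
      by (intro sum_norm_le) (force intro!: mult_mono intro: order_trans)
    then show "norm (A (y, t) h) \<le> (\<Sum>i\<in>Basis. \<bar>B i\<bar>) * norm h"
      by (simp add: sum_distrib_left mult.commute)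
  qed (auto intro: sum_nonneg)
qed

text \<open>The point is uniformity in the time and in the base point. It comes from uniform
  continuity of the partial derivatives on a compact set and the mean value inequality on the
  segment from \<open>y\<close> to \<open>z\<close>, which stays in the ball.\<close>

lemma H_linearization:
  assumes e: "e > 0"
  obtains d where "d > 0" "\<And>t y z. \<lbrakk>t \<in> {a..b}; y \<in> cball 0 R; z \<in> cball 0 R; dist y z < d\<rbrakk> \<Longrightarrow>
    norm (H (z, t) - H (y, t) - A (y, t) (z - y)) \<le> e * norm (z - y)"
proof -
  obtain d where d: "d > 0" "\<And>t y z h. \<lbrakk>t \<in> {a..b}; y \<in> cball 0 R; z \<in> cball 0 R; dist y z < d\<rbrakk> \<Longrightarrow>
    norm (A (y, t) h - A (z, t) h) \<le> e * norm h" using A_uniform[OF e] by metis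
  show thesis
  proof (rule that[OF d(1)])
    fix t and y z :: 'a assume *: "t \<in> {a..b}" "y \<in> cball 0 R" "z \<in> cball 0 R" "dist y z < d"
    have "norm (H (z, t) - H (y, t) - A (y, t) (z - y)) \<le> norm (z - y) * e"
    proof (rule differentiable_bound_linearization[where S = "closed_segment y z" and f' = "\<lambda>p. A (p, t)"])
      show "y + s *\<^sub>R (z - y) \<in> closed_segment y z" if "s \<in> {0..1}" for s
        using that by (auto simp: closed_segment_def algebra_simps intro!: exI[of _ s])
      show "((\<lambda>y. H (y, t)) has_derivative A (p, t)) (at p within closed_segment y z)" for p
        using der_H'[OF *(1)] by (rule has_derivative_at_withinI)
      show "onorm (A (p, t) - A (y, t)) \<le> e" if p: "p \<in> closed_segment y z" for p
      proof (rule onorm_le)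
        fix h
        have "p \<in> cball 0 R"
          using p *(2,3) closed_segment_subset[OF *(2,3) convex_cball] by blast
        moreover have "dist p y < d"
          using p *(4) dist_in_closed_segment[OF p] by (simp add: dist_commute)
        ultimately show "norm ((A (p, t) - A (y, t)) h) \<le> e * norm h"
          using d(2) * by auto
      qed
    qed auto
    then show "norm (H (z, t) - H (y, t) - A (y, t) (z - y)) \<le> e * norm (z - y)"
      by (simp add: mult.commute)
  qed
qed

lemma H_lipschitz:
  assumes M: "\<And>t y h. \<lbrakk>t \<in> {a..b}; y \<in> cball 0 R\<rbrakk> \<Longrightarrow> norm (A (y, t) h) \<le> M * norm h"
    and t: "t \<in> {a..b}" and y: "y \<in> cball 0 R" and z: "z \<in> cball 0 R"
  shows "norm (H (y, t) - H (z, t)) \<le> M * norm (y - z)"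
proof (rule differentiable_bound[OF convex_cball _ _ y z])
  fix p assume "p \<in> cball (0::'a) R"
  then show "((\<lambda>y. H (y, t)) has_derivative A (p, t)) (at p within cball 0 R)"
    using der_H'[OF t] by (blast intro: has_derivative_at_withinI)
  show "onorm (A (p, t)) \<le> M"
    using M t \<open>p \<in> _\<close> by (intro onorm_le) auto
qed

lemma solution_bounded:
  assumes "solves_ivp H a b y0 x"
  obtains R where "\<And>t. t \<in> {a..b} \<Longrightarrow> norm (x t) \<le> R"
proof -
  have "bounded (x ` {a..b})"
    using solves_ivp_continuous[OF assms] by (intro compact_imp_bounded compact_continuous_image) auto
  then show ?thesis using that unfolding bounded_iff by blast
qed

text \<open>\<open>H\<close> is only locally Lipschitz, but two given solutions are bounded and stay
  in a common ball, where Gronwall's estimate applies with error 0.\<close>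

lemma ivp_unique:
  assumes x: "solves_ivp H a b y0 x" and z: "solves_ivp H a b y0 z" and t: "t \<in> {a..b}"
  shows "x t = z t"
proof -
  obtain R1 where R1: "\<And>t. t \<in> {a..b} \<Longrightarrow> norm (x t) \<le> R1" using solution_bounded[OF x] by blast
  obtain R2 where R2: "\<And>t. t \<in> {a..b} \<Longrightarrow> norm (z t) \<le> R2" using solution_bounded[OF z] by blast
  define R where "R = max R1 R2"
  have R: "x s \<in> cball 0 R" "z s \<in> cball 0 R" if "s \<in> {a..b}" for s
    using R1[OF that] R2[OF that] by (auto simp: R_def)
  obtain M where M: "M \<ge> 0" "\<And>t y h. \<lbrakk>t \<in> {a..b}; y \<in> cball 0 R\<rbrakk> \<Longrightarrow> norm (A (y, t) h) \<le> M * norm h"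
    using A_bounded by metis
  have "norm (x t - z t) \<le> gronwall_const M (b - a) * (norm (x a - z a) + 0)"
  proof (rule gronwall[where u = "\<lambda>t. x t - z t" and u' = "\<lambda>t. H (x t, t) - H (z t, t)"])
    fix s assume s: "s \<in> {a..b}"
    show "((\<lambda>t. x t - z t) has_vector_derivative H (x s, s) - H (z s, s)) (at s within {a..b})"
      using solves_ivpD(2)[OF x s] solves_ivpD(2)[OF z s] by (rule has_vector_derivative_diff)
    show "norm (H (x s, s) - H (z s, s)) \<le> M * norm (x s - z s) + 0"
      using H_lipschitz[OF M(2) s] R[OF s] by simp
  qed (use M t in auto)
  then show ?thesis using solves_ivpD(1)[OF x] solves_ivpD(1)[OF z] by simp
qed

text \<open>The right-hand side is cut off outside a ball that contains the given solution with
  margin 1; the modified equation is globally Lipschitz and solvable for every initial value. The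
  derivative in the initial value is the solution \<open>w\<close> of the linear variational
  equation. Gronwall's estimate, applied to the linearization error and to the difference of two
  such solutions, gives differentiability and continuity of the derivative.\<close>

theorem C1_dependence:
  assumes x: "solves_ivp H a b y0 x"
  obtains d \<phi> w where "d > 0"
    "\<And>y. y \<in> ball y0 d \<Longrightarrow> solves_ivp H a b y (\<phi> y)"
    "\<And>y h. y \<in> ball y0 d \<Longrightarrow> solves_ivp (\<lambda>(v, t). A (\<phi> y t, t) v) a b h (w y h)"
    "\<And>t y. t \<in> {a..b} \<Longrightarrow> y \<in> ball y0 d \<Longrightarrow> ((\<lambda>y. \<phi> y t) has_derivative (\<lambda>h. w y h t)) (at y)"
    "\<And>t h. t \<in> {a..b} \<Longrightarrow> continuous_on (ball y0 d) (\<lambda>y. w y h t)"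
proof -
  obtain R0 where R0: "\<And>t. t \<in> {a..b} \<Longrightarrow> norm (x t) \<le> R0" using solution_bounded[OF x] by blast
  define R where "R = R0 + 1"
  have "0 \<le> R" using R0[of a] ab norm_ge_zero[of "x a"] by (auto simp: R_def simp del: norm_ge_zero)
  obtain M where M: "M \<ge> 0" "\<And>t y h. \<lbrakk>t \<in> {a..b}; y \<in> cball 0 R\<rbrakk> \<Longrightarrow> norm (A (y, t) h) \<le> M * norm h"
    using A_bounded by metis
  \<comment> \<open>The nearest point in the ball is a nonexpansive retraction, so \<open>Ht\<close>
    inherits the Lipschitz constant that \<open>H\<close> has on the ball.\<close>
  define cp where "cp = closest_point (cball (0::'a) R)"
  have ne: "cball (0::'a) R \<noteq> {}" using \<open>0 \<le> R\<close> by auto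
  have cp: "cp y \<in> cball 0 R" for y
    unfolding cp_def using ne by (intro closest_point_in_set) auto
  have cp_id: "cp y = y" if "y \<in> cball 0 R" for y
    unfolding cp_def using that by (rule closest_point_self)
  define Ht where "Ht = (\<lambda>(y, t). H (cp y, t))"
  have Ht: "Ht (y, t) = H (cp y, t)" for y t by (simp add: Ht_def)
  have cont_Ht: "continuous_on (UNIV \<times> {a..b}) Ht"
    unfolding Ht_def case_prod_unfold
  proof (rule continuous_on_compose2[OF cont_H])
    have "continuous_on UNIV cp" unfolding cp_def using ne by (intro continuous_on_closest_point) auto
    then have "continuous_on (UNIV \<times> {a..b}) (\<lambda>p. cp (fst p))"
      by (rule continuous_on_compose2) (auto intro: continuous_intros)
    then show "continuous_on (UNIV \<times> {a..b}) (\<lambda>p. (cp (fst p), snd p))"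
      by (intro continuous_intros)
  qed auto
  have lip: "norm (Ht (y, t) - Ht (z, t)) \<le> M * norm (y - z)" if "t \<in> {a..b}" for t y z
  proof -
    have "norm (Ht (y, t) - Ht (z, t)) \<le> M * norm (cp y - cp z)"
      unfolding Ht using M(2) that cp by (intro H_lipschitz) auto
    also have "norm (cp y - cp z) \<le> norm (y - z)"
      unfolding cp_def using closest_point_lipschitz[of "cball 0 R" y z] ne by (auto simp: dist_norm)
    finally show ?thesis using M(1) by (simp add: mult_left_mono)
  qed
  obtain \<phi> where \<phi>: "\<And>y. solves_ivp Ht a b y (\<phi> y)"
    using picard[OF ab cont_Ht lip] by metis
  \<comment> \<open>The added 1 makes the constant at least 1, so it can be divided by.\<close>
  define C where "C = gronwall_const M (b - a) + 1"
  have C: "C \<ge> 1" using gronwall_const_nonneg[of "b - a" M] ab by (simp add: C_def)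
  have gron: "norm (u t) \<le> C * (norm (u a) + e)"
    if "\<And>t. t \<in> {a..b} \<Longrightarrow> (u has_vector_derivative u' t) (at t within {a..b})"
      "\<And>t. t \<in> {a..b} \<Longrightarrow> norm (u' t) \<le> M * norm (u t) + e" "0 \<le> e" "t \<in> {a..b}"
    for u u' :: "real \<Rightarrow> 'a" and e t
  proof -
    have "norm (u t) \<le> gronwall_const M (b - a) * (norm (u a) + e)"
      using that M(1) by (intro gronwall[where u' = u']) auto
    also have "\<dots> \<le> C * (norm (u a) + e)"
      using that(3) by (intro mult_right_mono) (auto simp: C_def)
    finally show ?thesis .
  qed
  have dep: "norm (p t - q t) \<le> C * norm (y - z)"
    if "solves_ivp Ht a b y p" "solves_ivp Ht a b z q" "t \<in> {a..b}" for p q y z t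
  proof -
    have "norm (p t - q t) \<le> C * (norm (p a - q a) + 0)"
      using lip that(3)
      by (intro gron[where u = "\<lambda>t. p t - q t" and u' = "\<lambda>t. Ht (p t, t) - Ht (q t, t)"]
          has_vector_derivative_diff solves_ivpD(2)[OF that(1)] solves_ivpD(2)[OF that(2)]) auto
    then show ?thesis using solves_ivpD(1)[OF that(1)] solves_ivpD(1)[OF that(2)] by simp
  qed
  have xt: "solves_ivp Ht a b y0 x"
    using x R0 by (auto simp: solves_ivp_def Ht cp_id R_def add_increasing2)
  \<comment> \<open>Initial values this close to \<open>y0\<close> give solutions within distance 1
    of \<open>x\<close>, hence in the ball of radius \<open>R = R0 + 1\<close>, where the cut-off
    changes nothing.\<close>
  define d where "d = 1 / C"
  have d: "d > 0" using C by (simp add: d_def)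
  have inR: "\<phi> y t \<in> cball 0 R" if "y \<in> ball y0 d" "t \<in> {a..b}" for y t
  proof -
    have "norm (\<phi> y t - x t) \<le> C * norm (y - y0)" using dep \<phi> xt that by blast
    also have "\<dots> < 1" using that(1) C by (simp add: d_def dist_norm norm_minus_commute field_simps)
    finally have "norm (\<phi> y t) \<le> norm (x t) + 1"
      by (metis diff_add_cancel add.commute less_imp_le norm_triangle_le order_refl add_mono)
    then show ?thesis using R0[OF that(2)] by (simp add: R_def)
  qed
  have sol: "solves_ivp H a b y (\<phi> y)" if "y \<in> ball y0 d" for y
    using \<phi>[of y] inR[OF that] by (simp add: solves_ivp_def Ht cp_id)
  have cont_\<phi>: "continuous_on {a..b} (\<phi> y)" for y using \<phi> by (rule solves_ivp_continuous)
  let ?L = "\<lambda>y (v, t). A (\<phi> y t, t) v"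
  have "\<exists>v. solves_ivp (?L y) a b i v" if y: "y \<in> ball y0 d" for y i
  proof (rule picard[OF ab, where M = M])
    show "continuous_on (UNIV \<times> {a..b}) (?L y)"
      unfolding A_def case_prod_unfold
    proof (intro continuous_intros)
      fix i :: 'a assume i: "i \<in> Basis"
      have "continuous_on (UNIV \<times> {a..b}) (\<lambda>p::'a \<times> real. \<phi> y (snd p))"
        by (rule continuous_on_compose2[OF cont_\<phi>]) (auto intro: continuous_intros)
      then show "continuous_on (UNIV \<times> {a..b}) (\<lambda>p::'a \<times> real. G i (\<phi> y (snd p), snd p))"
        by (intro continuous_on_compose2[OF cont_G[OF i]] continuous_intros) auto
    qed
    fix t v v' assume t: "t \<in> {a..b}"
    interpret bounded_linear "A (\<phi> y t, t)" by (rule A_bounded_linear)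
    show "norm (?L y (v, t) - ?L y (v', t)) \<le> M * norm (v - v')"
      using M(2)[OF t inR[OF y t], of "v - v'"] by (simp add: diff)
  qed
  then obtain wb where wb: "\<And>y i. y \<in> ball y0 d \<Longrightarrow> solves_ivp (?L y) a b i (wb y i)"
    by metis
  \<comment> \<open>Combining the solutions for the basis vectors makes linearity in
    \<open>h\<close> hold by construction.\<close>
  define w where "w y h t = (\<Sum>i\<in>Basis. (h \<bullet> i) *\<^sub>R wb y i t)" for y h t
  have w: "solves_ivp (?L y) a b h (w y h)" if y: "y \<in> ball y0 d" for y h
    unfolding solves_ivp_def
  proof (intro conjI ballI)
    show "w y h a = h"
      using solves_ivpD(1)[OF wb[OF y]] by (simp add: w_def euclidean_representation)
    fix t assume t: "t \<in> {a..b}"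
    interpret bounded_linear "A (\<phi> y t, t)" by (rule A_bounded_linear)
    have "((\<lambda>t. \<Sum>i\<in>Basis. (h \<bullet> i) *\<^sub>R wb y i t) has_vector_derivative (\<Sum>i\<in>Basis. (h \<bullet> i) *\<^sub>R A (\<phi> y t, t) (wb y i t))) (at t within {a..b})"
      using solves_ivpD(2)[OF wb[OF y] t]
      by (intro has_vector_derivative_sum bounded_linear.has_vector_derivative[OF bounded_linear_scaleR_right]) auto
    then show "(w y h has_vector_derivative ?L y (w y h t, t)) (at t within {a..b})"
      by (simp add: w_def[abs_def] sum scaleR)
  qed
  have w_der: "(w y h has_vector_derivative A (\<phi> y t, t) (w y h t)) (at t within {a..b})"
    if "y \<in> ball y0 d" "t \<in> {a..b}" for y h t
    using solves_ivpD(2)[OF w[OF that(1)] that(2)] by simp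
  have w_bound: "norm (w y h t) \<le> C * norm h" if y: "y \<in> ball y0 d" and t: "t \<in> {a..b}" for y h t
    using gron[where u = "w y h" and u' = "\<lambda>t. A (\<phi> y t, t) (w y h t)" and e = 0 and t = t]
      w_der[OF y] M(2) inR[OF y] t solves_ivpD(1)[OF w[OF y]] by auto
  have w_lin: "bounded_linear (\<lambda>h. w y h t)" for y t
    unfolding w_def by (intro bounded_linear_sum bounded_linear_scaleR_const bounded_linear_inner_left)
  have der: "((\<lambda>y. \<phi> y t) has_derivative (\<lambda>h. w y h t)) (at y)" if t: "t \<in> {a..b}" and y: "y \<in> ball y0 d" for t y
    unfolding has_derivative_at_alt
  proof (intro conjI allI impI w_lin)
    fix e :: real assume "0 < e"
    \<comment> \<open>One factor \<open>C\<close> is lost in the Lipschitz dependence of the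
      solutions on the initial value, the other in Gronwall's estimate for the remainder.\<close>
    define e' where "e' = e / C\<^sup>2"
    have "e' > 0" using \<open>0 < e\<close> C by (simp add: e'_def)
    then obtain r where r: "r > 0" "\<And>t y z. \<lbrakk>t \<in> {a..b}; y \<in> cball 0 R; z \<in> cball 0 R; dist y z < r\<rbrakk> \<Longrightarrow>
      norm (H (z, t) - H (y, t) - A (y, t) (z - y)) \<le> e' * norm (z - y)"
      using H_linearization by metis
    obtain r' where r': "r' > 0" "ball y r' \<subseteq> ball y0 d" using y open_ball open_contains_ball by metis
    have "norm (\<phi> z t - \<phi> y t - w y (z - y) t) \<le> e * norm (z - y)" if z: "norm (z - y) < min r' (r / C)" for z
    proof -
      have zb: "z \<in> ball y0 d" using z r' by (auto simp: dist_norm norm_minus_commute)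
      define u where "u t = \<phi> z t - \<phi> y t - w y (z - y) t" for t
      have "norm (u t) \<le> C * (norm (u a) + e' * (C * norm (z - y)))"
      proof (rule gron[where u' = "\<lambda>t. H (\<phi> z t, t) - H (\<phi> y t, t) - A (\<phi> y t, t) (w y (z - y) t)"])
        fix s assume s: "s \<in> {a..b}"
        interpret bounded_linear "A (\<phi> y s, s)" by (rule A_bounded_linear)
        show "(u has_vector_derivative H (\<phi> z s, s) - H (\<phi> y s, s) - A (\<phi> y s, s) (w y (z - y) s)) (at s within {a..b})"
          unfolding u_def
          by (intro has_vector_derivative_diff w_der solves_ivpD(2)[OF sol] zb y s)
        have 1: "norm (\<phi> z s - \<phi> y s) \<le> C * norm (z - y)" using dep \<phi> s by blast
        also have "\<dots> < r" using z C by (simp add: field_simps)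
        finally have 2: "norm (H (\<phi> z s, s) - H (\<phi> y s, s) - A (\<phi> y s, s) (\<phi> z s - \<phi> y s)) \<le> e' * norm (\<phi> z s - \<phi> y s)"
          using inR[OF zb s] inR[OF y s] s by (intro r(2)) (auto simp: dist_norm norm_minus_commute)
        have "H (\<phi> z s, s) - H (\<phi> y s, s) - A (\<phi> y s, s) (w y (z - y) s)
          = A (\<phi> y s, s) (u s) + (H (\<phi> z s, s) - H (\<phi> y s, s) - A (\<phi> y s, s) (\<phi> z s - \<phi> y s))"
          unfolding u_def by (simp add: diff)
        then have "norm (H (\<phi> z s, s) - H (\<phi> y s, s) - A (\<phi> y s, s) (w y (z - y) s))
          \<le> M * norm (u s) + e' * norm (\<phi> z s - \<phi> y s)"
          using 2 M(2)[OF s inR[OF y s], of "u s"] by (metis norm_triangle_mono)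
        also have "\<dots> \<le> M * norm (u s) + e' * (C * norm (z - y))"
          using 1 \<open>e' > 0\<close> by (intro add_left_mono mult_left_mono) auto
        finally show "norm (H (\<phi> z s, s) - H (\<phi> y s, s) - A (\<phi> y s, s) (w y (z - y) s)) \<le> M * norm (u s) + e' * (C * norm (z - y))" .
      qed (use \<open>e' > 0\<close> C t in auto)
      moreover have "u a = 0"
        unfolding u_def using solves_ivpD(1)[OF w[OF y]] solves_ivpD(1)[OF \<phi>] by simp
      ultimately show ?thesis
        using C by (simp add: u_def e'_def power2_eq_square)
    qed
    then show "\<exists>r>0. \<forall>z. norm (z - y) < r \<longrightarrow> norm (\<phi> z t - \<phi> y t - w y (z - y) t) \<le> e * norm (z - y)"
      using r r' C by (intro exI[of _ "min r' (r / C)"]) auto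
  qed
  have cont: "continuous_on (ball y0 d) (\<lambda>y. w y h t)" if t: "t \<in> {a..b}" for h t
    unfolding continuous_on_iff
  proof (intro ballI allI impI)
    fix y e assume y: "y \<in> ball y0 d" and e: "0 < (e::real)"
    \<comment> \<open>As before, two factors \<open>C\<close> are lost; the 1 added to
      \<open>norm h\<close> covers \<open>h = 0\<close> and makes the final inequality
      strict.\<close>
    define e' where "e' = e / (C\<^sup>2 * (norm h + 1))"
    have "C\<^sup>2 * (norm h + 1) > 0" using C by (intro mult_pos_pos) (auto intro: add_nonneg_pos)
    then have "e' > 0" using e by (simp add: e'_def)
    then obtain r where r: "r > 0" "\<And>t y z h. \<lbrakk>t \<in> {a..b}; y \<in> cball 0 R; z \<in> cball 0 R; dist y z < r\<rbrakk> \<Longrightarrow>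
      norm (A (y, t) h - A (z, t) h) \<le> e' * norm h"
      using A_uniform by metis
    show "\<exists>r>0. \<forall>z\<in>ball y0 d. dist z y < r \<longrightarrow> dist (w z h t) (w y h t) < e"
    proof (intro exI[of _ "r / C"] conjI ballI impI)
      fix z assume z: "z \<in> ball y0 d" "dist z y < r / C"
      define u where "u t = w z h t - w y h t" for t
      have "norm (u t) \<le> C * (norm (u a) + e' * (C * norm h))"
      proof (rule gron[where u' = "\<lambda>t. A (\<phi> z t, t) (w z h t) - A (\<phi> y t, t) (w y h t)"])
        fix s assume s: "s \<in> {a..b}"
        interpret bounded_linear "A (\<phi> z s, s)" by (rule A_bounded_linear)
        show "(u has_vector_derivative A (\<phi> z s, s) (w z h s) - A (\<phi> y s, s) (w y h s)) (at s within {a..b})"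
          unfolding u_def by (intro has_vector_derivative_diff w_der z y s)
        have "dist (\<phi> z s) (\<phi> y s) \<le> C * norm (z - y)" using dep \<phi> s by (simp add: dist_norm)
        also have "\<dots> < r" using z C by (simp add: dist_norm field_simps)
        finally have "norm (A (\<phi> z s, s) (w y h s) - A (\<phi> y s, s) (w y h s)) \<le> e' * norm (w y h s)"
          using inR[OF z(1) s] inR[OF y s] s by (intro r(2)) auto
        also have "\<dots> \<le> e' * (C * norm h)"
          using w_bound[OF y s] \<open>e' > 0\<close> by (intro mult_left_mono) auto
        finally have 1: "norm (A (\<phi> z s, s) (w y h s) - A (\<phi> y s, s) (w y h s)) \<le> e' * (C * norm h)" .
        have "A (\<phi> z s, s) (w z h s) - A (\<phi> y s, s) (w y h s)
          = A (\<phi> z s, s) (u s) + (A (\<phi> z s, s) (w y h s) - A (\<phi> y s, s) (w y h s))"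
          unfolding u_def by (simp add: diff)
        then show "norm (A (\<phi> z s, s) (w z h s) - A (\<phi> y s, s) (w y h s)) \<le> M * norm (u s) + e' * (C * norm h)"
          using 1 M(2)[OF s inR[OF z(1) s], of "u s"] by (metis norm_triangle_mono)
      qed (use \<open>e' > 0\<close> C t in auto)
      moreover have "u a = 0"
        unfolding u_def using solves_ivpD(1)[OF w] y z by simp
      ultimately have "norm (u t) \<le> e' * C\<^sup>2 * norm h" by (simp add: power2_eq_square algebra_simps)
      also have "\<dots> < e' * C\<^sup>2 * (norm h + 1)" using \<open>e' > 0\<close> C by simp
      also have "\<dots> = e" using C \<open>C\<^sup>2 * (norm h + 1) > 0\<close> unfolding e'_def by (simp add: field_simps)
      finally show "dist (w z h t) (w y h t) < e" by (simp add: u_def dist_norm)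
    qed (use r C in auto)
  qed
  show thesis using that[OF d sol w der cont] by blast
qed

end

abbreviation state_dirs :: "('a::euclidean_space \<times> real) set" where
  "state_dirs \<equiv> (\<lambda>b. (b, 0)) ` Basis"

lemma C1_ivp_of_C_dirs:
  fixes H :: "'a::euclidean_space \<times> real \<Rightarrow> 'a"
  assumes ab: "a \<le> b" and H: "C_dirs state_dirs (Suc k) (UNIV \<times> {a..b}) H"
  obtains G where "C1_ivp H G a b" "\<And>i. i \<in> Basis \<Longrightarrow> C_dirs state_dirs k (UNIV \<times> {a..b}) (G i)"
proof -
  have "\<exists>F'. (\<forall>x\<in>UNIV \<times> {a..b}. ((\<lambda>s. H (x + s *\<^sub>R (i, 0))) has_vector_derivative F' x) (at 0)) \<and>
      C_dirs state_dirs k (UNIV \<times> {a..b}) F'" if "i \<in> Basis" for i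
    using H that unfolding C_dirs.simps(2) by blast
  then obtain G where G: "\<And>i x. i \<in> Basis \<Longrightarrow> x \<in> UNIV \<times> {a..b} \<Longrightarrow>
      ((\<lambda>s. H (x + s *\<^sub>R (i, 0))) has_vector_derivative G i x) (at 0)"
    "\<And>i. i \<in> Basis \<Longrightarrow> C_dirs state_dirs k (UNIV \<times> {a..b}) (G i)"
    by metis
  have "C1_ivp H G a b"
  proof
    show "continuous_on (UNIV \<times> {a..b}) H" using H by (rule C_dirs_imp_continuous_on)
    show "continuous_on (UNIV \<times> {a..b}) (G i)" if "i \<in> Basis" for i
      using G(2)[OF that] by (rule C_dirs_imp_continuous_on)
    fix t y assume t: "t \<in> {a..b}"
    show "((\<lambda>y. H (y, t)) has_derivative (\<lambda>h. \<Sum>i\<in>Basis. (h \<bullet> i) *\<^sub>R G i (y, t))) (at y)"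
    proof (rule has_derivative_partials[where S = UNIV and F' = "\<lambda>i y. G i (y, t)"])
      fix i z :: 'a assume i: "i \<in> Basis"
      show "((\<lambda>s. H (z + s *\<^sub>R i, t)) has_vector_derivative G i (z, t)) (at 0)"
        using G(1)[OF i, of "(z, t)"] t by simp
      show "continuous_on UNIV (\<lambda>y. G i (y, t))"
        using C_dirs_imp_continuous_on[OF G(2)[OF i]]
        by (rule continuous_on_compose2) (use t in \<open>auto intro: continuous_intros\<close>)
    qed auto
  qed fact
  then show thesis using that G(2) by blast
qed

text \<open>The derivative of the flow solves the variational equation. Together with the original
  equation this is an initial value problem whose right-hand side is \<open>C\<^sup>1\<close>.\<close>

theorem C2_dependence:
  fixes H :: "'a::euclidean_space \<times> real \<Rightarrow> 'a"
  assumes ab: "a \<le> b" and H: "C_dirs state_dirs 2 (UNIV \<times> {a..b}) H"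
    and x: "solves_ivp H a b y0 x"
  obtains d \<phi> where "d > 0" "\<And>y. y \<in> ball y0 d \<Longrightarrow> solves_ivp H a b y (\<phi> y)"
    "\<And>t. t \<in> {a..b} \<Longrightarrow> C_k 2 (ball y0 d) (\<lambda>y. \<phi> y t)"
proof -
  obtain G where G: "C1_ivp H G a b" "\<And>i. i \<in> Basis \<Longrightarrow> C_dirs state_dirs 1 (UNIV \<times> {a..b}) (G i)"
    using C1_ivp_of_C_dirs[OF ab, of 1 H] H by (auto simp del: C_dirs.simps simp: numeral_2_eq_2)
  interpret C1_ivp H G a b by fact
  obtain d \<phi> w where d: "d > 0"
    and \<phi>: "\<And>y. y \<in> ball y0 d \<Longrightarrow> solves_ivp H a b y (\<phi> y)"
    and w: "\<And>y h. y \<in> ball y0 d \<Longrightarrow> solves_ivp (\<lambda>(v, t). A (\<phi> y t, t) v) a b h (w y h)"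
    and der: "\<And>t y. t \<in> {a..b} \<Longrightarrow> y \<in> ball y0 d \<Longrightarrow> ((\<lambda>y. \<phi> y t) has_derivative (\<lambda>h. w y h t)) (at y)"
    and cont: "\<And>t h. t \<in> {a..b} \<Longrightarrow> continuous_on (ball y0 d) (\<lambda>y. w y h t)"
    by (rule C1_dependence[OF x]) (rule that)
  define H2 where "H2 p = (H (fst (fst p), snd p), A (fst (fst p), snd p) (snd (fst p)))"
    for p :: "('a \<times> 'a) \<times> real"
  have proj: "C_dirs state_dirs k (UNIV \<times> {a..b}) (\<lambda>p::('a \<times> 'a) \<times> real. F (fst (fst p), snd p))"
    if "C_dirs state_dirs k (UNIV \<times> {a..b}) F" for k and F :: "'a \<times> real \<Rightarrow> 'a"
    by (rule C_dirs_affine_comp[OF _ _ _ _ that,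
          of "UNIV \<times> {a..b}" "\<lambda>p. (fst (fst p), snd p)" state_dirs "\<lambda>c. (fst (fst c), 0)"])
      (auto simp: Basis_prod_def zero_prod_def intro!: continuous_intros)
  \<comment> \<open>The coefficients \<open>G i\<close> of \<open>A\<close> are partial derivatives
    of \<open>H\<close>, so one of the two orders of regularity is spent here.\<close>
  have "C_dirs state_dirs 1 (UNIV \<times> {a..b}) H2"
    unfolding H2_def[abs_def] A_def
  proof (intro C_dirs_Pair C_dirs_sum C_dirs_scaleR proj)
    show "C_dirs state_dirs 1 (UNIV \<times> {a..b}) H" using H by (rule C_dirs_le) simp
    fix i :: 'a assume "i \<in> Basis"
    then show "C_dirs state_dirs 1 (UNIV \<times> {a..b}) (G i)" by (rule G(2))
    show "C_dirs state_dirs 1 (UNIV \<times> {a..b}) (\<lambda>p::('a \<times> 'a) \<times> real. snd (fst p) \<bullet> i)"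
      by (intro C_dirs_bounded_linear bounded_linear_intros)
  qed
  then obtain G2 where "C1_ivp H2 G2 a b"
    unfolding One_nat_def by (rule C1_ivp_of_C_dirs[OF ab])
  then interpret two: C1_ivp H2 G2 a b .
  have ext: "solves_ivp H2 a b (y, h) (\<lambda>t. (\<phi> y t, w y h t))" if y: "y \<in> ball y0 d" for y h
    unfolding solves_ivp_def
  proof (intro conjI ballI)
    show "(\<phi> y a, w y h a) = (y, h)"
      using solves_ivpD(1)[OF \<phi>[OF y]] solves_ivpD(1)[OF w[OF y]] by simp
    fix t assume t: "t \<in> {a..b}"
    show "((\<lambda>t. (\<phi> y t, w y h t)) has_vector_derivative H2 ((\<phi> y t, w y h t), t)) (at t within {a..b})"
      unfolding H2_def
      using has_vector_derivative_Pair[OF solves_ivpD(2)[OF \<phi>[OF y] t] solves_ivpD(2)[OF w[OF y] t]]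
      by simp
  qed
  have y0: "y0 \<in> ball y0 d" using d by simp
  have "\<exists>r>0. \<forall>t\<in>{a..b}. C_k 1 (ball y0 (min d r)) (\<lambda>y. w y i t)" for i
  proof -
    obtain r \<Phi> W where r: "r > 0"
      and \<Phi>: "\<And>z. z \<in> ball (y0, i) r \<Longrightarrow> solves_ivp H2 a b z (\<Phi> z)"
      and lin\<Phi>: "\<And>z h. z \<in> ball (y0, i) r \<Longrightarrow> solves_ivp (\<lambda>(v, t). two.A (\<Phi> z t, t) v) a b h (W z h)"
      and D\<Phi>: "\<And>t z. t \<in> {a..b} \<Longrightarrow> z \<in> ball (y0, i) r \<Longrightarrow> ((\<lambda>z. \<Phi> z t) has_derivative (\<lambda>h. W z h t)) (at z)"
      and cW: "\<And>t h. t \<in> {a..b} \<Longrightarrow> continuous_on (ball (y0, i) r) (\<lambda>z. W z h t)"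
      by (rule two.C1_dependence[OF ext[OF y0, of i]]) (rule that)
    have "C_k 1 (ball y0 (min d r)) (\<lambda>y. w y i t)" if t: "t \<in> {a..b}" for t
    proof -
      have near: "(y, i) \<in> ball (y0, i) r" if "y \<in> ball y0 (min d r)" for y
        using that by (auto simp: dist_Pair_Pair)
      have "C_k (Suc 0) (ball (y0, i) r) (\<lambda>z. \<Phi> z t)"
        using D\<Phi>[OF t] cW[OF t] by (intro C_k_SucI[where F' = "\<lambda>z h. W z h t"]) auto
      then have "C_k (Suc 0) (ball y0 (min d r)) (\<lambda>y. \<Phi> (y, i) t)"
        by (rule C_dirs_affine_comp[rotated -1, where A' = "\<lambda>c. (c, 0)"])
          (auto simp: Basis_prod_def intro!: continuous_intros near)
      then have "C_k (Suc 0) (ball y0 (min d r)) (\<lambda>y. snd (\<Phi> (y, i) t))"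
        by (rule C_dirs_snd)
      \<comment> \<open>The extended flow and the variational solution were obtained independently;
        uniqueness for the extended equation identifies them.\<close>
      then have "C_k (Suc 0) (ball y0 (min d r)) (\<lambda>y. w y i t)"
      proof (rule C_dirs_cong[rotated -1])
        fix y assume y: "y \<in> ball y0 (min d r)"
        then show "snd (\<Phi> (y, i) t) = w y i t"
          using two.ivp_unique[OF \<Phi>[OF near[OF y]] ext[of y i] t] by simp
      qed auto
      then show ?thesis by simp
    qed
    then show ?thesis using r by blast
  qed
  then obtain r where r: "\<And>i. r i > 0" "\<And>i t. t \<in> {a..b} \<Longrightarrow> C_k 1 (ball y0 (min d (r i))) (\<lambda>y. w y i t)"
    by metis
  \<comment> \<open>The radius depends on the direction \<open>i\<close>; only the finitely many
    basis directions matter.\<close>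
  define e where "e = min d (Min (r ` Basis))"
  have e: "e > 0" "e \<le> d" "\<And>i. i \<in> Basis \<Longrightarrow> e \<le> min d (r i)"
    using d r(1) by (auto simp: e_def min_le_iff_disj)
  show thesis
  proof (rule that[of e \<phi>])
    show "solves_ivp H a b y (\<phi> y)" if "y \<in> ball y0 e" for y
      using \<phi> that e(2) by auto
    fix t assume t: "t \<in> {a..b}"
    have "C_k (Suc 1) (ball y0 e) (\<lambda>y. \<phi> y t)"
    proof (rule C_k_SucI)
      show "((\<lambda>y. \<phi> y t) has_derivative (\<lambda>h. w y h t)) (at y)" if "y \<in> ball y0 e" for y
        using der[OF t] that e(2) by auto
      show "C_k 1 (ball y0 e) (\<lambda>y. w y i t)" if "i \<in> Basis" for i
        using r(2)[OF t, of i] by (rule C_dirs_subset) (use e(3)[OF that] in auto)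
    qed
    then show "C_k 2 (ball y0 e) (\<lambda>y. \<phi> y t)" by (simp only: numeral_2_eq_2 One_nat_def)
  qed (rule e(1))
qed

declare transpose_matrix_vector [simp del]

section \<open>Matrices\<close>

lemma bounded_bilinear_matrix_mult:
  "bounded_bilinear ((**) :: real ^ 'm ^ 'n \<Rightarrow> real ^ 'k ^ 'm \<Rightarrow> real ^ 'k ^ 'n)"
proof -
  have "bilinear ((**) :: real ^ 'm ^ 'n \<Rightarrow> real ^ 'k ^ 'm \<Rightarrow> real ^ 'k ^ 'n)"
    unfolding bilinear_def linear_iff
    by (simp add: matrix_matrix_mult_def vec_eq_iff sum.distrib sum_distrib_left algebra_simps)
  then show ?thesis by (simp add: bilinear_conv_bounded_bilinear)
qed

lemma bounded_bilinear_matrix_vector_mult: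
  "bounded_bilinear ((*v) :: real ^ 'm ^ 'n \<Rightarrow> real ^ 'm \<Rightarrow> real ^ 'n)"
proof -
  have "bilinear ((*v) :: real ^ 'm ^ 'n \<Rightarrow> real ^ 'm \<Rightarrow> real ^ 'n)"
    unfolding bilinear_def linear_iff
    by (simp add: matrix_vector_mult_def vec_eq_iff sum.distrib sum_distrib_left algebra_simps)
  then show ?thesis by (simp add: bilinear_conv_bounded_bilinear)
qed

lemma bounded_linear_transpose: "bounded_linear (transpose :: real ^ 'm ^ 'n \<Rightarrow> real ^ 'n ^ 'm)"
proof -
  have "linear (transpose :: real ^ 'm ^ 'n \<Rightarrow> real ^ 'n ^ 'm)"
    unfolding linear_iff by (simp add: transpose_def vec_eq_iff)
  then show ?thesis by (simp add: linear_conv_bounded_linear)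
qed

lemmas matmul_simps =
  bounded_bilinear.add_left[OF bounded_bilinear_matrix_mult]
  bounded_bilinear.add_right[OF bounded_bilinear_matrix_mult]
  bounded_bilinear.diff_left[OF bounded_bilinear_matrix_mult]
  bounded_bilinear.diff_right[OF bounded_bilinear_matrix_mult]
  bounded_bilinear.minus_left[OF bounded_bilinear_matrix_mult]
  bounded_bilinear.minus_right[OF bounded_bilinear_matrix_mult]
  bounded_bilinear.scaleR_left[OF bounded_bilinear_matrix_mult]
  bounded_bilinear.scaleR_right[OF bounded_bilinear_matrix_mult]
  bounded_bilinear.zero_left[OF bounded_bilinear_matrix_mult]
  bounded_bilinear.zero_right[OF bounded_bilinear_matrix_mult]

lemmas transpose_simps =
  linear_add[OF bounded_linear.linear[OF bounded_linear_transpose]]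
  linear_diff[OF bounded_linear.linear[OF bounded_linear_transpose]]
  linear_neg[OF bounded_linear.linear[OF bounded_linear_transpose]]
  linear_0[OF bounded_linear.linear[OF bounded_linear_transpose]]
  linear_scale[OF bounded_linear.linear[OF bounded_linear_transpose]]
  matrix_transpose_mul

lemma inner_matrix_trace: "A \<bullet> B = trace (transpose A ** B)" for A B :: "real ^ 'm ^ 'n"
  unfolding trace_def inner_vec_def matrix_matrix_mult_def transpose_def
  by (simp add: sum.swap[of _ "UNIV :: 'n set"])

lemma trace_commute: "trace (A ** B) = trace (B ** A)" for A :: "real ^ 'm ^ 'n" and B :: "real ^ 'n ^ 'm"
  unfolding trace_def matrix_matrix_mult_def
  by (simp add: sum.swap[of _ "UNIV :: 'n set"] mult.commute)

lemma trace_transpose: "trace (transpose A) = trace A" for A :: "real ^ 'n ^ 'n"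
  by (simp add: trace_def transpose_def)

lemma inner_matmul_left: "(A ** B) \<bullet> C = B \<bullet> (transpose A ** C)"
  for A :: "real ^ 'm ^ 'n" and B :: "real ^ 'k ^ 'm" and C :: "real ^ 'k ^ 'n"
  by (simp add: inner_matrix_trace matrix_transpose_mul matrix_mul_assoc)

lemma inner_matmul_right: "(A ** B) \<bullet> C = A \<bullet> (C ** transpose B)"
  for A :: "real ^ 'm ^ 'n" and B :: "real ^ 'k ^ 'm" and C :: "real ^ 'k ^ 'n"
  using trace_commute[of "transpose B" "transpose A ** C"]
  by (simp add: inner_matrix_trace matrix_transpose_mul matrix_mul_assoc)

lemma inner_transpose: "transpose A \<bullet> transpose B = A \<bullet> B" for A B :: "real ^ 'm ^ 'n"
proof -
  have "trace (A ** transpose B) = trace (B ** transpose A)"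
    using trace_transpose[of "A ** transpose B"] by (simp add: matrix_transpose_mul)
  also have "\<dots> = trace (transpose A ** B)" by (rule trace_commute)
  finally show ?thesis by (simp add: inner_matrix_trace)
qed

lemma det_nz_iff_ker: "det A \<noteq> 0 \<longleftrightarrow> (\<forall>x. A *v x = 0 \<longrightarrow> x = 0)" for A :: "real ^ 'n ^ 'n"
  by (metis invertible_det_nz invertible_left_inverse matrix_left_invertible_ker)

lemma transpose_matrix_inv:
  fixes A :: "real ^ 'n ^ 'n"
  assumes "det A \<noteq> 0"
  shows "transpose (matrix_inv A) = matrix_inv (transpose A)"
proof -
  have dT: "det (transpose A) \<noteq> 0" using assms by simp
  have "transpose A ** transpose (matrix_inv A) = mat 1"
    using matrix_inv_det(2)[OF assms] by (metis matrix_transpose_mul transpose_mat)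
  then have "matrix_inv (transpose A) ** (transpose A ** transpose (matrix_inv A)) = matrix_inv (transpose A)"
    by simp
  then show ?thesis using matrix_inv_det(2)[OF dT] by (simp add: matrix_mul_assoc)
qed

lemma inner_matrix_vector: "(A *v x) \<bullet> y = x \<bullet> (transpose A *v y)" for A :: "real ^ 'm ^ 'n"
  by (metis dot_lmul_matrix inner_commute transpose_matrix_vector)

lemma C_dirs_matmul:
  fixes F :: "'a::euclidean_space \<Rightarrow> real ^ 'm ^ 'n" and G :: "'a \<Rightarrow> real ^ 'k ^ 'm"
  shows "C_dirs B k S F \<Longrightarrow> C_dirs B k S G \<Longrightarrow> C_dirs B k S (\<lambda>x. F x ** G x)"
  by (rule C_dirs_bilinear[OF bounded_bilinear_matrix_mult])

lemma C_dirs_transpose: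
  fixes F :: "'a::euclidean_space \<Rightarrow> real ^ 'm ^ 'n"
  shows "C_dirs B k S F \<Longrightarrow> C_dirs B k S (\<lambda>x. transpose (F x))"
  by (rule C_dirs_linear_comp[OF bounded_linear_transpose])

lemma C_dirs_det_comp:
  fixes F :: "'a::euclidean_space \<Rightarrow> real ^ 'n ^ 'n"
  shows "C_dirs B k S F \<Longrightarrow> C_dirs B k S (\<lambda>x. det (F x))"
  by (rule C_dirs_det) (rule C_dirs_linear_comp[OF bounded_linear_entry])

section \<open>Frames and oblique projections\<close>

text \<open>The projection onto the range of \<open>\<Phi>\<close> along the orthogonal complement
  of the range of \<open>\<Psi>\<close>, written in frames; it has this meaning when
  \<open>transpose \<Psi> ** \<Phi>\<close> is invertible. Equal frames give the orthogonal
  projection.\<close>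

definition oblique :: "real ^ 'r ^ 'n \<Rightarrow> real ^ 'r ^ 'n \<Rightarrow> real ^ 'n ^ 'n" where
  "oblique \<Phi> \<Psi> = \<Phi> ** matrix_inv (transpose \<Psi> ** \<Phi>) ** transpose \<Psi>"

lemma full_rank_iff_ker: "\<Phi> \<in> full_rank \<longleftrightarrow> (\<forall>c. \<Phi> *v c = 0 \<longrightarrow> c = 0)" for \<Phi> :: "real ^ 'r ^ 'n"
proof -
  have eq: "(\<Sum>j\<in>UNIV. c $ j *\<^sub>R column j \<Phi>) = \<Phi> *v c" for c
    by (simp add: matrix_mult_sum scalar_mult_eq_scaleR)
  show ?thesis
  proof
    assume "\<Phi> \<in> full_rank"
    then show "\<forall>c. \<Phi> *v c = 0 \<longrightarrow> c = 0"
      unfolding full_rank_def mem_Collect_eq eq[symmetric] by (metis vec_eq_iff zero_index)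
  next
    assume R: "\<forall>c. \<Phi> *v c = 0 \<longrightarrow> c = 0"
    show "\<Phi> \<in> full_rank"
      unfolding full_rank_def mem_Collect_eq
    proof (intro allI impI)
      fix c :: "'r \<Rightarrow> real" and j assume "(\<Sum>j\<in>UNIV. c j *\<^sub>R column j \<Phi>) = 0"
      then have "\<Phi> *v (\<chi> j. c j) = 0" by (simp flip: eq)
      then have "(\<chi> j. c j) = 0" using R by blast
      then show "c j = 0" by (metis vec_lambda_beta zero_index)
    qed
  qed
qed

lemma gram_ker: "(transpose \<Phi> ** \<Phi>) *v c = 0 \<longleftrightarrow> \<Phi> *v c = 0" for \<Phi> :: "real ^ 'r ^ 'n"
proof
  assume "(transpose \<Phi> ** \<Phi>) *v c = 0"
  then have "c \<bullet> (transpose \<Phi> *v (\<Phi> *v c)) = 0" by (simp add: matrix_vector_mul_assoc)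
  then show "\<Phi> *v c = 0" by (simp flip: inner_matrix_vector)
qed (simp flip: matrix_vector_mul_assoc)

lemma full_rank_iff_det: "\<Phi> \<in> full_rank \<longleftrightarrow> det (transpose \<Phi> ** \<Phi>) \<noteq> 0"
  unfolding full_rank_iff_ker det_nz_iff_ker gram_ker ..

lemma full_rank_oblique:
  assumes "det (transpose \<Psi> ** \<Phi>) \<noteq> 0"
  shows "\<Phi> \<in> full_rank" "\<Psi> \<in> full_rank"
proof -
  show "\<Phi> \<in> full_rank" unfolding full_rank_iff_ker
    using assms[unfolded det_nz_iff_ker] by (auto simp flip: matrix_vector_mul_assoc)
  have "det (transpose \<Phi> ** \<Psi>) \<noteq> 0"
    using assms by (metis det_transpose matrix_transpose_mul transpose_transpose)
  then show "\<Psi> \<in> full_rank" unfolding full_rank_iff_ker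
    unfolding det_nz_iff_ker by (auto simp flip: matrix_vector_mul_assoc)
qed

lemma open_det_nz:
  "open {z :: (real ^ 'r ^ 'n) \<times> (real ^ 'r ^ 'n). det (transpose (snd z) ** fst z) \<noteq> 0}"
proof -
  have "C_k 0 UNIV (\<lambda>z :: (real ^ 'r ^ 'n) \<times> (real ^ 'r ^ 'n). det (transpose (snd z) ** fst z))"
    by (intro C_dirs_det_comp C_dirs_matmul C_dirs_transpose C_dirs_bounded_linear bounded_linear_intros)
  then show ?thesis
    using open_Collect_neq[OF _ continuous_on_const, of _ 0] by simp
qed

lemma open_full_rank: "open (full_rank :: (real ^ 'r ^ 'n) set)"
proof -
  have "full_rank = (\<lambda>\<Phi>. (\<Phi>, \<Phi>)) -` {z :: (real ^ 'r ^ 'n) \<times> (real ^ 'r ^ 'n). det (transpose (snd z) ** fst z) \<noteq> 0}"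
    by (auto simp: full_rank_iff_det)
  moreover have "open ((\<lambda>\<Phi>. (\<Phi>, \<Phi>)) -` {z :: (real ^ 'r ^ 'n) \<times> (real ^ 'r ^ 'n). det (transpose (snd z) ** fst z) \<noteq> 0})"
    by (intro continuous_open_vimage open_det_nz allI continuous_intros)
  ultimately show ?thesis by simp
qed

lemma C_k_oblique:
  "C_k k {z :: (real ^ 'r ^ 'n) \<times> (real ^ 'r ^ 'n). det (transpose (snd z) ** fst z) \<noteq> 0} (\<lambda>z. oblique (fst z) (snd z))"
  unfolding oblique_def
  by (intro C_dirs_matmul C_dirs_transpose C_dirs_matrix_inv open_det_nz C_dirs_bounded_linear bounded_linear_intros) auto

lemma orthogonal_comp_range: "orthogonal_comp (range ((*v) A)) = {x. transpose A *v x = 0}" for A :: "real ^ 'k ^ 'n"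
proof -
  have "(\<forall>c. (A *v c) \<bullet> x = 0) \<longleftrightarrow> transpose A *v x = 0" for x
    unfolding inner_matrix_vector by (metis inner_eq_zero_iff inner_zero_right)
  then show ?thesis by (auto simp: orthogonal_comp_def orthogonal_def inner_commute)
qed

context
  fixes \<Phi> \<Psi> :: "real ^ 'r ^ 'n"
  assumes nz: "det (transpose \<Psi> ** \<Phi>) \<noteq> 0"
begin

lemma oblique_mult_frame: "oblique \<Phi> \<Psi> ** \<Phi> = \<Phi>"
  unfolding oblique_def using matrix_inv_det(2)[OF nz] by (simp add: matrix_mul_assoc[symmetric])

lemma frame_mult_oblique: "transpose \<Psi> ** oblique \<Phi> \<Psi> = transpose \<Psi>"
proof -
  have "transpose \<Psi> ** oblique \<Phi> \<Psi> = ((transpose \<Psi> ** \<Phi>) ** matrix_inv (transpose \<Psi> ** \<Phi>)) ** transpose \<Psi>"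
    unfolding oblique_def by (simp only: matrix_mul_assoc)
  then show ?thesis by (simp add: matrix_inv_det(1)[OF nz])
qed

lemma oblique_idem: "oblique \<Phi> \<Psi> ** oblique \<Phi> \<Psi> = oblique \<Phi> \<Psi>"
proof -
  have "oblique \<Phi> \<Psi> ** oblique \<Phi> \<Psi> = (oblique \<Phi> \<Psi> ** \<Phi>) ** matrix_inv (transpose \<Psi> ** \<Phi>) ** transpose \<Psi>"
    unfolding oblique_def[of \<Phi> \<Psi>] by (simp only: matrix_mul_assoc)
  then show ?thesis unfolding oblique_mult_frame by (simp add: oblique_def)
qed

lemma range_oblique: "range ((*v) (oblique \<Phi> \<Psi>)) = range ((*v) \<Phi>)"
proof
  show "range ((*v) (oblique \<Phi> \<Psi>)) \<subseteq> range ((*v) \<Phi>)"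
    unfolding oblique_def by (auto simp flip: matrix_vector_mul_assoc)
  have "\<Phi> *v c = oblique \<Phi> \<Psi> *v (\<Phi> *v c)" for c
    by (simp add: matrix_vector_mul_assoc oblique_mult_frame)
  then show "range ((*v) \<Phi>) \<subseteq> range ((*v) (oblique \<Phi> \<Psi>))" by (metis image_subsetI rangeI)
qed

lemma ker_oblique: "{x. oblique \<Phi> \<Psi> *v x = 0} = orthogonal_comp (range ((*v) \<Psi>))"
proof -
  have "transpose \<Psi> *v x = 0" if "oblique \<Phi> \<Psi> *v x = 0" for x
    using that frame_mult_oblique by (metis matrix_vector_mul_assoc matrix_vector_mult_0_right)
  moreover have "oblique \<Phi> \<Psi> *v x = 0" if "transpose \<Psi> *v x = 0" for x
    using that by (simp add: oblique_def flip: matrix_vector_mul_assoc)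
  ultimately show ?thesis unfolding orthogonal_comp_range by blast
qed

text \<open>A projection is determined by range and kernel: for any candidate \<open>P\<close>, the
  vector \<open>x - oblique \<Phi> \<Psi> *v x\<close> lies in the common kernel, and on the common
  range both act as the identity.\<close>

lemma oblique_proj_eq: "oblique_proj (range ((*v) \<Phi>)) (range ((*v) \<Psi>)) = oblique \<Phi> \<Psi>"
  unfolding oblique_proj_def
proof (rule the_equality)
  show "oblique \<Phi> \<Psi> ** oblique \<Phi> \<Psi> = oblique \<Phi> \<Psi> \<and> range ((*v) (oblique \<Phi> \<Psi>)) = range ((*v) \<Phi>) \<and>
      {x. oblique \<Phi> \<Psi> *v x = 0} = orthogonal_comp (range ((*v) \<Psi>))"
    by (intro conjI oblique_idem range_oblique ker_oblique)
  fix P :: "real ^ 'n ^ 'n"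
  assume P: "P ** P = P \<and> range ((*v) P) = range ((*v) \<Phi>) \<and> {x. P *v x = 0} = orthogonal_comp (range ((*v) \<Psi>))"
  show "P = oblique \<Phi> \<Psi>"
    unfolding matrix_eq
  proof
    fix x
    have "oblique \<Phi> \<Psi> *v (x - oblique \<Phi> \<Psi> *v x) = 0"
      by (simp add: matrix_vector_mult_diff_distrib matrix_vector_mul_assoc oblique_idem)
    then have "P *v (x - oblique \<Phi> \<Psi> *v x) = 0" using P ker_oblique by blast
    moreover have "P *v (oblique \<Phi> \<Psi> *v x) = oblique \<Phi> \<Psi> *v x"
    proof -
      have "oblique \<Phi> \<Psi> *v x \<in> range ((*v) P)" using P range_oblique by blast
      then obtain y where "oblique \<Phi> \<Psi> *v x = P *v y" by blast
      then show ?thesis using P by (metis matrix_vector_mul_assoc)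
    qed
    ultimately show "P *v x = oblique \<Phi> \<Psi> *v x"
      by (simp add: matrix_vector_mult_diff_distrib)
  qed
qed

end

lemma dim_range_full_rank:
  fixes \<Phi> :: "real ^ 'r ^ 'n"
  assumes "\<Phi> \<in> full_rank"
  shows "dim (range ((*v) \<Phi>)) = CARD('r)"
proof -
  have "inj ((*v) \<Phi>)"
    using assms[unfolded full_rank_iff_ker] linear_injective_0[OF matrix_vector_mul_linear[of \<Phi>]] by blast
  then have "dim (range ((*v) \<Phi>)) = dim (UNIV :: (real ^ 'r) set)"
    by (intro dim_image_eq) (auto intro: inj_on_subset)
  then show ?thesis by simp
qed

lemma CARD_le_of_full_rank:
  fixes \<Phi> :: "real ^ 'r ^ 'n"
  shows "\<Phi> \<in> full_rank \<Longrightarrow> CARD('r) \<le> CARD('n)"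
  using dim_range_full_rank[of \<Phi>] dim_subset_UNIV[of "range ((*v) \<Phi>)"] by simp

lemma space_of_range_of:
  fixes \<Phi> :: "real ^ 'r ^ 'n"
  assumes "\<Phi> \<in> full_rank"
  shows "space_of (range_of \<Phi>) = range ((*v) \<Phi>)"
proof -
  have "subspace (range ((*v) \<Phi>))"
    by (simp add: linear_subspace_image matrix_vector_mul_linear)
  then show ?thesis
    unfolding range_of_def using assms
    by (intro Grass_inverse) (simp add: dim_range_full_rank CARD_le_of_full_rank)
qed

lemma range_of_eqI:
  fixes \<Phi> :: "real ^ 'r ^ 'n"
  assumes \<Phi>: "\<Phi> \<in> full_rank" and sub: "range ((*v) \<Phi>) \<subseteq> space_of V"
  shows "range_of \<Phi> = V"
proof -
  have V: "subspace (space_of V)" "dim (space_of V) = min CARD('r) CARD('n)" using space_of[of V] by auto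
  have "range ((*v) \<Phi>) = space_of V"
    using V sub dim_range_full_rank[OF \<Phi>]
    by (intro subspace_dim_equal) (auto simp: linear_subspace_image matrix_vector_mul_linear)
  then show ?thesis using space_of_range_of[OF \<Phi>] by (simp add: space_of_inject[symmetric])
qed

lemma orthonormal_frame:
  fixes V :: "('n::finite, 'r::finite) grassmann"
  assumes "CARD('r) \<le> CARD('n)"
  obtains \<Phi> :: "real ^ 'r ^ 'n" where "transpose \<Phi> ** \<Phi> = mat 1" "\<Phi> \<in> full_rank" "range_of \<Phi> = V"
proof -
  have V: "subspace (space_of V)" "dim (space_of V) = CARD('r)" using space_of[of V] assms by auto
  obtain B where B: "B \<subseteq> space_of V" "pairwise orthogonal B" "\<And>x. x \<in> B \<Longrightarrow> norm x = 1" "independent B" "card B = dim (space_of V)"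
    using orthonormal_basis_subspace[OF V(1)] by metis
  then obtain f :: "'r \<Rightarrow> real ^ 'n" where f: "bij_betw f UNIV B"
    using V(2) finite_same_card_bij[of "UNIV :: 'r set" B] independent_imp_finite by auto
  define \<Phi> :: "real ^ 'r ^ 'n" where "\<Phi> = (\<chi> i j. f j $ i)"
  have "(transpose \<Phi> ** \<Phi>) $ i $ j = (if i = j then 1 else 0)" for i j
  proof -
    have "(transpose \<Phi> ** \<Phi>) $ i $ j = f i \<bullet> f j"
      by (simp add: matrix_matrix_mult_def transpose_def \<Phi>_def inner_vec_def)
    moreover have "f i \<in> B" "f j \<in> B" using f by (auto simp: bij_betw_def)
    moreover have "f i = f j \<Longrightarrow> i = j" using f by (auto simp: bij_betw_def inj_on_def)
    ultimately show ?thesis using B(2,3) by (auto simp: pairwise_def orthogonal_def norm_eq_1)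
  qed
  then have 1: "transpose \<Phi> ** \<Phi> = mat 1" by (simp add: vec_eq_iff mat_def)
  then have 2: "\<Phi> \<in> full_rank" by (simp add: full_rank_iff_det)
  have "\<Phi> *v c \<in> space_of V" for c
  proof -
    have "\<Phi> *v c = (\<Sum>j\<in>UNIV. c $ j *\<^sub>R f j)"
      by (simp add: matrix_mult_sum scalar_mult_eq_scaleR column_def \<Phi>_def)
    moreover have "f j \<in> space_of V" for j using f B(1) by (auto simp: bij_betw_def)
    ultimately show ?thesis using V(1) by (simp add: subspace_sum subspace_scale)
  qed
  then have "range_of \<Phi> = V" using 2 by (intro range_of_eqI) auto
  then show thesis using that 1 2 by blast
qed

text \<open>A vector \<open>c\<close> in the kernel of \<open>transpose \<Psi> ** \<Phi>\<close>
  gives a vector \<open>\<Phi> *v c\<close> in the intersection of \<open>V\<close> with the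
  complement of \<open>W\<close>. Conversely, the oblique projection splits every vector.\<close>

lemma admissible_iff:
  fixes \<Phi> \<Psi> :: "real ^ 'r ^ 'n"
  assumes "\<Phi> \<in> full_rank" "\<Psi> \<in> full_rank"
  shows "(range_of \<Phi>, range_of \<Psi>) \<in> admissible_pairs \<longleftrightarrow> det (transpose \<Psi> ** \<Phi>) \<noteq> 0"
proof
  assume "(range_of \<Phi>, range_of \<Psi>) \<in> admissible_pairs"
  then have int: "range ((*v) \<Phi>) \<inter> {x. transpose \<Psi> *v x = 0} = {0}"
    using assms by (simp add: admissible_pairs_def space_of_range_of orthogonal_comp_range)
  have "c = 0" if "(transpose \<Psi> ** \<Phi>) *v c = 0" for c
  proof -
    have "\<Phi> *v c \<in> range ((*v) \<Phi>) \<inter> {x. transpose \<Psi> *v x = 0}"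
      using that by (simp add: matrix_vector_mul_assoc)
    then have "\<Phi> *v c = 0" using int by blast
    then show "c = 0" using assms(1) by (simp add: full_rank_iff_ker)
  qed
  then show "det (transpose \<Psi> ** \<Phi>) \<noteq> 0" unfolding det_nz_iff_ker by blast
next
  assume nz: "det (transpose \<Psi> ** \<Phi>) \<noteq> 0"
  let ?P = "oblique \<Phi> \<Psi>"
  have P: "?P *v x = x" if "x \<in> range ((*v) \<Phi>)" for x
    using that oblique_mult_frame[OF nz] by (auto simp: matrix_vector_mul_assoc)
  have "range ((*v) \<Phi>) \<inter> {x. ?P *v x = 0} = {0}"
    using P range_oblique[OF nz] by (auto intro!: image_eqI[of _ _ 0])
  moreover have "\<exists>v w. x = v + w \<and> v \<in> range ((*v) \<Phi>) \<and> ?P *v w = 0" for x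
  proof (intro exI conjI)
    show "x = ?P *v x + (x - ?P *v x)" by simp
    show "?P *v x \<in> range ((*v) \<Phi>)" using range_oblique[OF nz] by blast
    show "?P *v (x - ?P *v x) = 0"
      by (simp add: matrix_vector_mult_diff_distrib matrix_vector_mul_assoc oblique_idem[OF nz])
  qed
  ultimately show "(range_of \<Phi>, range_of \<Psi>) \<in> admissible_pairs"
    using assms by (auto simp: admissible_pairs_def space_of_range_of ker_oblique[OF nz, symmetric])
qed

section \<open>Tangent spaces of the Grassmann manifold as spaces of matrices\<close>

lemma C_k_Suc_frechet_derivative:
  fixes F :: "'a::euclidean_space \<Rightarrow> 'b::real_normed_vector"
  assumes F: "C_k (Suc k) S F" and S: "open S"
  shows "x \<in> S \<Longrightarrow> (F has_derivative frechet_derivative F (at x)) (at x)"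
    and "C_k k S (\<lambda>x. frechet_derivative F (at x) h)"
proof -
  obtain F' where F': "\<And>b. b \<in> Basis \<Longrightarrow> C_k k S (F' b)"
    and der: "\<And>x. x \<in> S \<Longrightarrow> (F has_derivative (\<lambda>h. \<Sum>b\<in>Basis. (h \<bullet> b) *\<^sub>R F' b x)) (at x)"
    by (rule C_k_SucE[OF F S]) (rule that)
  have eq: "frechet_derivative F (at x) = (\<lambda>h. \<Sum>b\<in>Basis. (h \<bullet> b) *\<^sub>R F' b x)" if "x \<in> S" for x
    using frechet_derivative_at[OF der[OF that]] by simp
  show "(F has_derivative frechet_derivative F (at x)) (at x)" if "x \<in> S"
    unfolding eq[OF that] using der[OF that] .
  have "C_k k S (\<lambda>x. \<Sum>b\<in>Basis. (h \<bullet> b) *\<^sub>R F' b x)"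
    using F' by (intro C_dirs_sum C_dirs_scaleR C_dirs_const)
  then show "C_k k S (\<lambda>x. frechet_derivative F (at x) h)"
    by (rule C_dirs_cong[OF S, rotated]) (simp add: eq)
qed

lemma has_derivative_eq_on_open:
  assumes "(F has_derivative F') (at x)" "(G has_derivative G') (at x)"
    and "open S" "x \<in> S" "\<And>y. y \<in> S \<Longrightarrow> F y = G y"
  shows "F' h = G' h"
proof -
  have "(G has_derivative F') (at x)"
    using has_derivative_transform_within_open[OF assms(1,3,4)] assms(5) by simp
  then show ?thesis using has_derivative_unique[OF assms(2)] by metis
qed

section \<open>Orthogonal projectors and their tangent matrices\<close>

definition orth_projector :: "real ^ 'n ^ 'n \<Rightarrow> bool" where
  "orth_projector P \<longleftrightarrow> P ** P = P \<and> transpose P = P"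

text \<open>The two equations are the linearizations of \<open>transpose P = P\<close> and
  \<open>P ** P = P\<close>. Relative to the splitting into range and kernel of \<open>P\<close>,
  they single out the symmetric matrices with vanishing diagonal blocks.\<close>

definition tan_at :: "real ^ 'n ^ 'n \<Rightarrow> (real ^ 'n ^ 'n) set" where
  "tan_at P = {\<xi>. transpose \<xi> = \<xi> \<and> \<xi> ** P + P ** \<xi> = \<xi>}"

definition sym_part :: "real ^ 'n ^ 'n \<Rightarrow> real ^ 'n ^ 'n" where
  "sym_part Z = (1/2) *\<^sub>R (Z + transpose Z)"

text \<open>With \<open>S\<close> the symmetric part of \<open>Z\<close> and \<open>I\<close> the
  identity, this is P S (I - P) + (I - P) S P, the off-diagonal part of \<open>S\<close>: the
  orthogonal projection onto \<open>tan_at P\<close> when \<open>P\<close> is an orthogonal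
  projector.\<close>

definition tproj :: "real ^ 'n ^ 'n \<Rightarrow> real ^ 'n ^ 'n \<Rightarrow> real ^ 'n ^ 'n" where
  "tproj P Z = P ** sym_part Z + sym_part Z ** P - 2 *\<^sub>R (P ** sym_part Z ** P)"

definition dtproj :: "real ^ 'n ^ 'n \<Rightarrow> real ^ 'n ^ 'n \<Rightarrow> real ^ 'n ^ 'n \<Rightarrow> real ^ 'n ^ 'n" where
  "dtproj P Z \<zeta> = \<zeta> ** sym_part Z + sym_part Z ** \<zeta> - 2 *\<^sub>R (\<zeta> ** sym_part Z ** P + P ** sym_part Z ** \<zeta>)"

lemma bounded_linear_sym_part: "bounded_linear sym_part"
  unfolding sym_part_def
  by (intro bounded_linear_intros bounded_linear_transpose bounded_linear_compose[OF bounded_linear_scaleR_right])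

lemma sym_part_id: "transpose Z = Z \<Longrightarrow> sym_part Z = Z"
  by (simp add: sym_part_def flip: scaleR_2)

lemma transpose_sym_part: "transpose (sym_part Z) = sym_part Z"
  by (simp add: sym_part_def transpose_simps add.commute)

lemma inner_sym_part: "transpose \<xi> = \<xi> \<Longrightarrow> \<xi> \<bullet> sym_part Z = \<xi> \<bullet> Z"
  using inner_transpose[of \<xi> Z] by (simp add: sym_part_def inner_add_right)

lemma bounded_linear_tproj: "bounded_linear (tproj P)"
  unfolding tproj_def
  by (intro bounded_linear_intros bounded_linear_compose[OF bounded_linear_scaleR_right]
      bounded_linear_compose[OF bounded_bilinear.bounded_linear_left[OF bounded_bilinear_matrix_mult]]
      bounded_linear_compose[OF bounded_bilinear.bounded_linear_right[OF bounded_bilinear_matrix_mult]]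
      bounded_linear_sym_part)

lemma has_derivative_tproj: "((\<lambda>P. tproj P Z) has_derivative dtproj P Z) (at P within S)"
  unfolding tproj_def dtproj_def
  by (rule derivative_eq_intros bounded_bilinear.FDERIV[OF bounded_bilinear_matrix_mult] refl)+
    (simp add: matmul_simps algebra_simps)

lemma C_dirs_tproj:
  fixes F G :: "'a::euclidean_space \<Rightarrow> real ^ 'n ^ 'n"
  assumes "C_dirs B k S F" "C_dirs B k S G"
  shows "C_dirs B k S (\<lambda>x. tproj (F x) (G x))"
  unfolding tproj_def
  by (intro C_dirs_add C_dirs_diff C_dirs_matmul C_dirs_scaleR[OF C_dirs_const]
      C_dirs_linear_comp[OF bounded_linear_sym_part] assms)

context
  fixes P :: "real ^ 'n ^ 'n"
  assumes P: "orth_projector P"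
begin

lemma PP: "P ** P = P" and PPl: "X ** P ** P = X ** P" and Pt: "transpose P = P" for X :: "real ^ 'n ^ 'm"
  using P by (auto simp: orth_projector_def simp flip: matrix_mul_assoc)

lemma tan_atD:
  assumes "\<xi> \<in> tan_at P"
  shows "transpose \<xi> = \<xi>" "P ** \<xi> = \<xi> - \<xi> ** P" "P ** \<xi> ** P = 0"
proof -
  show 1: "transpose \<xi> = \<xi>" and 2: "P ** \<xi> = \<xi> - \<xi> ** P"
    using assms by (auto simp: tan_at_def algebra_simps)
  show "P ** \<xi> ** P = 0" unfolding 2 by (simp add: matmul_simps PPl)
qed

lemma tproj_in: "tproj P Z \<in> tan_at P"
proof -
  let ?S = "sym_part Z"
  have t: "transpose (P ** ?S) = ?S ** P" "transpose (?S ** P) = P ** ?S"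
    "transpose (P ** ?S ** P) = P ** ?S ** P"
    by (simp_all add: transpose_simps transpose_sym_part Pt matrix_mul_assoc)
  have "transpose (tproj P Z) = ?S ** P + P ** ?S - 2 *\<^sub>R (P ** ?S ** P)"
    unfolding tproj_def by (simp only: transpose_simps(1,2,5) t)
  moreover have "tproj P Z ** P + P ** tproj P Z =
      (P ** ?S ** P + ?S ** P - 2 *\<^sub>R (P ** ?S ** P)) + (P ** ?S + P ** ?S ** P - 2 *\<^sub>R (P ** ?S ** P))"
    unfolding tproj_def by (simp only: matmul_simps matrix_mul_assoc PP PPl)
  ultimately show ?thesis
    by (simp add: tan_at_def tproj_def scaleR_2 add.commute)
qed

lemma tproj_id: "\<xi> \<in> tan_at P \<Longrightarrow> tproj P \<xi> = \<xi>"
proof -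
  assume \<xi>: "\<xi> \<in> tan_at P"
  have "tproj P \<xi> = P ** \<xi> + \<xi> ** P - 2 *\<^sub>R 0"
    unfolding tproj_def sym_part_id[OF tan_atD(1)[OF \<xi>]] tan_atD(3)[OF \<xi>] ..
  then show ?thesis by (simp add: tan_atD(2)[OF \<xi>])
qed

lemma inner_tproj: "\<xi> \<in> tan_at P \<Longrightarrow> \<xi> \<bullet> tproj P Z = \<xi> \<bullet> Z"
proof -
  assume \<xi>: "\<xi> \<in> tan_at P"
  have l: "\<xi> \<bullet> (P ** X) = (P ** \<xi>) \<bullet> X" for X
    using inner_matmul_left[of P X \<xi>] by (simp add: Pt inner_commute)
  have r: "Y \<bullet> (X ** P) = (Y ** P) \<bullet> X" for X Y :: "real ^ 'n ^ 'n"
    using inner_matmul_right[of X P Y] by (simp add: Pt inner_commute)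
  have "\<xi> \<bullet> tproj P Z = (P ** \<xi> + \<xi> ** P - 2 *\<^sub>R (P ** \<xi> ** P)) \<bullet> sym_part Z"
    unfolding tproj_def by (simp add: inner_simps l r matrix_mul_assoc[symmetric])
  also have "\<dots> = \<xi> \<bullet> sym_part Z" using tan_atD[OF \<xi>] by simp
  finally show ?thesis by (simp add: inner_sym_part tan_atD[OF \<xi>])
qed

text \<open>A matrix commuting with \<open>P\<close> has no off-diagonal blocks, so nothing of it is
  tangent.\<close>

lemma tproj_eq_0: "P ** N = N ** P \<Longrightarrow> transpose N = N \<Longrightarrow> tproj P N = 0"
  by (simp add: tproj_def sym_part_id PPl scaleR_2)

text \<open>Multiplying the equation by \<open>P\<close> from the left and from the right shows that
  \<open>P ** N\<close> and \<open>N ** P\<close> both equal \<open>P ** N ** P\<close>.\<close>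

lemma tproj_eq_0D:
  assumes "tproj P N = 0" "transpose N = N"
  shows "N ** P = P ** N"
proof -
  have *: "P ** N + N ** P = 2 *\<^sub>R (P ** N ** P)"
    using assms by (simp add: tproj_def sym_part_id)
  have "P ** (P ** N + N ** P) = 2 *\<^sub>R (P ** P ** N ** P)" "(P ** N + N ** P) ** P = 2 *\<^sub>R (P ** N ** P ** P)"
    unfolding * by (simp_all add: matmul_simps matrix_mul_assoc)
  then have "P ** N + P ** N ** P = 2 *\<^sub>R (P ** N ** P)" "P ** N ** P + N ** P = 2 *\<^sub>R (P ** N ** P)"
    by (simp_all add: matmul_simps matrix_mul_assoc PP PPl)
  then show ?thesis by (simp add: scaleR_2)
qed

text \<open>A tangent matrix exchanges range and kernel of \<open>P\<close>, so a product of two of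
  them preserves both and commutes with \<open>P\<close>. All terms of the derivative are such
  products, up to factors \<open>P\<close>, and the sum is symmetric, hence normal.\<close>

lemma tproj_dtproj_eq_0:
  assumes "\<xi> \<in> tan_at P" "\<zeta> \<in> tan_at P"
  shows "tproj P (dtproj P \<xi> \<zeta>) = 0"
proof (rule tproj_eq_0)
  have *: "P ** x ** y = x ** y ** P" if "x \<in> tan_at P" "y \<in> tan_at P" for x y
    using that by (simp add: tan_atD matmul_simps matrix_mul_assoc[symmetric])
  show "P ** dtproj P \<xi> \<zeta> = dtproj P \<xi> \<zeta> ** P"
    using assms by (simp add: dtproj_def sym_part_id tan_atD(1) matmul_simps matrix_mul_assoc * PP PPl)
  show "transpose (dtproj P \<xi> \<zeta>) = dtproj P \<xi> \<zeta>"
    using assms by (simp add: dtproj_def sym_part_id tan_atD(1) transpose_simps Pt matrix_mul_assoc add.commute)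
qed

end

lemma subspace_tan_at: "subspace (tan_at P)"
  by (auto simp: subspace_def tan_at_def transpose_simps matmul_simps algebra_simps simp flip: scaleR_add_right)

lemma orth_projector_derivative:
  assumes P: "\<And>s. s \<in> I \<Longrightarrow> orth_projector (P s)"
    and der: "(P has_vector_derivative P') (at t within I)" and t: "t \<in> I" "at t within I \<noteq> bot"
  shows "P' \<in> tan_at (P t)"
proof -
  have "((\<lambda>s. transpose (P s)) has_vector_derivative transpose P') (at t within I)"
    by (rule bounded_linear.has_vector_derivative[OF bounded_linear_transpose der])
  then have "(P has_vector_derivative transpose P') (at t within I)"
    by (rule has_vector_derivative_transform[rotated -1]) (use P t in \<open>auto simp: orth_projector_def\<close>)
  then have "transpose P' = P'" using vector_derivative_unique_within[OF t(2)] der by blast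
  moreover have "((\<lambda>s. P s ** P s) has_vector_derivative P t ** P' + P' ** P t) (at t within I)"
    by (rule bounded_bilinear.has_vector_derivative[OF bounded_bilinear_matrix_mult der der])
  then have "(P has_vector_derivative P t ** P' + P' ** P t) (at t within I)"
    by (rule has_vector_derivative_transform[rotated -1]) (use P t in \<open>auto simp: orth_projector_def\<close>)
  then have "P t ** P' + P' ** P t = P'" using vector_derivative_unique_within[OF t(2)] der by blast
  ultimately show ?thesis by (simp add: tan_at_def add.commute)
qed

section \<open>The map from frames to orthogonal projectors and its derivative\<close>

definition pr :: "real ^ 'r ^ 'n \<Rightarrow> real ^ 'n ^ 'n" where
  "pr \<Phi> = oblique \<Phi> \<Phi>"

lemma C_k_pr: "C_k k full_rank (pr :: real ^ 'r ^ 'n \<Rightarrow> _)"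
proof -
  have "C_k k (full_rank :: (real ^ 'r ^ 'n) set) (\<lambda>\<Phi>. \<Phi>)"
    by (rule C_dirs_bounded_linear[OF bounded_linear_ident])
  then show ?thesis
    unfolding pr_def[abs_def] oblique_def
    by (intro C_dirs_matmul C_dirs_transpose C_dirs_matrix_inv open_full_rank) (auto simp: full_rank_iff_det)
qed

context
  fixes \<Phi> :: "real ^ 'r ^ 'n"
  assumes \<Phi>: "\<Phi> \<in> full_rank"
begin

lemma orth_proj_range_of: "orth_proj (range_of \<Phi>) = pr \<Phi>"
  using \<Phi> by (simp add: orth_proj_def space_of_range_of pr_def oblique_proj_eq full_rank_iff_det)

lemma pr_mult_frame: "pr \<Phi> ** \<Phi> = \<Phi>" and frame_mult_pr: "transpose \<Phi> ** pr \<Phi> = transpose \<Phi>"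
  using \<Phi> by (simp_all add: pr_def oblique_mult_frame frame_mult_oblique full_rank_iff_det)

lemma orth_projector_pr: "orth_projector (pr \<Phi>)"
proof -
  have nz: "det (transpose \<Phi> ** \<Phi>) \<noteq> 0" using \<Phi> by (simp add: full_rank_iff_det)
  have "transpose (pr \<Phi>) = pr \<Phi>"
    by (simp add: pr_def oblique_def transpose_simps transpose_matrix_inv[OF nz] matrix_mul_assoc)
  then show ?thesis using oblique_idem[OF nz] by (simp add: orth_projector_def pr_def)
qed

lemma range_pr: "range ((*v) (pr \<Phi>)) = range ((*v) \<Phi>)"
  using \<Phi> by (simp add: pr_def range_oblique full_rank_iff_det)

end

context
  fixes \<Phi> :: "real ^ 'r ^ 'n"
  assumes \<Phi>: "\<Phi> \<in> full_rank"
begin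

lemma has_derivative_pr: "(pr has_derivative D_range_of \<Phi>) (at \<Phi>)"
proof -
  obtain F' where "(pr has_derivative F') (at \<Phi>)"
    using C_k_Suc_frechet_derivative(1)[OF C_k_pr open_full_rank \<Phi>] by blast
  moreover from this have "((\<lambda>\<Phi>. orth_proj (range_of \<Phi>)) has_derivative F') (at \<Phi>)"
    by (rule has_derivative_transform_within_open[OF _ open_full_rank \<Phi>])
      (simp add: orth_proj_range_of)
  ultimately show ?thesis
    unfolding D_range_of_def using frechet_derivative_at by metis
qed

text \<open>Differentiate the identity \<open>pr X ** X = X\<close> at \<open>\<Phi>\<close>. This
  determines the derivative on the range of the frame.\<close>

lemma D_range_of_frame: "D_range_of \<Phi> H ** \<Phi> = H - pr \<Phi> ** H"
proof -
  have "((\<lambda>X. pr X ** X) has_derivative (\<lambda>H. pr \<Phi> ** H + D_range_of \<Phi> H ** \<Phi>)) (at \<Phi>)"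
    by (rule bounded_bilinear.FDERIV[OF bounded_bilinear_matrix_mult has_derivative_pr has_derivative_ident])
  from has_derivative_eq_on_open[OF this has_derivative_ident open_full_rank \<Phi>, of H]
  have "pr \<Phi> ** H + D_range_of \<Phi> H ** \<Phi> = H"
    by (simp add: pr_mult_frame)
  then show ?thesis by (simp add: algebra_simps)
qed

lemma D_range_of_in: "D_range_of \<Phi> H \<in> tan_at (pr \<Phi>)"
proof -
  let ?c = "\<lambda>s::real. \<Phi> + s *\<^sub>R H"
  define I where "I = ?c -` full_rank"
  have I: "open I" "0 \<in> I"
    unfolding I_def using \<Phi> by (auto intro!: continuous_open_vimage open_full_rank continuous_intros)
  interpret bounded_linear "D_range_of \<Phi>"
    using has_derivative_pr by (rule has_derivative_bounded_linear)
  have "(?c has_derivative (\<lambda>s. s *\<^sub>R H)) (at 0)" by (auto intro!: derivative_eq_intros)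
  from has_derivative_compose[OF this, of pr "D_range_of \<Phi>"] has_derivative_pr
  have "((\<lambda>s. pr (?c s)) has_vector_derivative D_range_of \<Phi> H) (at 0)"
    by (simp add: has_vector_derivative_def scaleR)
  then have "((\<lambda>s. pr (?c s)) has_vector_derivative D_range_of \<Phi> H) (at 0 within I)"
    by (rule has_vector_derivative_at_within)
  moreover have "orth_projector (pr (?c s))" if "s \<in> I" for s
    using that by (intro orth_projector_pr) (simp add: I_def)
  moreover have "at 0 within I \<noteq> bot"
    unfolding at_within_open[OF I(2,1)] by (rule at_neq_bot)
  ultimately have "D_range_of \<Phi> H \<in> tan_at (pr (?c 0))"
    using I(2) by (intro orth_projector_derivative[where I = I]) auto
  then show ?thesis by simp
qed

text \<open>This exhibits \<open>\<xi> ** \<Phi>\<close> as the horizontal lift. The derivative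
  agrees with \<open>\<xi>\<close> after multiplication by \<open>pr \<Phi>\<close> from the right,
  by symmetry also from the left, and a tangent matrix is the sum of these two products.\<close>

lemma D_range_of_lift:
  assumes \<xi>: "\<xi> \<in> tan_at (pr \<Phi>)"
  shows "D_range_of \<Phi> (\<xi> ** \<Phi>) = \<xi>" "transpose \<Phi> ** (\<xi> ** \<Phi>) = 0"
proof -
  let ?P = "pr \<Phi>" and ?X = "D_range_of \<Phi> (\<xi> ** \<Phi>)"
  note P = orth_projector_pr[OF \<Phi>]
  have "?P ** \<xi> ** (?P ** \<Phi>) = 0"
    using tan_atD(3)[OF P \<xi>] by (simp add: matrix_mul_assoc matmul_simps)
  then have 0: "?P ** \<xi> ** \<Phi> = 0" by (simp add: pr_mult_frame[OF \<Phi>])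
  then have "?X ** \<Phi> = \<xi> ** \<Phi>"
    by (simp add: D_range_of_frame matrix_mul_assoc)
  then have XP: "?X ** ?P = \<xi> ** ?P"
    by (simp add: pr_def oblique_def matrix_mul_assoc)
  then have "transpose (?X ** ?P) = transpose (\<xi> ** ?P)" by simp
  then have PX: "?P ** ?X = ?P ** \<xi>"
    using tan_atD(1)[OF P D_range_of_in[of "\<xi> ** \<Phi>"]] tan_atD(1)[OF P \<xi>] P
    by (simp add: transpose_simps orth_projector_def)
  show "?X = \<xi>"
    using tan_atD(2)[OF P D_range_of_in[of "\<xi> ** \<Phi>"]] tan_atD(2)[OF P \<xi>] XP PX by simp
  have "transpose \<Phi> ** ?P ** \<xi> ** \<Phi> = 0"
    using 0 by (metis matrix_mul_assoc matmul_simps(10))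
  then show "transpose \<Phi> ** (\<xi> ** \<Phi>) = 0" by (simp add: frame_mult_pr[OF \<Phi>] matrix_mul_assoc)
qed

lemma horizontal_lift_eq:
  assumes \<xi>: "\<xi> \<in> tan_at (pr \<Phi>)"
  shows "horizontal_lift \<Phi> \<xi> = \<xi> ** \<Phi>"
  unfolding horizontal_lift_def
proof (rule the_equality)
  show "transpose \<Phi> ** (\<xi> ** \<Phi>) = 0 \<and> D_range_of \<Phi> (\<xi> ** \<Phi>) = \<xi>"
    using D_range_of_lift[OF \<xi>] by blast
  fix H assume H: "transpose \<Phi> ** H = 0 \<and> D_range_of \<Phi> H = \<xi>"
  then have "pr \<Phi> ** H = 0"
    by (simp add: pr_def oblique_def matrix_mul_assoc[symmetric] matmul_simps)
  then show "H = \<xi> ** \<Phi>" using D_range_of_frame[of H] H by simp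
qed

text \<open>The projected columns lie in \<open>V\<close>, so they form a frame of it as soon as
  they are independent. For a fixed frame this gives a local inverse of \<open>range_of\<close>, on
  which all transfers between the manifold and matrices rest.\<close>

lemma range_of_projector_mult:
  assumes "orth_proj V ** \<Phi> \<in> full_rank" "CARD('r) \<le> CARD('n)"
  shows "range_of (orth_proj V ** \<Phi>) = V"
proof (rule range_of_eqI[OF assms(1)])
  obtain \<Psi> :: "real ^ 'r ^ 'n" where \<Psi>: "\<Psi> \<in> full_rank" "range_of \<Psi> = V"
    using orthonormal_frame[OF assms(2)] by metis
  have "det (transpose \<Psi> ** \<Psi>) \<noteq> 0" using \<Psi>(1) by (simp add: full_rank_iff_det)
  then have "orth_proj V = oblique \<Psi> \<Psi>"
    using \<Psi> by (auto simp: orth_proj_def space_of_range_of oblique_proj_eq)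
  then show "range ((*v) (orth_proj V ** \<Phi>)) \<subseteq> space_of V"
    using \<Psi> by (auto simp: space_of_range_of oblique_def simp flip: matrix_vector_mul_assoc)
qed

end

lemma frame_ex:
  fixes V :: "('n::finite, 'r::finite) grassmann"
  assumes "CARD('r) \<le> CARD('n)"
  obtains \<Phi> :: "real ^ 'r ^ 'n" where "\<Phi> \<in> full_rank" "range_of \<Phi> = V"
  using orthonormal_frame[OF assms] by metis

lemma some_basis:
  fixes V :: "('n::finite, 'r::finite) grassmann"
  assumes "CARD('r) \<le> CARD('n)"
  shows "some_basis V \<in> full_rank" "range_of (some_basis V) = V"
proof -
  have "some_basis V \<in> full_rank \<and> range_of (some_basis V) = V"
    unfolding some_basis_def by (rule someI_ex) (metis frame_ex[OF assms])
  then show "some_basis V \<in> full_rank" "range_of (some_basis V) = V" by auto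
qed

context
  fixes V :: "('n::finite, 'r::finite) grassmann"
  assumes le: "CARD('r) \<le> CARD('n)"
begin

lemma orth_projector_orth_proj: "orth_projector (orth_proj V)"
  using some_basis[OF le, of V] orth_proj_range_of orth_projector_pr by metis

lemma gtangent_eq: "gtangent V = tan_at (orth_proj V)"
proof
  show "gtangent V \<subseteq> tan_at (orth_proj V)"
    unfolding gtangent_def using D_range_of_in by (auto simp: orth_proj_range_of)
  show "tan_at (orth_proj V) \<subseteq> gtangent V"
  proof
    fix \<xi> assume \<xi>: "\<xi> \<in> tan_at (orth_proj V)"
    obtain \<Phi> :: "real ^ 'r ^ 'n" where \<Phi>: "\<Phi> \<in> full_rank" "range_of \<Phi> = V" using frame_ex[OF le] .
    then have "\<xi> \<in> tan_at (pr \<Phi>)" using \<xi> orth_proj_range_of by metis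
    then have "D_range_of \<Phi> (\<xi> ** \<Phi>) = \<xi>" using D_range_of_lift \<Phi> by blast
    moreover have "D_range_of \<Phi> (\<xi> ** \<Phi>) \<in> gtangent V" unfolding gtangent_def using \<Phi> by blast
    ultimately show "\<xi> \<in> gtangent V" by simp
  qed
qed

text \<open>With lifts of the form \<open>\<xi> ** \<Phi>\<close>, cyclicity of the trace collects
  the frame factors into the projector and leaves \<open>\<xi> \<bullet> (\<zeta> ** P)\<close>.
  Transposition gives the same value for \<open>\<xi> \<bullet> (P ** \<zeta>)\<close>, and the two
  add up to \<open>\<xi> \<bullet> \<zeta>\<close>; hence the factor 1/2.\<close>

lemma gmetric_eq:
  assumes \<xi>: "\<xi> \<in> tan_at (orth_proj V)" and \<zeta>: "\<zeta> \<in> tan_at (orth_proj V)"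
  shows "gmetric V \<xi> \<zeta> = (\<xi> \<bullet> \<zeta>) / 2"
proof -
  define \<Phi> where "\<Phi> = some_basis V"
  have \<Phi>: "\<Phi> \<in> full_rank" "range_of \<Phi> = V" unfolding \<Phi>_def using some_basis[OF le] by auto
  let ?P = "pr \<Phi>" and ?M = "matrix_inv (transpose \<Phi> ** \<Phi>)"
  have P: "orth_projector ?P" "orth_proj V = ?P" using orth_projector_pr orth_proj_range_of \<Phi> by metis+
  note sym = tan_atD(1)[OF P(1) \<xi>[unfolded P(2)]] tan_atD(1)[OF P(1) \<zeta>[unfolded P(2)]]
  have "gmetric V \<xi> \<zeta> = trace (?M ** (transpose (\<xi> ** \<Phi>) ** (\<zeta> ** \<Phi>)))"
    using \<xi> \<zeta> horizontal_lift_eq[OF \<Phi>(1)] P(2) by (simp add: gmetric_def \<Phi>_def[symmetric] Let_def)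
  also have "\<dots> = trace ((?M ** transpose \<Phi>) ** (\<xi> ** \<zeta> ** \<Phi>))"
    by (simp add: transpose_simps sym matrix_mul_assoc)
  also have "\<dots> = trace ((\<xi> ** \<zeta> ** \<Phi>) ** (?M ** transpose \<Phi>))" by (rule trace_commute)
  also have "\<dots> = \<xi> \<bullet> (\<zeta> ** ?P)"
    by (simp add: inner_matrix_trace sym pr_def oblique_def matrix_mul_assoc)
  finally have 1: "gmetric V \<xi> \<zeta> = \<xi> \<bullet> (\<zeta> ** ?P)" .
  have "\<xi> \<bullet> (?P ** \<zeta>) = \<xi> \<bullet> (\<zeta> ** ?P)"
    using inner_transpose[of \<xi> "\<zeta> ** ?P"] sym P(1) by (simp add: transpose_simps orth_projector_def)
  moreover have "\<xi> \<bullet> \<zeta> = \<xi> \<bullet> (\<zeta> ** ?P) + \<xi> \<bullet> (?P ** \<zeta>)"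
    using tan_atD(2)[OF P(1) \<zeta>[unfolded P(2)]] by (simp flip: inner_add_right)
  ultimately show ?thesis using 1 by simp
qed

lemma orth_proj_inject: "orth_proj V = orth_proj W \<longleftrightarrow> V = W" for W :: "('n, 'r) grassmann"
proof
  assume eq: "orth_proj V = orth_proj W"
  have *: "space_of X = range ((*v) (orth_proj X))" for X :: "('n, 'r) grassmann"
    using some_basis[OF le, of X] orth_proj_range_of range_pr space_of_range_of by metis
  show "V = W" using *[of V] *[of W] eq by (simp add: space_of_inject[symmetric])
qed simp

end

section \<open>Calculus on the product manifold\<close>

abbreviation frame_pairs :: "('n::finite, 'r::finite) frames set" where
  "frame_pairs \<equiv> full_rank \<times> full_rank"

text \<open>A pair of square matrices is itself of a frame type, with equal index types, so the same
  operation is the multiplication in the algebra of pairs of matrices.\<close>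

definition act :: "'n tvec \<Rightarrow> ('n::finite, 'r::finite) frames \<Rightarrow> ('n, 'r) frames" where
  "act A z = (fst A ** fst z, snd A ** snd z)"

definition pr2 :: "('n::finite, 'r::finite) frames \<Rightarrow> 'n tvec" where
  "pr2 z = (pr (fst z), pr (snd z))"

definition tproj2 :: "('n::finite) tvec \<Rightarrow> 'n tvec \<Rightarrow> 'n tvec" where
  "tproj2 P Z = (tproj (fst P) (fst Z), tproj (snd P) (snd Z))"

definition dtproj2 :: "('n::finite) tvec \<Rightarrow> 'n tvec \<Rightarrow> 'n tvec \<Rightarrow> 'n tvec" where
  "dtproj2 P Z \<zeta> = (dtproj (fst P) (fst Z) (fst \<zeta>), dtproj (snd P) (snd Z) (snd \<zeta>))"

lemma bounded_bilinear_act: "bounded_bilinear (act :: 'n tvec \<Rightarrow> ('n::finite, 'r::finite) frames \<Rightarrow> _)"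
proof -
  have "bilinear (act :: 'n tvec \<Rightarrow> ('n, 'r) frames \<Rightarrow> _)"
    unfolding bilinear_def linear_iff by (simp add: act_def matmul_simps)
  then show ?thesis by (simp add: bilinear_conv_bounded_bilinear)
qed

lemma open_frame_pairs: "open (frame_pairs :: ('n::finite, 'r::finite) frames set)"
  by (intro open_Times open_full_rank)

lemma C_k_pr2: "C_k k frame_pairs pr2"
proof -
  have "C_k k (frame_pairs :: ('n::finite, 'r::finite) frames set) (\<lambda>z. pr (fst z))"
    by (rule C_dirs_compose[OF open_full_rank _ C_k_pr C_dirs_bounded_linear[OF bounded_linear_fst]]) auto
  moreover have "C_k k (frame_pairs :: ('n::finite, 'r::finite) frames set) (\<lambda>z. pr (snd z))"
    by (rule C_dirs_compose[OF open_full_rank _ C_k_pr C_dirs_bounded_linear[OF bounded_linear_snd]]) auto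
  ultimately show ?thesis unfolding pr2_def[abs_def] by (rule C_dirs_Pair)
qed

lemma has_derivative_pr2: "z \<in> frame_pairs \<Longrightarrow> (pr2 has_derivative D_range_of2 z) (at z)"
  unfolding pr2_def[abs_def] D_range_of2_def[abs_def]
  by (intro has_derivative_Pair has_derivative_compose[OF has_derivative_fst[OF has_derivative_ident]]
      has_derivative_compose[OF has_derivative_snd[OF has_derivative_ident]] has_derivative_pr) auto

lemma act_pr2: "z \<in> frame_pairs \<Longrightarrow> act (pr2 z) z = z"
  by (auto simp: act_def pr2_def pr_mult_frame)

lemma continuous_on_range_of: "continuous_on full_rank (range_of :: real ^ 'r ^ 'n \<Rightarrow> ('n::finite, 'r::finite) grassmann)"
  unfolding continuous_on_open_invariant
proof (intro allI impI)
  fix B :: "('n, 'r) grassmann set" assume "open B"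
  then have "openin (top_of_set full_rank) {\<Phi> \<in> full_rank. range_of \<Phi> \<in> B}"
    by (simp add: open_grassmann_def)
  then have "open {\<Phi> \<in> full_rank. range_of \<Phi> \<in> B}"
    using open_full_rank by (rule openin_open_trans)
  then show "\<exists>A. open A \<and> A \<inter> full_rank = range_of -` B \<inter> full_rank"
    by (intro exI[of _ "{\<Phi> \<in> full_rank. range_of \<Phi> \<in> B}"]) auto
qed

lemma continuous_on_range_of2: "continuous_on frame_pairs range_of2"
  unfolding range_of2_def[abs_def]
  by (intro continuous_on_Pair continuous_on_compose2[OF continuous_on_range_of]) (auto intro: continuous_intros)

lemma open_preimage_range_of2: "open U \<Longrightarrow> open {z \<in> frame_pairs. range_of2 z \<in> U}"
  using continuous_open_preimage[OF continuous_on_range_of2 open_frame_pairs, of U]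
  by (simp add: vimage_def Int_def conj_commute)

lemma bounded_linear_tproj2: "bounded_linear (tproj2 P)"
  unfolding tproj2_def[abs_def]
  by (intro bounded_linear_Pair bounded_linear_compose[OF bounded_linear_tproj] bounded_linear_intros)

lemma has_derivative_tproj2: "((\<lambda>P. tproj2 P Z) has_derivative dtproj2 P Z) (at P)"
  unfolding tproj2_def dtproj2_def[abs_def]
  by (intro has_derivative_Pair has_derivative_compose[OF _ has_derivative_tproj] has_derivative_fst has_derivative_snd
      has_derivative_ident)

lemma C_dirs_tproj2:
  assumes "C_dirs B k S F" "C_dirs B k S G"
  shows "C_dirs B k S (\<lambda>x. tproj2 (F x) (G x))"
  unfolding tproj2_def
  by (intro C_dirs_Pair C_dirs_tproj C_dirs_fst C_dirs_snd assms)

section \<open>The product manifold as a set of pairs of projectors\<close>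

locale grassmannian =
  fixes dims :: "('n::finite \<times> 'r::finite) itself"
  assumes le: "CARD('r) \<le> CARD('n)"
begin

lemma embed_range_of2:
  fixes z :: "('n, 'r) frames"
  shows "z \<in> frame_pairs \<Longrightarrow> embed (range_of2 z) = pr2 z"
  by (auto simp: embed_def range_of2_def pr2_def orth_proj_range_of)

lemma frames_ex:
  fixes p :: "('n, 'r) pt"
  obtains z where "z \<in> frame_pairs" "range_of2 z = p" "act (embed p) z = z"
proof -
  obtain \<Phi> \<Psi> :: "real ^ 'r ^ 'n" where "\<Phi> \<in> full_rank" "range_of \<Phi> = fst p" "\<Psi> \<in> full_rank" "range_of \<Psi> = snd p"
    using frame_ex[OF le] by metis
  then have z: "(\<Phi>, \<Psi>) \<in> frame_pairs" "range_of2 (\<Phi>, \<Psi>) = p" by (auto simp: range_of2_def)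
  then show thesis using that act_pr2 embed_range_of2 by metis
qed

lemma embed_inject: "embed p = embed q \<longleftrightarrow> p = q" for p q :: "('n, 'r) pt"
  by (auto simp: embed_def orth_proj_inject[OF le] prod_eq_iff)

lemma orth_projector_embed:
  fixes p :: "('n, 'r) pt"
  shows "orth_projector (fst (embed p))" "orth_projector (snd (embed p))"
  by (simp_all add: embed_def orth_projector_orth_proj[OF le])

lemma tangent_eq: "tangent p = tan_at (fst (embed p)) \<times> tan_at (snd (embed p))" for p :: "('n, 'r) pt"
  by (simp add: tangent_def embed_def gtangent_eq[OF le])

lemma subspace_tangent: "subspace (tangent p)" for p :: "('n, 'r) pt"
  unfolding tangent_eq by (intro subspace_Times subspace_tan_at)

lemma metric_eq:
  fixes p :: "('n, 'r) pt"
  shows "\<xi> \<in> tangent p \<Longrightarrow> \<zeta> \<in> tangent p \<Longrightarrow> metric p \<xi> \<zeta> = (\<xi> \<bullet> \<zeta>) / 2"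
  by (auto simp: metric_def tangent_eq embed_def gmetric_eq[OF le] inner_prod_def add_divide_distrib)

lemma tnorm_eq:
  fixes p :: "('n, 'r) pt"
  shows "\<xi> \<in> tangent p \<Longrightarrow> tnorm p \<xi> = norm \<xi> / sqrt 2"
  by (simp add: tnorm_def metric_eq real_sqrt_divide norm_eq_sqrt_inner)

lemma tproj2_in: "tproj2 (embed p) Z \<in> tangent p" for p :: "('n, 'r) pt"
  by (simp add: tproj2_def tangent_eq tproj_in orth_projector_embed)

lemma tproj2_id:
  fixes p :: "('n, 'r) pt"
  shows "\<xi> \<in> tangent p \<Longrightarrow> tproj2 (embed p) \<xi> = \<xi>"
  by (auto simp: tproj2_def tangent_eq tproj_id orth_projector_embed)

lemma inner_tproj2:
  fixes p :: "('n, 'r) pt"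
  shows "\<xi> \<in> tangent p \<Longrightarrow> \<xi> \<bullet> tproj2 (embed p) Z = \<xi> \<bullet> Z"
  by (auto simp: tproj2_def tangent_eq inner_tproj orth_projector_embed inner_prod_def)

lemma tproj2_dtproj2_eq_0:
  fixes p :: "('n, 'r) pt"
  shows "\<xi> \<in> tangent p \<Longrightarrow> \<zeta> \<in> tangent p \<Longrightarrow> tproj2 (embed p) (dtproj2 (embed p) \<xi> \<zeta>) = 0"
  by (auto simp: tproj2_def dtproj2_def tangent_eq tproj_dtproj_eq_0 orth_projector_embed zero_prod_def)

lemma D_range_of2_lift:
  fixes z :: "('n, 'r) frames"
  assumes "z \<in> frame_pairs" "\<xi> \<in> tangent (range_of2 z)"
  shows "D_range_of2 z (act \<xi> z) = \<xi>"
  using assms by (auto simp: D_range_of2_def act_def tangent_eq embed_range_of2 pr2_def D_range_of_lift)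

lemma range_of2_act:
  fixes z :: "('n, 'r) frames" and p :: "('n, 'r) pt"
  shows "z \<in> frame_pairs \<Longrightarrow> act (embed p) z \<in> frame_pairs \<Longrightarrow> range_of2 (act (embed p) z) = p"
  by (cases p) (auto simp: act_def embed_def range_of2_def range_of_projector_mult le)

lemma continuous_on_embed: "continuous_on UNIV (embed :: ('n, 'r) pt \<Rightarrow> 'n tvec)"
proof -
  have "continuous_on UNIV (orth_proj :: ('n, 'r) grassmann \<Rightarrow> _)"
    unfolding continuous_on_open_vimage[OF open_UNIV]
  proof (intro allI impI)
    fix B :: "(real ^ 'n ^ 'n) set" assume "open B"
    have "open (pr -` B \<inter> full_rank :: (real ^ 'r ^ 'n) set)"
      using continuous_open_preimage[OF C_dirs_imp_continuous_on[OF C_k_pr] open_full_rank \<open>open B\<close>]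
      by (simp add: Int_commute)
    moreover have "{\<Phi> \<in> full_rank. range_of \<Phi> \<in> orth_proj -` B \<inter> UNIV} = (pr -` B \<inter> full_rank :: (real ^ 'r ^ 'n) set)"
      by (auto simp: orth_proj_range_of)
    ultimately show "open (orth_proj -` B \<inter> UNIV :: ('n, 'r) grassmann set)"
      by (simp add: open_grassmann_def openin_open_eq open_full_rank)
  qed
  note c = continuous_on_compose2[OF this _ subset_UNIV]
  show ?thesis
    unfolding embed_def[abs_def]
    by (intro continuous_on_Pair c continuous_on_fst continuous_on_snd continuous_on_id)
qed

lemma open_lift_nbhd:
  fixes z :: "('n, 'r) frames"
  assumes "open S"
  shows "open {q :: ('n, 'r) pt. act (embed q) z \<in> S}"
proof -
  have "continuous_on UNIV (\<lambda>q :: ('n, 'r) pt. act (embed q) z)"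
    by (intro bounded_bilinear.continuous_on[OF bounded_bilinear_act] continuous_on_embed continuous_intros)
  then have "open ((\<lambda>q :: ('n, 'r) pt. act (embed q) z) -` S)"
    using assms by (rule open_vimage[rotated])
  then show ?thesis by (simp only: vimage_def)
qed

section \<open>Regularity and derivatives of functions on the manifold\<close>

lemma C_k_nearE:
  fixes z :: "('n, 'r) frames"
  assumes "C_k_near k (range_of2 z) F" "z \<in> frame_pairs"
  obtains S where "open S" "z \<in> S" "S \<subseteq> frame_pairs" "C_k k S (\<lambda>z. F (range_of2 z))"
proof -
  obtain U where U: "open U" "range_of2 z \<in> U" "C_k k {z \<in> frame_pairs. range_of2 z \<in> U} (\<lambda>z. F (range_of2 z))"
    using assms(1) unfolding C_k_near_def by blast
  show thesis
    by (rule that[OF open_preimage_range_of2[OF U(1)] _ _ U(3)]) (use U(2) assms(2) in auto)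
qed

text \<open>The definition asks for regularity on all frames over a neighbourhood, the assumption
  concerns only frames close to \<open>z\<close>. A frame \<open>w\<close> over a nearby point is
  exchanged for the projected frame \<open>act (pr2 w) z\<close>: it lies in \<open>S\<close>, has
  the same range, and depends smoothly on \<open>w\<close>.\<close>

lemma C_k_nearI:
  fixes z :: "('n, 'r) frames"
  assumes S: "open S" "z \<in> S" "S \<subseteq> frame_pairs" and F: "C_k k S (\<lambda>z. F (range_of2 z))"
  shows "C_k_near k (range_of2 z) F"
proof -
  define U where "U = {q :: ('n, 'r) pt. act (embed q) z \<in> S}"
  have z: "z \<in> frame_pairs" using S by blast
  have U: "open U" "range_of2 z \<in> U"
    unfolding U_def using open_lift_nbhd S z by (auto simp: embed_range_of2 act_pr2)
  let ?T = "{z \<in> frame_pairs. range_of2 z \<in> U}"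
  have T: "open ?T" using U(1) by (rule open_preimage_range_of2)
  have act: "act (pr2 w) z \<in> S" if "w \<in> ?T" for w
    using that by (auto simp: U_def embed_range_of2 simp del: mem_Times_iff)
  have "C_k k ?T (\<lambda>w. F (range_of2 (act (pr2 w) z)))"
  proof (rule C_dirs_compose[OF S(1) _ F])
    show "C_k k ?T (\<lambda>w. act (pr2 w) z)"
      by (rule C_dirs_bilinear[OF bounded_bilinear_act C_dirs_subset[OF C_k_pr2] C_dirs_const]) auto
  qed (use act in auto)
  then have "C_k k ?T (\<lambda>w. F (range_of2 w))"
  proof (rule C_dirs_cong[OF T, rotated])
    fix w assume w: "w \<in> ?T"
    then have "range_of2 (act (embed (range_of2 w)) z) = range_of2 w"
      using act[OF w] S(3) z by (intro range_of2_act) (auto simp: embed_range_of2)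
    then show "F (range_of2 (act (pr2 w) z)) = F (range_of2 w)"
      using w by (simp add: embed_range_of2)
  qed
  then show ?thesis unfolding C_k_near_def using U by blast
qed

lemma C_k_near_has_derivative:
  fixes z :: "('n, 'r) frames"
  assumes "C_k_near (Suc k) (range_of2 z) F" "z \<in> frame_pairs"
  shows "((\<lambda>z. F (range_of2 z)) has_derivative frechet_derivative (\<lambda>z. F (range_of2 z)) (at z)) (at z)"
proof -
  obtain S where "open S" "z \<in> S" "S \<subseteq> frame_pairs" "C_k (Suc k) S (\<lambda>z. F (range_of2 z))"
    using C_k_nearE[OF assms] by blast
  then show ?thesis using C_k_Suc_frechet_derivative(1) by blast
qed

text \<open>\<open>mderiv\<close> evaluates at some frame \<open>w\<close> and vector
  \<open>h\<close> that are not under control. Near \<open>w\<close> the function factors through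
  the projected frame \<open>act (pr2 x) z\<close>, which equals \<open>z\<close> at
  \<open>x = w\<close>, and the chain rule turns \<open>h\<close> into
  \<open>act \<xi> z\<close>.\<close>

lemma mderiv_eq:
  fixes z :: "('n, 'r) frames"
  assumes z: "z \<in> frame_pairs" and F: "((\<lambda>z. F (range_of2 z)) has_derivative F') (at z)"
    and \<xi>: "\<xi> \<in> tangent (range_of2 z)"
  shows "mderiv F (range_of2 z) \<xi> = F' (act \<xi> z)"
proof -
  let ?Q = "\<lambda>(w, h). w \<in> frame_pairs \<and> range_of2 w = range_of2 z \<and> D_range_of2 w h = \<xi>"
  have "?Q (z, act \<xi> z)" using z D_range_of2_lift[OF z \<xi>] by simp
  then have "?Q (SOME x. ?Q x)" by (rule someI)
  then obtain w h where wh: "(SOME x. ?Q x) = (w, h)" "w \<in> frame_pairs" "range_of2 w = range_of2 z" "D_range_of2 w h = \<xi>"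
    by (cases "SOME x. ?Q x") auto
  have w_act: "act (pr2 w) z = z"
    using wh z by (metis embed_range_of2 act_pr2)
  let ?T = "(frame_pairs :: ('n, 'r) frames set) \<inter> (\<lambda>x. act (pr2 x) z) -` frame_pairs"
  have "continuous_on frame_pairs (\<lambda>x :: ('n, 'r) frames. act (pr2 x) z)"
    by (intro bounded_bilinear.continuous_on[OF bounded_bilinear_act] C_dirs_imp_continuous_on[OF C_k_pr2] continuous_intros)
  then have "open ?T" by (rule continuous_open_preimage[OF _ open_frame_pairs open_frame_pairs])
  moreover have "w \<in> ?T" using w_act z wh(2) by simp
  ultimately have T: "open ?T" "w \<in> ?T" .
  have "((\<lambda>x. act (pr2 x) z) has_derivative (\<lambda>h. act (D_range_of2 w h) z)) (at w)"
    using bounded_linear.has_derivative[OF bounded_bilinear.bounded_linear_left[OF bounded_bilinear_act] has_derivative_pr2[OF wh(2)]] .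
  from has_derivative_compose[OF this, of "\<lambda>z. F (range_of2 z)" F'] F w_act
  have "((\<lambda>x. F (range_of2 (act (pr2 x) z))) has_derivative (\<lambda>h. F' (act (D_range_of2 w h) z))) (at w)"
    by simp
  then have "((\<lambda>x. F (range_of2 x)) has_derivative (\<lambda>h. F' (act (D_range_of2 w h) z))) (at w)"
  proof (rule has_derivative_transform_within_open[OF _ T])
    fix x assume x: "x \<in> ?T"
    then have "range_of2 (act (embed (range_of2 x)) z) = range_of2 x"
      using z by (intro range_of2_act) (auto simp: embed_range_of2)
    then show "F (range_of2 (act (pr2 x) z)) = F (range_of2 x)" using x by (simp add: embed_range_of2)
  qed
  then have "frechet_derivative (\<lambda>x. F (range_of2 x)) (at w) h = F' (act \<xi> z)"
    using frechet_derivative_at wh(4) by metis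
  then show ?thesis by (simp add: mderiv_def wh(1))
qed

lemma mderiv_frechet:
  fixes z :: "('n, 'r) frames"
  assumes "C_k_near (Suc k) (range_of2 z) F" "z \<in> frame_pairs" "\<xi> \<in> tangent (range_of2 z)"
  shows "mderiv F (range_of2 z) \<xi> = frechet_derivative (\<lambda>z. F (range_of2 z)) (at z) (act \<xi> z)"
  using mderiv_eq[OF assms(2) C_k_near_has_derivative[OF assms(1,2)] assms(3)] .

text \<open>No lift of the curve to frames is given. Projecting a frame \<open>z\<close> of
  \<open>\<gamma> t\<close> onto \<open>\<gamma> s\<close> supplies one for \<open>s\<close> near
  \<open>t\<close>, because full rank is an open condition; the chain rule then applies to
  matrices.\<close>

lemma mderiv_along_curve:
  fixes \<gamma> :: "real \<Rightarrow> ('n, 'r) pt"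
  assumes F: "C_k_near (Suc k) (\<gamma> t) F"
    and \<gamma>: "((\<lambda>s. embed (\<gamma> s)) has_vector_derivative P') (at t within I)" and t: "t \<in> I"
    and P': "P' \<in> tangent (\<gamma> t)"
  shows "((\<lambda>s. F (\<gamma> s)) has_vector_derivative mderiv F (\<gamma> t) P') (at t within I)"
proof -
  obtain z where z: "z \<in> frame_pairs" "range_of2 z = \<gamma> t" "act (embed (\<gamma> t)) z = z" by (rule frames_ex)
  have c: "((\<lambda>s. act (embed (\<gamma> s)) z) has_derivative (\<lambda>h. h *\<^sub>R act P' z)) (at t within I)"
    using bounded_linear.has_vector_derivative[OF bounded_bilinear.bounded_linear_left[OF bounded_bilinear_act] \<gamma>]
    by (simp add: has_vector_derivative_def)
  let ?F = "\<lambda>z. F (range_of2 z)"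
  have F': "(?F has_derivative frechet_derivative ?F (at z)) (at z)"
    using C_k_near_has_derivative[of k z F] F z by simp
  interpret bounded_linear "frechet_derivative ?F (at z)" using F' by (rule has_derivative_bounded_linear)
  have "(?F has_derivative frechet_derivative ?F (at z)) (at (act (embed (\<gamma> t)) z))"
    using F' z by simp
  from has_derivative_compose[OF c this]
  have "((\<lambda>s. ?F (act (embed (\<gamma> s)) z)) has_derivative (\<lambda>h. h *\<^sub>R frechet_derivative ?F (at z) (act P' z))) (at t within I)"
    by (simp add: scaleR)
  moreover have "frechet_derivative ?F (at z) (act P' z) = mderiv F (\<gamma> t) P'"
    using mderiv_frechet[of k z F P'] F z P' by simp
  ultimately have "((\<lambda>s. ?F (act (embed (\<gamma> s)) z)) has_derivative (\<lambda>h. h *\<^sub>R mderiv F (\<gamma> t) P')) (at t within I)"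
    by simp
  moreover have "\<forall>\<^sub>F s in at t within I. ?F (act (embed (\<gamma> s)) z) = F (\<gamma> s)"
  proof -
    have "((\<lambda>s. act (embed (\<gamma> s)) z) \<longlongrightarrow> z) (at t within I)"
      using has_derivative_continuous[OF c] z(3) by (simp add: continuous_within)
    then have "\<forall>\<^sub>F s in at t within I. act (embed (\<gamma> s)) z \<in> frame_pairs"
      by (rule topological_tendstoD[OF _ open_frame_pairs z(1)])
    then show ?thesis by eventually_elim (simp add: range_of2_act z(1))
  qed
  moreover have "?F (act (embed (\<gamma> t)) z) = F (\<gamma> t)" using z by simp
  ultimately show ?thesis
    unfolding has_vector_derivative_def by (rule has_derivative_transform_eventually) (rule t)
qed

lemma C_k_near_comp:
  fixes p :: "('n, 'r) pt"
  assumes "C_k_near k p F" "C_k_near k p G"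
    and H: "\<And>S. open S \<Longrightarrow> C_k k S (\<lambda>z. F (range_of2 z)) \<Longrightarrow> C_k k S (\<lambda>z. G (range_of2 z)) \<Longrightarrow> C_k k S (\<lambda>z. H (range_of2 z))"
  shows "C_k_near k p H"
proof -
  obtain z where z: "z \<in> frame_pairs" "range_of2 z = p" by (rule frames_ex)
  obtain S where S: "open S" "z \<in> S" "S \<subseteq> frame_pairs" "C_k k S (\<lambda>z. F (range_of2 z))"
    using C_k_nearE[of k z F] assms(1) z by blast
  obtain T where T: "open T" "z \<in> T" "T \<subseteq> frame_pairs" "C_k k T (\<lambda>z. G (range_of2 z))"
    using C_k_nearE[of k z G] assms(2) z by blast
  have "C_k k (S \<inter> T) (\<lambda>z. H (range_of2 z))"
    using S T by (intro H C_dirs_subset[OF S(4)] C_dirs_subset[OF T(4)]) auto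
  then have "C_k_near k (range_of2 z) H"
    using S T by (intro C_k_nearI[of "S \<inter> T"]) auto
  then show ?thesis using z by simp
qed

lemma C_k_near_const: "C_k_near k p (\<lambda>q :: ('n, 'r) pt. c)"
  unfolding C_k_near_def by (intro exI[of _ UNIV] conjI open_UNIV UNIV_I C_dirs_const)

lemma C_k_near_embed: "C_k_near k p (embed :: ('n, 'r) pt \<Rightarrow> _)"
proof -
  obtain z where z: "z \<in> frame_pairs" "range_of2 z = p" by (rule frames_ex)
  have "C_k k frame_pairs (\<lambda>z :: ('n, 'r) frames. embed (range_of2 z))"
    by (rule C_dirs_cong[OF open_frame_pairs _ C_k_pr2]) (simp add: embed_range_of2)
  then show ?thesis using C_k_nearI[OF open_frame_pairs z(1)] z(2) by simp
qed

lemma C_k_near_scaleR: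
  fixes p :: "('n, 'r) pt"
  shows "C_k_near k p \<phi> \<Longrightarrow> C_k_near k p Y \<Longrightarrow> C_k_near k p (\<lambda>q. \<phi> q *\<^sub>R Y q)"
  by (erule C_k_near_comp, assumption) (rule C_dirs_scaleR)

lemma C_k_near_inner:
  fixes p :: "('n, 'r) pt" and Y Z :: "('n, 'r) pt \<Rightarrow> 'b::real_inner"
  shows "C_k_near k p Y \<Longrightarrow> C_k_near k p Z \<Longrightarrow> C_k_near k p (\<lambda>q. Y q \<bullet> Z q)"
  by (erule C_k_near_comp, assumption) (rule C_dirs_bilinear[OF bounded_bilinear_inner])

lemma C_k_near_add:
  fixes p :: "('n, 'r) pt"
  shows "C_k_near k p Y \<Longrightarrow> C_k_near k p Z \<Longrightarrow> C_k_near k p (\<lambda>q. Y q + Z q)"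
  by (erule C_k_near_comp, assumption) (rule C_dirs_add)

lemma C_k_near_tproj2:
  fixes p :: "('n, 'r) pt"
  shows "C_k_near k p Y \<Longrightarrow> C_k_near k p (\<lambda>q. tproj2 (embed q) (Y q))"
  by (rule C_k_near_comp[OF C_k_near_embed], assumption) (rule C_dirs_tproj2)

lemma C_k_near_transform:
  fixes p :: "('n, 'r) pt"
  assumes "C_k_near k p F" "open U" "p \<in> U" "\<And>q. q \<in> U \<Longrightarrow> F q = G q"
  shows "C_k_near k p G"
proof -
  obtain V where V: "open V" "p \<in> V" "C_k k {z \<in> frame_pairs. range_of2 z \<in> V} (\<lambda>z. F (range_of2 z))"
    using assms(1) unfolding C_k_near_def by blast
  have "C_k k {z \<in> frame_pairs. range_of2 z \<in> V \<inter> U} (\<lambda>z. G (range_of2 z))"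
    by (rule C_dirs_cong[OF open_preimage_range_of2 _ C_dirs_subset[OF V(3)]])
      (use V(1) assms(2,4) in auto)
  then show ?thesis unfolding C_k_near_def using V assms(2,3) by (intro exI[of _ "V \<inter> U"]) auto
qed

section \<open>Vector fields of class C1 and derivatives of particular functions\<close>

lemma C1_field_nearD: "C1_field_near p Y \<Longrightarrow> C_k_near (Suc 0) p Y" "C1_field_near p Y \<Longrightarrow> Y p \<in> tangent p"
  for p :: "('n, 'r) pt"
  by (auto simp: C1_field_near_def)

lemma C1_field_nearI:
  fixes p :: "('n, 'r) pt"
  shows "C_k_near (Suc 0) p Y \<Longrightarrow> (\<And>q. Y q \<in> tangent q) \<Longrightarrow> C1_field_near p Y"
  by (auto simp: C1_field_near_def)

lemma C1_field_near_add:
  fixes p :: "('n, 'r) pt"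
  assumes Y: "C1_field_near p Y" and Z: "C1_field_near p Z"
  shows "C1_field_near p (\<lambda>q. Y q + Z q)"
proof -
  obtain U V where "open U" "p \<in> U" "\<forall>q\<in>U. Y q \<in> tangent q" "open V" "p \<in> V" "\<forall>q\<in>V. Z q \<in> tangent q"
    using Y Z unfolding C1_field_near_def by blast
  then have "\<exists>U. open U \<and> p \<in> U \<and> (\<forall>q\<in>U. Y q + Z q \<in> tangent q)"
    by (intro exI[of _ "U \<inter> V"]) (auto intro: subspace_add[OF subspace_tangent])
  moreover have "C_k_near 1 p (\<lambda>q. Y q + Z q)"
    using Y Z by (intro C_k_near_add) (simp_all add: C1_field_near_def)
  ultimately show ?thesis unfolding C1_field_near_def by blast
qed

lemma C1_field_near_scaleR:
  fixes p :: "('n, 'r) pt"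
  assumes Y: "C1_field_near p Y" and \<phi>: "C_k_near 1 p \<phi>"
  shows "C1_field_near p (\<lambda>q. \<phi> q *\<^sub>R Y q)"
proof -
  obtain U where "open U" "p \<in> U" "\<forall>q\<in>U. Y q \<in> tangent q"
    using Y unfolding C1_field_near_def by blast
  then have "\<exists>U. open U \<and> p \<in> U \<and> (\<forall>q\<in>U. \<phi> q *\<^sub>R Y q \<in> tangent q)"
    by (intro exI[of _ U]) (auto intro: subspace_scale[OF subspace_tangent])
  moreover have "C_k_near 1 p (\<lambda>q. \<phi> q *\<^sub>R Y q)"
    using Y \<phi> by (intro C_k_near_scaleR) (simp_all add: C1_field_near_def)
  ultimately show ?thesis unfolding C1_field_near_def by blast
qed

lemma C1_field_near_sum:
  fixes p :: "('n, 'r) pt"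
  shows "finite A \<Longrightarrow> (\<And>i. i \<in> A \<Longrightarrow> C1_field_near p (Y i)) \<Longrightarrow> C1_field_near p (\<lambda>q. \<Sum>i\<in>A. Y i q)"
proof (induction A rule: finite_induct)
  case empty
  then show ?case by (auto intro!: C1_field_nearI C_k_near_const subspace_0[OF subspace_tangent])
next
  case (insert x F)
  then show ?case by (auto intro!: C1_field_near_add)
qed

text \<open>Constant matrices made tangent by projection. With \<open>w\<close> ranging over the
  matrix basis these fields span every tangent space, so any tangent field is a combination of them
  with its own matrix entries as coefficients.\<close>

definition proj_field :: "'n tvec \<Rightarrow> ('n, 'r) pt \<Rightarrow> 'n tvec" where
  "proj_field w q = tproj2 (embed q) w"

lemma C_k_near_proj_field: "C_k_near k p (proj_field w)"
  unfolding proj_field_def[abs_def] by (intro C_k_near_tproj2 C_k_near_const)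

lemma C1_field_proj_field: "C1_field_near p (proj_field w)"
  by (intro C1_field_nearI C_k_near_proj_field) (simp add: proj_field_def tproj2_in)

lemma mderiv_embed:
  fixes p :: "('n, 'r) pt"
  assumes "\<xi> \<in> tangent p"
  shows "mderiv embed p \<xi> = \<xi>"
proof -
  obtain z where z: "z \<in> frame_pairs" "range_of2 z = p" by (rule frames_ex)
  have "((\<lambda>z. embed (range_of2 z)) has_derivative D_range_of2 z) (at z)"
    by (rule has_derivative_transform_within_open[OF has_derivative_pr2 open_frame_pairs])
      (use z in \<open>auto simp: embed_range_of2\<close>)
  then show ?thesis
    using mderiv_eq[OF z(1), of embed] D_range_of2_lift[OF z(1)] z(2) assms by simp
qed

lemma mderiv_comp_embed:
  fixes p :: "('n, 'r) pt"
  assumes \<xi>: "\<xi> \<in> tangent p" and F: "(F has_derivative F') (at (embed p))"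
  shows "mderiv (\<lambda>q. F (embed q)) p \<xi> = F' \<xi>"
proof -
  obtain z where z: "z \<in> frame_pairs" "range_of2 z = p" by (rule frames_ex)
  have emb: "((\<lambda>z. embed (range_of2 z)) has_derivative D_range_of2 z) (at z)"
    by (rule has_derivative_transform_within_open[OF has_derivative_pr2 open_frame_pairs])
      (use z in \<open>auto simp: embed_range_of2\<close>)
  from has_derivative_compose[OF emb, of F F'] F z(2)
  have "((\<lambda>z. F (embed (range_of2 z))) has_derivative (\<lambda>h. F' (D_range_of2 z h))) (at z)" by simp
  then show ?thesis
    using mderiv_eq[OF z(1), of "\<lambda>q. F (embed q)"] D_range_of2_lift[OF z(1)] z(2) \<xi> by simp
qed

lemma mderiv_linear_comp:
  fixes p :: "('n, 'r) pt"
  assumes A: "bounded_linear A" and Y: "C_k_near (Suc k) p Y" and \<xi>: "\<xi> \<in> tangent p"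
  shows "mderiv (\<lambda>q. A (Y q)) p \<xi> = A (mderiv Y p \<xi>)"
proof -
  obtain z where z: "z \<in> frame_pairs" "range_of2 z = p" by (rule frames_ex)
  have Y': "((\<lambda>z. Y (range_of2 z)) has_derivative frechet_derivative (\<lambda>z. Y (range_of2 z)) (at z)) (at z)"
    using C_k_near_has_derivative[of k z Y] Y z by simp
  from bounded_linear.has_derivative[OF A this] mderiv_eq[OF z(1), of "\<lambda>q. A (Y q)"]
    mderiv_eq[OF z(1) Y'] \<xi> z(2)
  show ?thesis by auto
qed

lemma mderiv_const: "\<xi> \<in> tangent p \<Longrightarrow> mderiv (\<lambda>q :: ('n, 'r) pt. c) p \<xi> = 0"
proof -
  assume \<xi>: "\<xi> \<in> tangent p"
  obtain z where z: "z \<in> frame_pairs" "range_of2 z = p" by (rule frames_ex)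
  then show "mderiv (\<lambda>q. c) p \<xi> = 0"
    using mderiv_eq[OF z(1), of "\<lambda>q. c" "\<lambda>h. 0"] \<xi> by auto
qed

lemma mderiv_proj_field:
  assumes "\<zeta> \<in> tangent p"
  shows "mderiv (proj_field w) p \<zeta> = dtproj2 (embed p) w \<zeta>"
  unfolding proj_field_def[abs_def] using mderiv_comp_embed[OF assms has_derivative_tproj2] .

end

section \<open>The Riemannian connection\<close>

locale grassmann_connection = grassmannian dims for dims :: "('n::finite \<times> 'r::finite) itself" +
  fixes nabla :: "('n, 'r) conn"
  assumes conn: "riemannian_connection nabla"
begin

lemma nabla_tangent: "\<xi> \<in> tangent p \<Longrightarrow> C1_field_near p Y \<Longrightarrow> nabla p \<xi> Y \<in> tangent p"
  and nabla_add: "\<xi> \<in> tangent p \<Longrightarrow> C1_field_near p Y \<Longrightarrow> C1_field_near p Z \<Longrightarrow>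
    nabla p \<xi> (\<lambda>q. Y q + Z q) = nabla p \<xi> Y + nabla p \<xi> Z"
  and nabla_leibniz: "\<xi> \<in> tangent p \<Longrightarrow> C_k_near 1 p \<phi> \<Longrightarrow> C1_field_near p Y \<Longrightarrow>
    nabla p \<xi> (\<lambda>q. \<phi> q *\<^sub>R Y q) = mderiv \<phi> p \<xi> *\<^sub>R Y p + \<phi> p *\<^sub>R nabla p \<xi> Y"
  and nabla_torsion: "C1_field_near p X \<Longrightarrow> C1_field_near p Y \<Longrightarrow> C_k_near 2 p \<psi> \<Longrightarrow>
    mderiv \<psi> p (nabla p (X p) Y - nabla p (Y p) X) =
      mderiv (\<lambda>q. mderiv \<psi> q (Y q)) p (X p) - mderiv (\<lambda>q. mderiv \<psi> q (X q)) p (Y p)"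
  and nabla_metric: "\<xi> \<in> tangent p \<Longrightarrow> C1_field_near p Y \<Longrightarrow> C1_field_near p Z \<Longrightarrow>
    mderiv (\<lambda>q. metric q (Y q) (Z q)) p \<xi> = metric p (nabla p \<xi> Y) (Z p) + metric p (Y p) (nabla p \<xi> Z)"
  for \<psi> :: "_ \<Rightarrow> real"
  using conn unfolding riemannian_connection_def by blast+

lemma nabla_sum:
  assumes \<xi>: "\<xi> \<in> tangent p"
  shows "finite A \<Longrightarrow> (\<And>i. i \<in> A \<Longrightarrow> C1_field_near p (Y i)) \<Longrightarrow>
    nabla p \<xi> (\<lambda>q. \<Sum>i\<in>A. Y i q) = (\<Sum>i\<in>A. nabla p \<xi> (Y i))"
proof (induction A rule: finite_induct)
  case empty
  have "C1_field_near p (\<lambda>q. 0)" using C1_field_near_sum[of "{}" p] by simp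
  from nabla_add[OF \<xi> this this] show ?case by simp
next
  case (insert x F)
  then show ?case using nabla_add[OF \<xi>, of "Y x" "\<lambda>q. \<Sum>i\<in>F. Y i q"] by (simp add: C1_field_near_sum)
qed

text \<open>Locality: a field vanishing near \<open>p\<close> is multiplied by an indicator function that
  vanishes near \<open>p\<close>, which is smooth near \<open>p\<close>.\<close>

lemma nabla_local:
  assumes \<xi>: "\<xi> \<in> tangent p" and Y: "C1_field_near p Y" and Z: "C1_field_near p Z"
    and U: "open U" "p \<in> U" "\<And>q. q \<in> U \<Longrightarrow> Y q = Z q"
  shows "nabla p \<xi> Y = nabla p \<xi> Z"
proof -
  define X where "X q = Y q - Z q" for q
  have X: "C1_field_near p X"
    using C1_field_near_add[OF Y C1_field_near_scaleR[OF Z C_k_near_const[of _ _ "-1"]]] by (simp add: X_def[abs_def])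
  define \<phi> where "\<phi> q = (if q \<in> U then 0 else 1 :: real)" for q
  have \<phi>: "C_k_near 1 p \<phi>"
    by (rule C_k_near_transform[where F = "\<lambda>q. 0", OF C_k_near_const U(1,2)]) (simp add: \<phi>_def)
  have "(\<lambda>q. \<phi> q *\<^sub>R X q) = X" using U(3) by (auto simp: \<phi>_def X_def)
  then have "nabla p \<xi> X = 0"
    using nabla_leibniz[OF \<xi> \<phi> X] U by (simp add: \<phi>_def X_def)
  moreover have "Y = (\<lambda>q. Z q + X q)" by (simp add: X_def)
  ultimately show ?thesis using nabla_add[OF \<xi> Z X] by simp
qed

text \<open>At \<open>p\<close>, the fields \<open>proj_field w\<close> with \<open>w\<close> tangent have normal ordinary derivatives. Thus
  all terms of the Koszul formula vanish.\<close>

lemma nabla_proj_field: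
  assumes "\<xi> \<in> tangent p" "w \<in> tangent p"
  shows "nabla p \<xi> (proj_field w) = 0"
proof -
  define c where "c a b d = nabla p a (proj_field b) \<bullet> d" for a b d
  have at_p: "proj_field b p = b" if "b \<in> tangent p" for b
    using that by (simp add: proj_field_def tproj2_id)
  have normal: "dtproj2 (embed p) a b \<bullet> d = 0" "d \<bullet> dtproj2 (embed p) a b = 0"
    if "a \<in> tangent p" "b \<in> tangent p" "d \<in> tangent p" for a b d
    using inner_tproj2[OF that(3), of "dtproj2 (embed p) a b"] that
    by (simp_all add: tproj2_dtproj2_eq_0 inner_commute)
  \<comment> \<open>Vanishing torsion, tested on the linear function \<open>\<psi>\<close>: both
    iterated derivatives are derivatives of projected fields paired with the tangent vector
    \<open>d\<close>, so they vanish at \<open>p\<close>.\<close>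
  have sym: "c a b d = c b a d" if "a \<in> tangent p" "b \<in> tangent p" "d \<in> tangent p" for a b d
  proof -
    define \<psi> where "\<psi> q = embed q \<bullet> d" for q :: "('n, 'r) pt"
    have D\<psi>: "mderiv \<psi> q v = v \<bullet> d" if "v \<in> tangent q" for q v
      unfolding \<psi>_def
      using mderiv_linear_comp[OF bounded_linear_inner_left C_k_near_embed that] mderiv_embed[OF that] by simp
    have "C_k_near 2 p \<psi>"
      unfolding \<psi>_def[abs_def] by (intro C_k_near_inner C_k_near_embed C_k_near_const)
    from nabla_torsion[OF C1_field_proj_field C1_field_proj_field this, of a b]
    have "mderiv \<psi> p (nabla p a (proj_field b) - nabla p b (proj_field a)) =
        mderiv (\<lambda>q. mderiv \<psi> q (proj_field b q)) p a - mderiv (\<lambda>q. mderiv \<psi> q (proj_field a q)) p b"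
      using that by (simp add: at_p)
    moreover have "(\<lambda>q. mderiv \<psi> q (proj_field x q)) = (\<lambda>q. proj_field x q \<bullet> d)" for x
      by (simp add: D\<psi> proj_field_def tproj2_in)
    moreover have "mderiv (\<lambda>q. proj_field x q \<bullet> d) p v = 0" if "x \<in> tangent p" "v \<in> tangent p" for x v
      using mderiv_linear_comp[OF bounded_linear_inner_left C_k_near_proj_field that(2)]
        mderiv_proj_field[OF that(2)] normal that \<open>d \<in> tangent p\<close> by simp
    ultimately have "mderiv \<psi> p (nabla p a (proj_field b) - nabla p b (proj_field a)) = 0"
      using that by simp
    moreover have "nabla p a (proj_field b) - nabla p b (proj_field a) \<in> tangent p"
      using that by (intro subspace_diff[OF subspace_tangent] nabla_tangent C1_field_proj_field)
    ultimately show ?thesis using D\<psi> by (simp add: c_def inner_diff_left)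
  qed
  \<comment> \<open>Compatibility with the metric: the inner product of two such fields has
    derivative 0 at \<open>p\<close>.\<close>
  have anti: "c a b d = - c a d b" if "a \<in> tangent p" "b \<in> tangent p" "d \<in> tangent p" for a b d
  proof -
    have m: "metric q (proj_field b q) (proj_field d q) = (tproj2 (embed q) b \<bullet> tproj2 (embed q) d) / 2" for q
      by (simp add: metric_eq proj_field_def tproj2_in)
    have "((\<lambda>P. (tproj2 P b \<bullet> tproj2 P d) / 2) has_derivative
      (\<lambda>h. (tproj2 (embed p) b \<bullet> dtproj2 (embed p) d h + dtproj2 (embed p) b h \<bullet> tproj2 (embed p) d) / 2)) (at (embed p))"
      by (intro derivative_eq_intros has_derivative_tproj2 refl) (auto simp: fun_eq_iff intro: has_derivative_tproj2)
    from mderiv_comp_embed[OF that(1) this]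
    have "mderiv (\<lambda>q. metric q (proj_field b q) (proj_field d q)) p a = 0"
      using that by (simp add: m tproj2_id normal)
    moreover have "mderiv (\<lambda>q. metric q (proj_field b q) (proj_field d q)) p a
      = metric p (nabla p a (proj_field b)) d + metric p b (nabla p a (proj_field d))"
      using nabla_metric[OF that(1) C1_field_proj_field C1_field_proj_field] that by (simp add: at_p)
    ultimately show ?thesis
      using that by (simp add: metric_eq nabla_tangent C1_field_proj_field c_def inner_commute)
  qed
  \<comment> \<open>A trilinear expression symmetric in its first two and antisymmetric in its last
    two arguments vanishes; permuting the arguments six times returns it with the opposite
    sign.\<close>
  have zero: "c a b d = 0" if "a \<in> tangent p" "b \<in> tangent p" "d \<in> tangent p" for a b d
    using sym[OF that] anti[OF that] sym[of a d b] anti[of d a b] sym[of d b a] anti[of b d a] that by linarith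
  have "nabla p \<xi> (proj_field w) \<in> tangent p"
    using assms by (intro nabla_tangent C1_field_proj_field)
  then show ?thesis using zero[OF assms, of "nabla p \<xi> (proj_field w)"] by (simp add: c_def)
qed

lemma proj_field_expand: "proj_field w q = (\<Sum>b\<in>Basis. (w \<bullet> b) *\<^sub>R proj_field b q)"
proof -
  interpret tq: bounded_linear "tproj2 (embed q)" by (rule bounded_linear_tproj2)
  have "proj_field w q = tproj2 (embed q) (\<Sum>b\<in>Basis. (w \<bullet> b) *\<^sub>R b)"
    by (simp add: proj_field_def euclidean_representation)
  then show ?thesis by (simp add: tq.sum tq.scaleR proj_field_def)
qed

text \<open>A basis matrix \<open>b\<close> need not be tangent at \<open>p\<close>, so the single
  terms need not vanish. Only their combination with the coefficients of a tangent \<open>w\<close>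
  is the derivative of \<open>proj_field w\<close>.\<close>

lemma sum_nabla_proj_field:
  assumes \<xi>: "\<xi> \<in> tangent p" and w: "w \<in> tangent p"
  shows "(\<Sum>b\<in>Basis. (w \<bullet> b) *\<^sub>R nabla p \<xi> (proj_field b)) = 0"
proof -
  have "(\<Sum>b\<in>Basis. (w \<bullet> b) *\<^sub>R nabla p \<xi> (proj_field b))
      = (\<Sum>b\<in>Basis. nabla p \<xi> (\<lambda>q. (w \<bullet> b) *\<^sub>R proj_field b q))"
    by (simp add: nabla_leibniz[OF \<xi> C_k_near_const C1_field_proj_field] mderiv_const[OF \<xi>])
  also have "\<dots> = nabla p \<xi> (\<lambda>q. \<Sum>b\<in>Basis. (w \<bullet> b) *\<^sub>R proj_field b q)"
    by (intro nabla_sum[OF \<xi>, symmetric] C1_field_near_scaleR C1_field_proj_field C_k_near_const) auto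
  also have "\<dots> = nabla p \<xi> (proj_field w)" by (simp flip: proj_field_expand)
  finally show ?thesis using nabla_proj_field[OF \<xi> w] by simp
qed

text \<open>Expand \<open>Y\<close> in the projected basis fields with its entries as coefficients.
  By the Leibniz rule the derivatives of the coefficients assemble to the projected ordinary
  derivative, and the derivatives of the fields cancel, because \<open>Y p\<close> is
  tangent.\<close>

theorem nabla_eq:
  assumes \<xi>: "\<xi> \<in> tangent p" and Y: "C1_field_near p Y"
  shows "nabla p \<xi> Y = tproj2 (embed p) (mderiv Y p \<xi>)"
proof -
  interpret tp: bounded_linear "tproj2 (embed p)" by (rule bounded_linear_tproj2)
  have comp: "C_k_near 1 p (\<lambda>q. Y q \<bullet> b)" for b
    using C_k_near_inner[OF C1_field_nearD(1)[OF Y] C_k_near_const] by simp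
  obtain U where U: "open U" "p \<in> U" "\<And>q. q \<in> U \<Longrightarrow> Y q \<in> tangent q"
    using Y unfolding C1_field_near_def by blast
  have "nabla p \<xi> Y = nabla p \<xi> (\<lambda>q. \<Sum>b\<in>Basis. (Y q \<bullet> b) *\<^sub>R proj_field b q)"
  \<comment> \<open>\<open>Y\<close> is tangent only near \<open>p\<close>, so it agrees with the
    expansion only there.\<close>
  proof (rule nabla_local[OF \<xi> Y _ U(1,2)])
    show "C1_field_near p (\<lambda>q. \<Sum>b\<in>Basis. (Y q \<bullet> b) *\<^sub>R proj_field b q)"
      by (intro C1_field_near_sum C1_field_near_scaleR C1_field_proj_field comp) auto
    show "Y q = (\<Sum>b\<in>Basis. (Y q \<bullet> b) *\<^sub>R proj_field b q)" if "q \<in> U" for q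
      using U(3)[OF that] by (simp flip: proj_field_expand) (simp add: proj_field_def tproj2_id)
  qed
  also have "\<dots> = (\<Sum>b\<in>Basis. nabla p \<xi> (\<lambda>q. (Y q \<bullet> b) *\<^sub>R proj_field b q))"
    by (intro nabla_sum[OF \<xi>] C1_field_near_scaleR C1_field_proj_field comp) auto
  also have "\<dots> = (\<Sum>b\<in>Basis. (mderiv Y p \<xi> \<bullet> b) *\<^sub>R proj_field b p + (Y p \<bullet> b) *\<^sub>R nabla p \<xi> (proj_field b))"
    by (simp add: nabla_leibniz[OF \<xi> comp C1_field_proj_field]
        mderiv_linear_comp[OF bounded_linear_inner_left C1_field_nearD(1)[OF Y] \<xi>])
  also have "\<dots> = proj_field (mderiv Y p \<xi>) p + (\<Sum>b\<in>Basis. (Y p \<bullet> b) *\<^sub>R nabla p \<xi> (proj_field b))"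
    by (simp add: sum.distrib flip: proj_field_expand)
  also have "(\<Sum>b\<in>Basis. (Y p \<bullet> b) *\<^sub>R nabla p \<xi> (proj_field b)) = 0"
    using sum_nabla_proj_field[OF \<xi> C1_field_nearD(2)[OF Y]] .
  finally show ?thesis by (simp add: proj_field_def)
qed

end

section \<open>One-parameter groups of rotations\<close>

definition brk :: "('n::finite) tvec \<Rightarrow> 'n tvec \<Rightarrow> 'n tvec" where
  "brk A B = act A B - act B A"

definition id2 :: "('n::finite) tvec" where
  "id2 = (mat 1, mat 1)"

definition skew2 :: "('n::finite) tvec \<Rightarrow> bool" where
  "skew2 A \<longleftrightarrow> transpose (fst A) = - fst A \<and> transpose (snd A) = - snd A"

lemma act_id2: "act id2 z = z"
  by (simp add: act_def id2_def)

lemma act_act: "act A (act B z) = act (act A B) z"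
  by (simp add: act_def matrix_mul_assoc)

lemma bounded_bilinear_brk: "bounded_bilinear brk"
proof -
  have "bilinear brk"
    unfolding bilinear_def linear_iff by (simp add: brk_def act_def matmul_simps algebra_simps)
  then show ?thesis by (simp add: bilinear_conv_bounded_bilinear)
qed

lemma at_within_Icc_neq_bot: "a < b \<Longrightarrow> t \<in> {a..b} \<Longrightarrow> at t within {a..b::real} \<noteq> bot"
  by (simp add: trivial_limit_within islimpt_Icc)

lemma zero_derivative_const:
  fixes f :: "real \<Rightarrow> 'a::real_normed_vector"
  assumes "\<And>t. t \<in> {a..b} \<Longrightarrow> (f has_vector_derivative 0) (at t within {a..b})" "t \<in> {a..b}"
  shows "f t = f a"
proof (rule has_derivative_zero_unique[of "{a..b}"])
  show "(f has_derivative (\<lambda>h. 0)) (at t within {a..b})" if "t \<in> {a..b}" for t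
    using assms(1)[OF that] by (simp add: has_vector_derivative_def)
qed (use assms(2) in auto)

lemma linear_ode_zero:
  fixes u :: "real \<Rightarrow> 'a::euclidean_space"
  assumes A: "bounded_linear A"
    and u: "\<And>t. t \<in> {a..b} \<Longrightarrow> (u has_vector_derivative A (u t)) (at t within {a..b})"
    and "u a = 0" "t \<in> {a..b}"
  shows "u t = 0"
proof -
  obtain K where K: "K > 0" "\<And>x. norm (A x) \<le> norm x * K"
    using bounded_linear.pos_bounded[OF A] by blast
  have "norm (u t) \<le> gronwall_const K (b - a) * (norm (u a) + 0)"
    using K assms(4) by (intro gronwall[where u' = "\<lambda>t. A (u t)"] u) (auto simp: mult.commute)
  then show ?thesis using assms(3) by simp
qed

lemma linear_ode_unique:
  fixes u v :: "real \<Rightarrow> 'a::euclidean_space"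
  assumes A: "bounded_linear A"
    and u: "\<And>t. t \<in> {a..b} \<Longrightarrow> (u has_vector_derivative A (u t)) (at t within {a..b})"
    and v: "\<And>t. t \<in> {a..b} \<Longrightarrow> (v has_vector_derivative A (v t)) (at t within {a..b})"
    and "u a = v a" "t \<in> {a..b}"
  shows "u t = v t"
proof -
  interpret bounded_linear A by (rule A)
  have "u t - v t = 0"
    by (rule linear_ode_zero[OF A, of a b "\<lambda>t. u t - v t"])
      (use assms has_vector_derivative_diff[OF u v] in \<open>auto simp: diff\<close>)
  then show ?thesis by simp
qed

abbreviation rot_rhs :: "('n::finite) tvec \<Rightarrow> 'n tvec \<times> real \<Rightarrow> 'n tvec" where
  "rot_rhs \<Omega> \<equiv> (\<lambda>(X, t). act \<Omega> X)"

text \<open>The matrix exponential, applied to both components.\<close>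

definition rot :: "('n::finite) tvec \<Rightarrow> 'n tvec" where
  "rot \<Omega> = (SOME X. solves_ivp (rot_rhs \<Omega>) 0 1 id2 X) 1"

lemma rot_rhs_solution:
  fixes \<Omega> :: "('n::finite) tvec"
  assumes "0 \<le> T"
  shows "\<exists>X. solves_ivp (rot_rhs \<Omega>) 0 T id2 X"
proof -
  interpret bounded_linear "act \<Omega> :: 'n tvec \<Rightarrow> 'n tvec"
    by (rule bounded_bilinear.bounded_linear_right[OF bounded_bilinear_act])
  obtain K where K: "\<And>x :: 'n tvec. norm (act \<Omega> x) \<le> norm x * K" using bounded by blast
  show ?thesis
  proof (rule picard[OF assms, where M = K])
    show "continuous_on (UNIV \<times> {0..T}) (rot_rhs \<Omega>)"
      unfolding case_prod_unfold by (intro continuous_on continuous_intros)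
    show "norm (rot_rhs \<Omega> (y, t) - rot_rhs \<Omega> (z, t)) \<le> K * norm (y - z)" for t :: real and y z
      using K[of "y - z"] by (simp add: diff mult.commute)
  qed
qed

lemma rot_rhs_unique:
  assumes "solves_ivp (rot_rhs \<Omega>) 0 T id2 X" "solves_ivp (rot_rhs \<Omega>) 0 T id2 Y" "t \<in> {0..T}"
  shows "X t = Y t"
  by (rule linear_ode_unique[OF bounded_bilinear.bounded_linear_right[OF bounded_bilinear_act], of 0 T])
    (use assms in \<open>auto simp: solves_ivp_def\<close>)

lemma rot_eq: "solves_ivp (rot_rhs \<Omega>) 0 1 id2 X \<Longrightarrow> rot \<Omega> = X 1"
  unfolding rot_def by (rule rot_rhs_unique[OF someI[of "solves_ivp (rot_rhs \<Omega>) 0 1 id2"]]) auto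

text \<open>The reparametrized curve \<open>X (s * t)\<close> solves the equation for
  \<open>s *\<^sub>R \<Omega>\<close>. Thus \<open>rot\<close>, defined by the value at time 1,
  describes the solution at all times of any interval starting at 0.\<close>

lemma rot_scale:
  assumes X: "solves_ivp (rot_rhs \<Omega>) 0 T id2 X" and s: "s \<in> {0..T}"
  shows "rot (s *\<^sub>R \<Omega>) = X s"
proof -
  have "solves_ivp (rot_rhs (s *\<^sub>R \<Omega>)) 0 1 id2 (\<lambda>t. X (s * t))"
    unfolding solves_ivp_def
  proof (intro conjI ballI)
    show "X (s * 0) = id2" using solves_ivpD(1)[OF X] by simp
    fix t :: real assume t: "t \<in> {0..1}"
    have sub: "(\<lambda>t. s * t) ` {0..1} \<subseteq> {0..T}"
      using s by (auto intro: mult_left_le[THEN order_trans])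
    have "((\<lambda>t. s * t) has_vector_derivative s) (at t within {0..1})"
      by (auto intro!: derivative_eq_intros)
    moreover have "(X has_vector_derivative act \<Omega> (X (s * t))) (at (s * t) within (\<lambda>t. s * t) ` {0..1})"
      using has_vector_derivative_within_subset[OF solves_ivpD(2)[OF X, of "s * t"] sub] image_subset_iff[THEN iffD1, OF sub] t
      by auto
    ultimately have "(X \<circ> (\<lambda>t. s * t) has_vector_derivative s *\<^sub>R act \<Omega> (X (s * t))) (at t within {0..1})"
      by (rule vector_diff_chain_within)
    then show "((\<lambda>t. X (s * t)) has_vector_derivative rot_rhs (s *\<^sub>R \<Omega>) (X (s * t), t)) (at t within {0..1})"
      by (simp add: o_def bounded_bilinear.scaleR_left[OF bounded_bilinear_act])
  qed
  from rot_eq[OF this] show ?thesis by simp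
qed

lemma rot_0: "rot 0 = id2"
proof -
  have "solves_ivp (rot_rhs 0) 0 1 id2 (\<lambda>t. id2)"
    by (simp add: solves_ivp_def bounded_bilinear.zero_left[OF bounded_bilinear_act])
  then show ?thesis by (rule rot_eq)
qed

text \<open>The generator becomes a second component of the state with derivative 0, so dependence
  on it is a case of dependence on the initial value. Differentiability in all directions is needed
  for the exponential map as a function on a tangent space.\<close>

lemma rot_differentiable:
  fixes \<Omega> :: "('n::finite) tvec"
  obtains D where "(rot has_derivative D) (at \<Omega>)"
proof -
  define H where "H p = (act (snd (fst p)) (fst (fst p)), 0 :: 'n tvec)" for p :: "('n tvec \<times> 'n tvec) \<times> real"
  have "C_dirs state_dirs (Suc 0) (UNIV \<times> {0..1}) H"
    unfolding H_def[abs_def]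
    by (intro C_dirs_Pair C_dirs_bilinear[OF bounded_bilinear_act] C_dirs_const C_dirs_bounded_linear bounded_linear_intros)
  then obtain G where "C1_ivp H G 0 1" by (rule C1_ivp_of_C_dirs[rotated]) auto
  then interpret C1_ivp H G 0 1 .
  obtain X where X: "solves_ivp (rot_rhs \<Omega>) 0 1 id2 X" using rot_rhs_solution[of 1 \<Omega>] by auto
  have "solves_ivp H 0 1 (id2, \<Omega>) (\<lambda>t. (X t, \<Omega>))"
    unfolding solves_ivp_def
  proof (intro conjI ballI)
    show "(X 0, \<Omega>) = (id2, \<Omega>)" using solves_ivpD(1)[OF X] by simp
    fix t :: real assume "t \<in> {0..1}"
    from has_vector_derivative_Pair[OF solves_ivpD(2)[OF X this] has_vector_derivative_const[of \<Omega>]]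
    show "((\<lambda>t. (X t, \<Omega>)) has_vector_derivative H ((X t, \<Omega>), t)) (at t within {0..1})"
      by (simp add: H_def)
  qed
  then obtain d \<phi> w where d: "d > 0"
    and \<phi>: "\<And>y. y \<in> ball (id2, \<Omega>) d \<Longrightarrow> solves_ivp H 0 1 y (\<phi> y)"
    and "\<And>y h. y \<in> ball (id2, \<Omega>) d \<Longrightarrow> solves_ivp (\<lambda>(v, t). A (\<phi> y t, t) v) 0 1 h (w y h)"
    and der: "\<And>t y. t \<in> {0..1} \<Longrightarrow> y \<in> ball (id2, \<Omega>) d \<Longrightarrow> ((\<lambda>y. \<phi> y t) has_derivative (\<lambda>h. w y h t)) (at y)"
    and "\<And>t h. t \<in> {0..1} \<Longrightarrow> continuous_on (ball (id2, \<Omega>) d) (\<lambda>y. w y h t)"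
    by (rule C1_dependence) (rule that)
  have rot: "fst (\<phi> (id2, \<Omega>') 1) = rot \<Omega>'" if "\<Omega>' \<in> ball \<Omega> d" for \<Omega>'
  proof -
    have sol: "solves_ivp H 0 1 (id2, \<Omega>') (\<phi> (id2, \<Omega>'))"
      using that by (intro \<phi>) (auto simp: dist_Pair_Pair)
    let ?f = "\<phi> (id2, \<Omega>')"
    have "((\<lambda>t. snd (?f t)) has_vector_derivative 0) (at t within {0..1})" if "t \<in> {0..1}" for t
      using bounded_linear.has_vector_derivative[OF bounded_linear_snd solves_ivpD(2)[OF sol that]] by (simp add: H_def)
    from zero_derivative_const[OF this] have snd: "snd (?f t) = \<Omega>'" if "t \<in> {0..1}" for t
      using that solves_ivpD(1)[OF sol] by simp
    have "solves_ivp (rot_rhs \<Omega>') 0 1 id2 (\<lambda>t. fst (?f t))"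
      unfolding solves_ivp_def
    proof (intro conjI ballI)
      show "fst (?f 0) = id2" using solves_ivpD(1)[OF sol] by simp
      fix t :: real assume "t \<in> {0..1}"
      then show "((\<lambda>t. fst (?f t)) has_vector_derivative rot_rhs \<Omega>' (fst (?f t), t)) (at t within {0..1})"
        using bounded_linear.has_vector_derivative[OF bounded_linear_fst solves_ivpD(2)[OF sol]] snd
        by (simp add: H_def)
    qed
    from rot_eq[OF this] show ?thesis by simp
  qed
  have "((\<lambda>\<Omega>'. (id2, \<Omega>')) has_derivative (\<lambda>h. (0, h))) (at \<Omega>)"
    by (auto intro!: derivative_eq_intros)
  moreover have "((\<lambda>y. \<phi> y 1) has_derivative (\<lambda>h. w (id2, \<Omega>) h 1)) (at (id2, \<Omega>))"
    using d by (intro der) auto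
  ultimately have "((\<lambda>\<Omega>'. \<phi> (id2, \<Omega>') 1) has_derivative (\<lambda>h. w (id2, \<Omega>) (0, h) 1)) (at \<Omega>)"
    by (rule has_derivative_compose)
  from has_derivative_fst[OF this]
  have "(rot has_derivative (\<lambda>h. fst (w (id2, \<Omega>) (0, h) 1))) (at \<Omega>)"
    by (rule has_derivative_transform_within_open[where s = "ball \<Omega> d"]) (use d rot in auto)
  then show thesis by (rule that)
qed

text \<open>The initial value problem yields the derivative within an interval only, one-sided at 0.
  Differentiability of \<open>rot\<close> supplies a two-sided derivative, and uniqueness of
  derivatives within the interval identifies its value.\<close>

lemma rot_has_vector_derivative:
  assumes s: "0 \<le> s"
  shows "((\<lambda>s. rot (s *\<^sub>R \<Omega>)) has_vector_derivative act \<Omega> (rot (s *\<^sub>R \<Omega>))) (at s)"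
proof -
  obtain X where X: "solves_ivp (rot_rhs \<Omega>) 0 (s + 1) id2 X" using rot_rhs_solution[of "s + 1" \<Omega>] s by auto
  have "(X has_vector_derivative act \<Omega> (X s)) (at s within {0..s + 1})"
    using solves_ivpD(2)[OF X, of s] s by simp
  then have right: "((\<lambda>s. rot (s *\<^sub>R \<Omega>)) has_vector_derivative act \<Omega> (X s)) (at s within {0..s + 1})"
    by (rule has_vector_derivative_transform[rotated -1]) (use s in \<open>auto simp: rot_scale[OF X]\<close>)
  obtain D where D: "(rot has_derivative D) (at (s *\<^sub>R \<Omega>))" by (rule rot_differentiable)
  interpret bounded_linear D using D by (rule has_derivative_bounded_linear)
  have "((\<lambda>s. s *\<^sub>R \<Omega>) has_derivative (\<lambda>h. h *\<^sub>R \<Omega>)) (at s)"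
    by (auto intro!: derivative_eq_intros)
  from has_derivative_compose[OF this D]
  have two: "((\<lambda>s. rot (s *\<^sub>R \<Omega>)) has_vector_derivative D \<Omega>) (at s)"
    by (simp add: has_vector_derivative_def scaleR)
  have "at s within {0..s + 1} \<noteq> bot"
    using s by (intro at_within_Icc_neq_bot) auto
  then have "D \<Omega> = act \<Omega> (X s)"
    using vector_derivative_unique_within right has_vector_derivative_at_within[OF two] by blast
  then show ?thesis using two rot_scale[OF X, of s] s by simp
qed

section \<open>Geodesics and parallel translation\<close>

text \<open>Since \<open>A\<close> is skew, the Gram matrix of \<open>\<Phi> t\<close> is constant.
  Hence the frame stays of full rank, the inverse Gram matrix in the projector is a constant
  \<open>M\<close>, and the product rule gives the commutator.\<close>

lemma orthogonal_flow:
  fixes \<Phi> :: "real \<Rightarrow> real ^ 'r ^ 'n"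
  assumes A: "transpose A = - A"
    and \<Phi>: "\<And>t. t \<in> {a..b} \<Longrightarrow> (\<Phi> has_vector_derivative A ** \<Phi> t) (at t within {a..b})"
    and full: "\<Phi> a \<in> full_rank" and t: "t \<in> {a..b}"
  shows "\<Phi> t \<in> full_rank"
    and "((\<lambda>t. pr (\<Phi> t)) has_vector_derivative A ** pr (\<Phi> t) - pr (\<Phi> t) ** A) (at t within {a..b})"
proof -
  have T: "((\<lambda>t. transpose (\<Phi> t)) has_vector_derivative - (transpose (\<Phi> t) ** A)) (at t within {a..b})"
    if "t \<in> {a..b}" for t
    using bounded_linear.has_vector_derivative[OF bounded_linear_transpose \<Phi>[OF that]]
    by (simp add: transpose_simps A matmul_simps)
  have gram': "((\<lambda>t. transpose (\<Phi> t) ** \<Phi> t) has_vector_derivative 0) (at t within {a..b})" if "t \<in> {a..b}" for t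
    using bounded_bilinear.has_vector_derivative[OF bounded_bilinear_matrix_mult T[OF that] \<Phi>[OF that]]
    by (simp add: matmul_simps matrix_mul_assoc)
  have gram: "transpose (\<Phi> t) ** \<Phi> t = transpose (\<Phi> a) ** \<Phi> a" if "t \<in> {a..b}" for t
    by (rule zero_derivative_const[OF gram' that])
  show "\<Phi> t \<in> full_rank" using full t by (simp add: full_rank_iff_det gram[OF t])
  define M where "M = matrix_inv (transpose (\<Phi> a) ** \<Phi> a)"
  have pr: "pr (\<Phi> t) = \<Phi> t ** M ** transpose (\<Phi> t)" if "t \<in> {a..b}" for t
    by (simp add: pr_def oblique_def gram[OF that] M_def)
  have "((\<lambda>t. \<Phi> t ** M) has_vector_derivative A ** \<Phi> t ** M) (at t within {a..b})"
    by (rule bounded_linear.has_vector_derivative[OF bounded_bilinear.bounded_linear_left[OF bounded_bilinear_matrix_mult] \<Phi>[OF t]])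
  from bounded_bilinear.has_vector_derivative[OF bounded_bilinear_matrix_mult this T[OF t]]
  have "((\<lambda>t. \<Phi> t ** M ** transpose (\<Phi> t)) has_vector_derivative A ** pr (\<Phi> t) - pr (\<Phi> t) ** A) (at t within {a..b})"
    by (simp add: pr[OF t] matmul_simps matrix_mul_assoc)
  then show "((\<lambda>t. pr (\<Phi> t)) has_vector_derivative A ** pr (\<Phi> t) - pr (\<Phi> t) ** A) (at t within {a..b})"
    by (rule has_vector_derivative_transform[OF t, rotated]) (simp add: pr)
qed

section \<open>Commutators with a projector\<close>

context
  fixes P A :: "real ^ 'n ^ 'n"
  assumes P: "orth_projector P" and A: "transpose A = - A" and off: "A ** P + P ** A = A"
begin

text \<open>An off-diagonal \<open>A\<close> exchanges range and kernel of \<open>P\<close>, so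
  \<open>A ** A\<close> commutes with \<open>P\<close>. The double commutator reduces to
  \<open>4 *\<^sub>R (A ** A ** P) - 2 *\<^sub>R (A ** A)\<close>, which is symmetric and commutes
  with \<open>P\<close>, hence normal.\<close>

lemma off_diagonal_acceleration: "tproj P (A ** (A ** P - P ** A) - (A ** P - P ** A) ** A) = 0"
proof -
  have PA: "P ** A = A - A ** P" using off by (simp add: algebra_simps)
  have PAA: "P ** (A ** A) = A ** A ** P"
  proof -
    have "P ** (A ** A) = (A - A ** P) ** A" by (simp add: matrix_mul_assoc PA)
    also have "\<dots> = A ** A - A ** (P ** A)" by (simp only: matmul_simps matrix_mul_assoc)
    also have "\<dots> = A ** A - (A ** A - A ** A ** P)" unfolding PA by (simp only: matmul_simps matrix_mul_assoc)
    finally show ?thesis by simp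
  qed
  have N: "A ** (A ** P - P ** A) - (A ** P - P ** A) ** A = 4 *\<^sub>R (A ** A ** P) - 2 *\<^sub>R (A ** A)"
  proof -
    have 1: "A ** P ** A = A ** A - A ** A ** P"
      by (simp only: matrix_mul_assoc[symmetric] PA matmul_simps)
    have 2: "P ** A ** A = A ** A ** P" using PAA by (simp add: matrix_mul_assoc)
    have "A ** (A ** P - P ** A) - (A ** P - P ** A) ** A
        = A ** A ** P - A ** P ** A - (A ** P ** A - P ** A ** A)"
      by (simp only: matmul_simps matrix_mul_assoc)
    also have "\<dots> = 4 *\<^sub>R (A ** A ** P) - 2 *\<^sub>R (A ** A)"
      unfolding 1 2 by (simp add: vec_eq_iff)
    finally show ?thesis .
  qed
  show ?thesis
    unfolding N
  proof (rule tproj_eq_0[OF P])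
    show "P ** (4 *\<^sub>R (A ** A ** P) - 2 *\<^sub>R (A ** A)) = (4 *\<^sub>R (A ** A ** P) - 2 *\<^sub>R (A ** A)) ** P"
      using PAA PPl[OF P] by (simp add: matmul_simps matrix_mul_assoc)
    have "transpose (A ** A) = A ** A" by (simp add: transpose_simps A matmul_simps)
    moreover from this have "transpose (A ** A ** P) = A ** A ** P"
      using PAA by (simp add: transpose_simps Pt[OF P] A matmul_simps)
    ultimately show "transpose (4 *\<^sub>R (A ** A ** P) - 2 *\<^sub>R (A ** A)) = 4 *\<^sub>R (A ** A ** P) - 2 *\<^sub>R (A ** A)"
      by (simp only: transpose_simps)
  qed
qed

end

text \<open>The commutator with \<open>P\<close> keeps one off-diagonal block of
  \<open>\<xi>\<close> and negates the other. This makes the symmetric matrix skew, and doing it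
  twice gives \<open>\<xi>\<close> back.\<close>

lemma commutator_tangent:
  assumes P: "orth_projector P" and \<xi>: "\<xi> \<in> tan_at P"
  defines "A \<equiv> \<xi> ** P - P ** \<xi>"
  shows "transpose A = - A" "A ** P + P ** A = A" "A ** P - P ** A = \<xi>"
proof -
  note * = tan_atD[OF P \<xi>]
  show "transpose A = - A" by (simp add: A_def transpose_simps Pt[OF P] *(1))
  have 1: "A ** P = \<xi> ** P" using *(3) PPl[OF P, of \<xi>] by (simp add: A_def matmul_simps)
  have 2: "P ** A = - (P ** \<xi>)" using *(3) PP[OF P] by (simp add: A_def matmul_simps matrix_mul_assoc)
  show "A ** P + P ** A = A" unfolding 1 2 by (simp add: A_def)
  show "A ** P - P ** A = \<xi>" unfolding 1 2 using *(2) by simp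
qed

text \<open>The defect \<open>A ** P t + P t ** A - A\<close> satisfies a linear homogeneous
  differential equation and starts at 0.\<close>

lemma off_diagonal_preserved:
  assumes P: "\<And>t. t \<in> {a..b} \<Longrightarrow> (P has_vector_derivative A ** P t - P t ** A) (at t within {a..b})"
    and init: "A ** P a + P a ** A = A" and t: "t \<in> {a..b}"
  shows "A ** P t + P t ** A = (A :: real ^ 'n ^ 'n)"
proof -
  have "A ** P t + P t ** A - A = 0"
  proof (rule linear_ode_zero[where A = "\<lambda>X. A ** X - X ** A" and u = "\<lambda>t. A ** P t + P t ** A - A"])
    show "bounded_linear (\<lambda>X. A ** X - X ** A)"
      by (intro bounded_linear_sub bounded_bilinear.bounded_linear_left[OF bounded_bilinear_matrix_mult]
          bounded_bilinear.bounded_linear_right[OF bounded_bilinear_matrix_mult])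
    fix s assume s: "s \<in> {a..b}"
    have "((\<lambda>t. A ** P t + P t ** A - A) has_vector_derivative
        A ** (A ** P s - P s ** A) + (A ** P s - P s ** A) ** A - 0) (at s within {a..b})"
      by (intro has_vector_derivative_diff has_vector_derivative_add has_vector_derivative_const
          bounded_linear.has_vector_derivative[OF bounded_bilinear.bounded_linear_left[OF bounded_bilinear_matrix_mult] P[OF s]]
          bounded_linear.has_vector_derivative[OF bounded_bilinear.bounded_linear_right[OF bounded_bilinear_matrix_mult] P[OF s]])
    then show "((\<lambda>t. A ** P t + P t ** A - A) has_vector_derivative
        A ** (A ** P s + P s ** A - A) - (A ** P s + P s ** A - A) ** A) (at s within {a..b})"
      by (simp add: matmul_simps matrix_mul_assoc algebra_simps)
  qed (use init t in auto)
  then show ?thesis by simp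
qed

section \<open>Explicit geodesics\<close>

context grassmannian
begin

lemma brk_tangent:
  fixes p :: "('n, 'r) pt"
  assumes "\<xi> \<in> tangent p"
  shows "skew2 (brk \<xi> (embed p))" "brk (brk \<xi> (embed p)) (embed p) = \<xi>"
proof -
  have \<xi>: "fst \<xi> \<in> tan_at (fst (embed p))" "snd \<xi> \<in> tan_at (snd (embed p))"
    using assms by (auto simp: tangent_eq)
  note c = commutator_tangent[OF orth_projector_embed(1) \<xi>(1)] commutator_tangent[OF orth_projector_embed(2) \<xi>(2)]
  show "skew2 (brk \<xi> (embed p))" "brk (brk \<xi> (embed p)) (embed p) = \<xi>"
    using c(1,3,4,6) by (simp_all add: skew2_def brk_def act_def prod_eq_iff)
qed

text \<open>The curve \<open>exp (t \<Omega>) z\<close> of frames over the geodesic from \<open>p\<close> in direction \<open>\<xi>\<close>, where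
  \<open>\<Omega> = [\<xi>, p]\<close> is the skew matrix with \<open>[\<Omega>, p] = \<xi>\<close>.\<close>

definition geo_frames :: "'n tvec \<Rightarrow> ('n, 'r) frames \<Rightarrow> ('n, 'r) frames" where
  "geo_frames \<xi> z = act (rot (brk \<xi> (pr2 z))) z"

lemma geo_frames_scale: "geo_frames (t *\<^sub>R \<xi>) z = act (rot (t *\<^sub>R brk \<xi> (pr2 z))) z"
  by (simp add: geo_frames_def bounded_bilinear.scaleR_left[OF bounded_bilinear_brk])

lemma geo_frames_has_vector_derivative:
  assumes "0 \<le> t"
  shows "((\<lambda>t. geo_frames (t *\<^sub>R \<xi>) z) has_vector_derivative act (brk \<xi> (pr2 z)) (geo_frames (t *\<^sub>R \<xi>) z)) (at t)"
  unfolding geo_frames_scale act_act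
  by (rule bounded_linear.has_vector_derivative[OF bounded_bilinear.bounded_linear_left[OF bounded_bilinear_act] rot_has_vector_derivative[OF assms]])

lemma geo_frames_0: "geo_frames 0 z = z"
  using geo_frames_scale[of 0 0 z] by (simp add: rot_0 act_id2)

context
  fixes z :: "('n, 'r) frames" and \<xi> :: "'n tvec" and p :: "('n, 'r) pt" and \<Omega> :: "'n tvec"
  assumes z: "z \<in> frame_pairs" and \<xi>: "\<xi> \<in> tangent (range_of2 z)"
  defines "p \<equiv> range_of2 z" and "\<Omega> \<equiv> brk \<xi> (embed p)"
begin

definition geo :: "real \<Rightarrow> ('n, 'r) pt" where
  "geo t = range_of2 (geo_frames (t *\<^sub>R \<xi>) z)"

lemma geo_frames_full: "0 \<le> t \<Longrightarrow> geo_frames (t *\<^sub>R \<xi>) z \<in> frame_pairs"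
  and embed_geo_deriv: "t \<in> {0..T} \<Longrightarrow> ((\<lambda>s. embed (geo s)) has_vector_derivative brk \<Omega> (embed (geo t))) (at t within {0..T})"
proof -
  have \<Omega>: "\<Omega> = brk \<xi> (pr2 z)" using z by (simp add: \<Omega>_def p_def embed_range_of2)
  have skew: "transpose (fst \<Omega>) = - fst \<Omega>" "transpose (snd \<Omega>) = - snd \<Omega>"
    using brk_tangent(1)[OF \<xi>] by (auto simp: \<Omega>_def p_def skew2_def)
  have der: "((\<lambda>t. geo_frames (t *\<^sub>R \<xi>) z) has_vector_derivative act \<Omega> (geo_frames (t *\<^sub>R \<xi>) z)) (at t within S)"
    if "0 \<le> t" for t S
    using has_vector_derivative_at_within[OF geo_frames_has_vector_derivative[OF that]] unfolding \<Omega> .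
  have der1: "((\<lambda>t. fst (geo_frames (t *\<^sub>R \<xi>) z)) has_vector_derivative fst \<Omega> ** fst (geo_frames (t *\<^sub>R \<xi>) z)) (at t within S)"
    and der2: "((\<lambda>t. snd (geo_frames (t *\<^sub>R \<xi>) z)) has_vector_derivative snd \<Omega> ** snd (geo_frames (t *\<^sub>R \<xi>) z)) (at t within S)"
    if "0 \<le> t" for t S
    using bounded_linear.has_vector_derivative[OF bounded_linear_fst der[OF that]]
      bounded_linear.has_vector_derivative[OF bounded_linear_snd der[OF that]] by (simp_all add: act_def)
  have full: "geo_frames (t *\<^sub>R \<xi>) z \<in> frame_pairs" if "0 \<le> t" for t
    using orthogonal_flow(1)[OF skew(1) der1, of 0 t t] orthogonal_flow(1)[OF skew(2) der2, of 0 t t] that z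
      geo_frames_0[of z] by (simp add: mem_Times_iff)
  then show "0 \<le> t \<Longrightarrow> geo_frames (t *\<^sub>R \<xi>) z \<in> frame_pairs" .
  assume t: "t \<in> {0..T}"
  have init: "fst (geo_frames (0 *\<^sub>R \<xi>) z) \<in> full_rank" "snd (geo_frames (0 *\<^sub>R \<xi>) z) \<in> full_rank"
    using z geo_frames_0[of z] by (simp_all add: mem_Times_iff)
  have "((\<lambda>t. pr (fst (geo_frames (t *\<^sub>R \<xi>) z))) has_vector_derivative
      fst \<Omega> ** pr (fst (geo_frames (t *\<^sub>R \<xi>) z)) - pr (fst (geo_frames (t *\<^sub>R \<xi>) z)) ** fst \<Omega>) (at t within {0..T})"
    by (rule orthogonal_flow(2)[where \<Phi> = "\<lambda>t. fst (geo_frames (t *\<^sub>R \<xi>) z)", OF skew(1) _ init(1) t]) (simp add: der1)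
  moreover have "((\<lambda>t. pr (snd (geo_frames (t *\<^sub>R \<xi>) z))) has_vector_derivative
      snd \<Omega> ** pr (snd (geo_frames (t *\<^sub>R \<xi>) z)) - pr (snd (geo_frames (t *\<^sub>R \<xi>) z)) ** snd \<Omega>) (at t within {0..T})"
    by (rule orthogonal_flow(2)[where \<Phi> = "\<lambda>t. snd (geo_frames (t *\<^sub>R \<xi>) z)", OF skew(2) _ init(2) t]) (simp add: der2)
  ultimately have "((\<lambda>t. pr2 (geo_frames (t *\<^sub>R \<xi>) z)) has_vector_derivative brk \<Omega> (pr2 (geo_frames (t *\<^sub>R \<xi>) z))) (at t within {0..T})"
    unfolding pr2_def brk_def act_def using has_vector_derivative_Pair by fastforce
  then have "((\<lambda>s. embed (geo s)) has_vector_derivative brk \<Omega> (pr2 (geo_frames (t *\<^sub>R \<xi>) z))) (at t within {0..T})"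
    by (rule has_vector_derivative_transform[OF t, rotated]) (use full in \<open>simp add: geo_def embed_range_of2\<close>)
  then show "((\<lambda>s. embed (geo s)) has_vector_derivative brk \<Omega> (embed (geo t))) (at t within {0..T})"
    using t full by (simp add: geo_def embed_range_of2)
qed

lemma geo_0: "geo 0 = p"
  using geo_frames_0[of z] by (simp add: geo_def p_def)

lemma geo_velocity_tangent: "0 \<le> t \<Longrightarrow> brk \<Omega> (embed (geo t)) \<in> tangent (geo t)"
proof -
  assume t: "0 \<le> t"
  have d: "((\<lambda>s. embed (geo s)) has_vector_derivative brk \<Omega> (embed (geo t))) (at t within {0..t + 1})"
    using t by (intro embed_geo_deriv) auto
  have "at t within {0..t + 1} \<noteq> bot" using t by (intro at_within_Icc_neq_bot) auto
  then show ?thesis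
    unfolding tangent_eq
    using orth_projector_derivative[OF _ bounded_linear.has_vector_derivative[OF bounded_linear_fst d]]
      orth_projector_derivative[OF _ bounded_linear.has_vector_derivative[OF bounded_linear_snd d]]
      orth_projector_embed t by (simp add: mem_Times_iff)
qed

lemma geo_velocity_deriv: "t \<in> {0..T} \<Longrightarrow>
    ((\<lambda>s. brk \<Omega> (embed (geo s))) has_vector_derivative brk \<Omega> (brk \<Omega> (embed (geo t)))) (at t within {0..T})"
  by (rule bounded_linear.has_vector_derivative[OF bounded_bilinear.bounded_linear_right[OF bounded_bilinear_brk] embed_geo_deriv])

text \<open>The generator is off-diagonal with respect to the starting point, because it is the
  commutator of a tangent matrix; it remains so along the curve, and then the second derivative is
  normal at every time.\<close>

lemma geo_acceleration: "0 \<le> t \<Longrightarrow> tproj2 (embed (geo t)) (brk \<Omega> (brk \<Omega> (embed (geo t)))) = 0"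
proof -
  assume t: "0 \<le> t"
  have skew: "transpose (fst \<Omega>) = - fst \<Omega>" "transpose (snd \<Omega>) = - snd \<Omega>"
    using brk_tangent(1)[OF \<xi>] by (auto simp: \<Omega>_def p_def skew2_def)
  have \<xi>': "fst \<xi> \<in> tan_at (fst (embed p))" "snd \<xi> \<in> tan_at (snd (embed p))"
    using \<xi> by (auto simp: tangent_eq p_def)
  have off1: "fst \<Omega> ** fst (embed (geo t)) + fst (embed (geo t)) ** fst \<Omega> = fst \<Omega>"
  proof (rule off_diagonal_preserved[where P = "\<lambda>t. fst (embed (geo t))" and a = 0 and b = t])
    show "((\<lambda>t. fst (embed (geo t))) has_vector_derivative
        fst \<Omega> ** fst (embed (geo s)) - fst (embed (geo s)) ** fst \<Omega>) (at s within {0..t})" if "s \<in> {0..t}" for s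
      using bounded_linear.has_vector_derivative[OF bounded_linear_fst embed_geo_deriv[OF that]]
      by (simp add: brk_def act_def)
    show "fst \<Omega> ** fst (embed (geo 0)) + fst (embed (geo 0)) ** fst \<Omega> = fst \<Omega>"
      using commutator_tangent(2)[OF orth_projector_embed(1) \<xi>'(1)] by (simp add: geo_0 \<Omega>_def brk_def act_def)
  qed (use t in auto)
  have off2: "snd \<Omega> ** snd (embed (geo t)) + snd (embed (geo t)) ** snd \<Omega> = snd \<Omega>"
  proof (rule off_diagonal_preserved[where P = "\<lambda>t. snd (embed (geo t))" and a = 0 and b = t])
    show "((\<lambda>t. snd (embed (geo t))) has_vector_derivative
        snd \<Omega> ** snd (embed (geo s)) - snd (embed (geo s)) ** snd \<Omega>) (at s within {0..t})" if "s \<in> {0..t}" for s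
      using bounded_linear.has_vector_derivative[OF bounded_linear_snd embed_geo_deriv[OF that]]
      by (simp add: brk_def act_def)
    show "snd \<Omega> ** snd (embed (geo 0)) + snd (embed (geo 0)) ** snd \<Omega> = snd \<Omega>"
      using commutator_tangent(2)[OF orth_projector_embed(2) \<xi>'(2)] by (simp add: geo_0 \<Omega>_def brk_def act_def)
  qed (use t in auto)
  show ?thesis
    using off_diagonal_acceleration[OF orth_projector_embed(1) skew(1) off1]
      off_diagonal_acceleration[OF orth_projector_embed(2) skew(2) off2]
    by (simp add: tproj2_def brk_def act_def zero_prod_def)
qed

lemma geo_velocity_0: "brk \<Omega> (embed (geo 0)) = \<xi>"
  using brk_tangent(2)[OF \<xi>] by (simp add: geo_0 \<Omega>_def p_def)

end

end

section \<open>Covariant derivatives, the exponential map and parallel translation\<close>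

context grassmann_connection
begin

lemma velocity_eq:
  "((\<lambda>s. embed (\<gamma> s)) has_vector_derivative v) (at t within I) \<Longrightarrow> at t within I \<noteq> bot \<Longrightarrow> velocity I \<gamma> t = v"
  unfolding velocity_def by (rule vector_derivative_within)

lemma curve_velocity_tangent:
  fixes \<gamma> :: "real \<Rightarrow> ('n, 'r) pt"
  assumes d: "((\<lambda>s. embed (\<gamma> s)) has_vector_derivative v) (at t within I)" and t: "t \<in> I" "at t within I \<noteq> bot"
  shows "v \<in> tangent (\<gamma> t)"
  unfolding tangent_eq
  using orth_projector_derivative[OF _ bounded_linear.has_vector_derivative[OF bounded_linear_fst d] t]
    orth_projector_derivative[OF _ bounded_linear.has_vector_derivative[OF bounded_linear_snd d] t]
    orth_projector_embed by (simp add: mem_Times_iff)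

text \<open>Whatever local representation witnesses the definition, the product rule and the formula
  for the connection reduce it to the projected ordinary derivative. So the value does not depend on
  the representation, and \<open>\<zeta>\<close> is differentiable.\<close>

lemma has_covariant_derivD:
  assumes cov: "has_covariant_deriv nabla I \<gamma> \<zeta> v t"
    and \<gamma>: "((\<lambda>s. embed (\<gamma> s)) has_vector_derivative P') (at t within I)" and t: "t \<in> I" "at t within I \<noteq> bot"
  obtains \<zeta>' where "(\<zeta> has_vector_derivative \<zeta>') (at t within I)" "v = tproj2 (embed (\<gamma> t)) \<zeta>'"
proof -
  obtain N :: nat and a a' E \<delta> where
    E: "\<And>i. i < N \<Longrightarrow> C1_field_near (\<gamma> t) (E i)" and
    a: "\<And>i. i < N \<Longrightarrow> (a i has_real_derivative a' i) (at t within I)" and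
    \<delta>: "\<delta> > 0" "\<And>s. s \<in> I \<Longrightarrow> \<bar>s - t\<bar> < \<delta> \<Longrightarrow> \<zeta> s = (\<Sum>i<N. a i s *\<^sub>R E i (\<gamma> s))" and
    v: "v = (\<Sum>i<N. a' i *\<^sub>R E i (\<gamma> t) + a i t *\<^sub>R nabla (\<gamma> t) (velocity I \<gamma> t) (E i))"
    using cov unfolding has_covariant_deriv_def by blast
  have P': "P' \<in> tangent (\<gamma> t)" using curve_velocity_tangent[OF \<gamma> t] .
  interpret tp: bounded_linear "tproj2 (embed (\<gamma> t))" by (rule bounded_linear_tproj2)
  let ?\<zeta>' = "\<Sum>i<N. a i t *\<^sub>R mderiv (E i) (\<gamma> t) P' + a' i *\<^sub>R E i (\<gamma> t)"
  have "((\<lambda>s. \<Sum>i<N. a i s *\<^sub>R E i (\<gamma> s)) has_vector_derivative ?\<zeta>') (at t within I)"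
    using a mderiv_along_curve[OF C1_field_nearD(1)[OF E] \<gamma> t(1) P']
    by (intro has_vector_derivative_sum has_vector_derivative_scaleR) auto
  then have "(\<zeta> has_vector_derivative ?\<zeta>') (at t within I)"
    by (rule has_vector_derivative_transform_within[OF _ \<delta>(1) t(1)]) (simp add: \<delta>(2) dist_real_def)
  moreover have "v = tproj2 (embed (\<gamma> t)) ?\<zeta>'"
    unfolding v velocity_eq[OF \<gamma> t(2)] tp.sum
    using nabla_eq[OF P' E] C1_field_nearD(2)[OF E]
    by (intro sum.cong) (auto simp: tp.add tp.scaleR tproj2_id)
  ultimately show thesis by (rule that)
qed

text \<open>The projected basis fields represent every tangent field along the curve, with its
  matrix entries as coefficients. This also works where the velocity vanishes, since the fields are
  not built from the curve.\<close>

lemma has_covariant_derivI: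
  assumes \<gamma>: "((\<lambda>s. embed (\<gamma> s)) has_vector_derivative P') (at t within I)" and t: "t \<in> I" "at t within I \<noteq> bot"
    and \<zeta>: "(\<zeta> has_vector_derivative \<zeta>') (at t within I)" and tan: "\<And>s. s \<in> I \<Longrightarrow> \<zeta> s \<in> tangent (\<gamma> s)"
  shows "has_covariant_deriv nabla I \<gamma> \<zeta> (tproj2 (embed (\<gamma> t)) \<zeta>') t"
proof -
  have P': "P' \<in> tangent (\<gamma> t)" using curve_velocity_tangent[OF \<gamma> t] .
  \<comment> \<open>The definition of the covariant derivative indexes its fields by natural
    numbers, so the basis is enumerated.\<close>
  obtain h where h: "bij_betw h {0..<card (Basis :: 'n tvec set)} (Basis :: 'n tvec set)"
    using ex_bij_betw_nat_finite[OF finite_Basis] by blast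
  let ?N = "card (Basis :: 'n tvec set)"
  have re: "(\<Sum>i<?N. F (h i)) = (\<Sum>b\<in>Basis. F b)" for F :: "'n tvec \<Rightarrow> 'n tvec"
    using sum.reindex_bij_betw[OF h, of F] by (simp add: atLeast0LessThan)
  show ?thesis
    unfolding has_covariant_deriv_def
  proof (intro exI[of _ ?N] exI[of _ "\<lambda>i s. \<zeta> s \<bullet> h i"] exI[of _ "\<lambda>i. \<zeta>' \<bullet> h i"]
      exI[of _ "\<lambda>i. proj_field (h i)"] exI[of _ 1] conjI allI impI ballI)
    fix i
    show "C1_field_near (\<gamma> t) (proj_field (h i))" by (rule C1_field_proj_field)
    show "((\<lambda>s. \<zeta> s \<bullet> h i) has_real_derivative \<zeta>' \<bullet> h i) (at t within I)"
      unfolding has_real_derivative_iff_has_vector_derivative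
      by (rule bounded_linear.has_vector_derivative[OF bounded_linear_inner_left \<zeta>])
  next
    fix s assume "s \<in> I"
    have "(\<Sum>i<?N. (\<zeta> s \<bullet> h i) *\<^sub>R proj_field (h i) (\<gamma> s)) = proj_field (\<zeta> s) (\<gamma> s)"
      unfolding re[of "\<lambda>b. (\<zeta> s \<bullet> b) *\<^sub>R proj_field b (\<gamma> s)"] by (rule proj_field_expand[symmetric])
    then show "\<zeta> s = (\<Sum>i<?N. (\<zeta> s \<bullet> h i) *\<^sub>R proj_field (h i) (\<gamma> s))"
      using tan[OF \<open>s \<in> I\<close>] by (simp add: proj_field_def tproj2_id)
  next
    have "(\<Sum>i<?N. (\<zeta>' \<bullet> h i) *\<^sub>R proj_field (h i) (\<gamma> t) + (\<zeta> t \<bullet> h i) *\<^sub>R nabla (\<gamma> t) (velocity I \<gamma> t) (proj_field (h i)))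
      = proj_field \<zeta>' (\<gamma> t) + (\<Sum>b\<in>Basis. (\<zeta> t \<bullet> b) *\<^sub>R nabla (\<gamma> t) P' (proj_field b))"
      unfolding re[of "\<lambda>b. (\<zeta>' \<bullet> b) *\<^sub>R proj_field b (\<gamma> t) + (\<zeta> t \<bullet> b) *\<^sub>R nabla (\<gamma> t) (velocity I \<gamma> t) (proj_field b)"]
      by (simp add: sum.distrib velocity_eq[OF \<gamma> t(2)] flip: proj_field_expand)
    then show "tproj2 (embed (\<gamma> t)) \<zeta>' = (\<Sum>i<?N. (\<zeta>' \<bullet> h i) *\<^sub>R proj_field (h i) (\<gamma> t)
        + (\<zeta> t \<bullet> h i) *\<^sub>R nabla (\<gamma> t) (velocity I \<gamma> t) (proj_field (h i)))"
      using sum_nabla_proj_field[OF P' tan[OF t(1)]] by (simp add: proj_field_def)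
  qed simp
qed

text \<open>The derivative of \<open>u t \<bullet> u t\<close> pairs a tangent with a normal matrix.
  Applied to the velocity this gives the isometry of the transport, and applied to the difference of
  two parallel fields it gives uniqueness.\<close>

lemma norm_const_of_normal_deriv:
  fixes \<gamma> :: "real \<Rightarrow> ('n, 'r) pt"
  assumes u: "\<And>t. t \<in> {a..b} \<Longrightarrow> (u has_vector_derivative u' t) (at t within {a..b})"
    and normal: "\<And>t. t \<in> {a..b} \<Longrightarrow> tproj2 (embed (\<gamma> t)) (u' t) = 0"
    and tan: "\<And>t. t \<in> {a..b} \<Longrightarrow> u t \<in> tangent (\<gamma> t)" and t: "t \<in> {a..b}"
  shows "norm (u t) = norm (u a)"
proof -
  have "((\<lambda>t. u t \<bullet> u t) has_vector_derivative 0) (at s within {a..b})" if s: "s \<in> {a..b}" for s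
  proof -
    have "u s \<bullet> u' s = 0" using inner_tproj2[OF tan[OF s], of "u' s"] normal[OF s] by simp
    then show ?thesis
      using bounded_bilinear.has_vector_derivative[OF bounded_bilinear_inner u[OF s] u[OF s]]
      by (simp add: inner_commute)
  qed
  from zero_derivative_const[OF this t] show ?thesis by (simp add: norm_eq_sqrt_inner)
qed

lemma geodesic_geo:
  fixes z :: "('n, 'r) frames"
  assumes z: "z \<in> frame_pairs" and \<xi>: "\<xi> \<in> tangent (range_of2 z)"
  shows "geodesic nabla {0..1} (geo z \<xi>)" "velocity {0..1} (geo z \<xi>) 0 = \<xi>"
proof -
  note d = embed_geo_deriv[OF z \<xi>] and tan = geo_velocity_tangent[OF z \<xi>]
  let ?\<Omega> = "brk \<xi> (embed (range_of2 z))"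
  have vel: "velocity {0..1} (geo z \<xi>) t = brk ?\<Omega> (embed (geo z \<xi> t))" if "t \<in> {0..1}" for t
    using that by (intro velocity_eq[OF d] at_within_Icc_neq_bot) auto
  show "velocity {0..1} (geo z \<xi>) 0 = \<xi>" using vel[of 0] geo_velocity_0[OF z \<xi>] by simp
  show "geodesic nabla {0..1} (geo z \<xi>)"
    unfolding geodesic_def
  proof (intro ballI conjI)
    fix t :: real assume t: "t \<in> {0..1}"
    show "(\<lambda>s. embed (geo z \<xi> s)) differentiable (at t within {0..1})"
      using d[OF t] by (meson differentiableI has_vector_derivative_def)
    have "(velocity {0..1} (geo z \<xi>) has_vector_derivative brk ?\<Omega> (brk ?\<Omega> (embed (geo z \<xi> t)))) (at t within {0..1})"
      by (rule has_vector_derivative_transform[OF t _ geo_velocity_deriv[OF z \<xi> t]]) (simp add: vel)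
    from has_covariant_derivI[OF d[OF t] t _ this]
    have "has_covariant_deriv nabla {0..1} (geo z \<xi>) (velocity {0..1} (geo z \<xi>))
        (tproj2 (embed (geo z \<xi> t)) (brk ?\<Omega> (brk ?\<Omega> (embed (geo z \<xi> t))))) t"
      using t vel tan at_within_Icc_neq_bot[of 0 1 t] by simp
    then show "has_covariant_deriv nabla {0..1} (geo z \<xi>) (velocity {0..1} (geo z \<xi>)) 0 t"
      using geo_acceleration[OF z \<xi>] t by simp
  qed
qed

text \<open>Along a geodesic, \<open>[\<gamma>', \<gamma>]\<close> is constant, since \<open>\<gamma>''\<close> is normal and hence commutes
  with \<open>\<gamma>\<close>.\<close>

lemma geodesic_unique:
  fixes z :: "('n, 'r) frames"
  assumes z: "z \<in> frame_pairs" and geod: "geodesic nabla {0..1} \<gamma>" and \<gamma>0: "\<gamma> 0 = range_of2 z"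
    and vel0: "velocity {0..1} \<gamma> 0 = \<xi>" and t: "t \<in> {0..1}"
  shows "\<gamma> t = geo z \<xi> t"
proof -
  let ?I = "{0..1::real}" and ?V = "velocity {0..1} \<gamma>" and ?P = "\<lambda>s. embed (\<gamma> s)"
  have nb: "at s within ?I \<noteq> bot" if "s \<in> ?I" for s using that by (intro at_within_Icc_neq_bot) auto
  have V: "(?P has_vector_derivative ?V s) (at s within ?I)" if "s \<in> ?I" for s
    using geod that unfolding geodesic_def velocity_def
    by (auto simp: vector_derivative_works[symmetric])
  have tan: "?V s \<in> tangent (\<gamma> s)" if "s \<in> ?I" for s
    using curve_velocity_tangent[OF V that nb] that by blast
  have "\<exists>V'. \<forall>s\<in>?I. (?V has_vector_derivative V' s) (at s within ?I) \<and> 0 = tproj2 (embed (\<gamma> s)) (V' s)"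
  proof (rule bchoice, rule ballI)
    fix s assume s: "s \<in> ?I"
    then have "has_covariant_deriv nabla ?I \<gamma> ?V 0 s" using geod unfolding geodesic_def by blast
    from has_covariant_derivD[OF this V[OF s] s nb[OF s]]
    show "\<exists>y. (?V has_vector_derivative y) (at s within ?I) \<and> 0 = tproj2 (embed (\<gamma> s)) y" by metis
  qed
  then obtain V' where V': "\<And>s. s \<in> ?I \<Longrightarrow> (?V has_vector_derivative V' s) (at s within ?I)"
    "\<And>s. s \<in> ?I \<Longrightarrow> tproj2 (embed (\<gamma> s)) (V' s) = 0" by metis
  \<comment> \<open>Differentiating the symmetry of the velocity shows that \<open>V' s\<close> is
    symmetric; a symmetric matrix without tangent part commutes with the projector.\<close>
  have comm: "brk (V' s) (?P s) = 0" if s: "s \<in> ?I" for s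
  proof -
    have symV: "transpose (fst (?V r)) = fst (?V r)" "transpose (snd (?V r)) = snd (?V r)" if "r \<in> ?I" for r
      using tan[OF that] orth_projector_embed[of "\<gamma> r"] tan_atD(1) by (auto simp: tangent_eq)
    have "((\<lambda>r. transpose (fst (?V r))) has_vector_derivative transpose (fst (V' s))) (at s within ?I)"
      "((\<lambda>r. transpose (snd (?V r))) has_vector_derivative transpose (snd (V' s))) (at s within ?I)"
      by (intro bounded_linear.has_vector_derivative[OF bounded_linear_transpose]
          bounded_linear.has_vector_derivative[OF bounded_linear_fst V'(1)[OF s]]
          bounded_linear.has_vector_derivative[OF bounded_linear_snd V'(1)[OF s]])+
    then have "((\<lambda>r. fst (?V r)) has_vector_derivative transpose (fst (V' s))) (at s within ?I)"
      "((\<lambda>r. snd (?V r)) has_vector_derivative transpose (snd (V' s))) (at s within ?I)"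
      by (auto intro: has_vector_derivative_transform[OF s, rotated] simp: symV)
    then have sym: "transpose (fst (V' s)) = fst (V' s)" "transpose (snd (V' s)) = snd (V' s)"
      using vector_derivative_unique_within[OF nb[OF s]]
        bounded_linear.has_vector_derivative[OF bounded_linear_fst V'(1)[OF s]]
        bounded_linear.has_vector_derivative[OF bounded_linear_snd V'(1)[OF s]] by blast+
    have "tproj (fst (?P s)) (fst (V' s)) = 0" "tproj (snd (?P s)) (snd (V' s)) = 0"
      using V'(2)[OF s] by (auto simp: tproj2_def zero_prod_def)
    then show ?thesis
      using tproj_eq_0D[OF orth_projector_embed(1) _ sym(1)] tproj_eq_0D[OF orth_projector_embed(2) _ sym(2)]
      by (simp add: brk_def act_def zero_prod_def)
  qed
  have const': "((\<lambda>s. brk (?V s) (?P s)) has_vector_derivative 0) (at s within ?I)" if s: "s \<in> ?I" for s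
    using bounded_bilinear.has_vector_derivative[OF bounded_bilinear_brk V'(1)[OF s] V[OF s]] comm[OF s]
    by (simp add: brk_def)
  have const: "brk (?V s) (?P s) = brk \<xi> (embed (range_of2 z))" if "s \<in> ?I" for s
    using zero_derivative_const[OF const' that] unfolding \<gamma>0 vel0 .
  have \<xi>: "\<xi> \<in> tangent (range_of2 z)" using tan[of 0] \<gamma>0 vel0 by simp
  let ?\<Omega> = "brk \<xi> (embed (range_of2 z))"
  have "?P t = embed (geo z \<xi> t)"
  \<comment> \<open>The velocity is recovered from the constant commutator as
    \<open>brk ?\<Omega> (?P s)\<close>, so both curves solve the same linear equation with the same
    initial value.\<close>
  proof (rule linear_ode_unique[where A = "brk ?\<Omega>" and a = 0 and b = 1])
    show "bounded_linear (brk ?\<Omega>)" by (rule bounded_bilinear.bounded_linear_right[OF bounded_bilinear_brk])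
    show "(?P has_vector_derivative brk ?\<Omega> (?P s)) (at s within ?I)" if "s \<in> ?I" for s
      using V[OF that] brk_tangent(2)[OF tan[OF that]] const[OF that] by simp
    show "((\<lambda>s. embed (geo z \<xi> s)) has_vector_derivative brk ?\<Omega> (embed (geo z \<xi> s))) (at s within ?I)" if "s \<in> ?I" for s
      using embed_geo_deriv[OF z \<xi> that] .
    show "?P 0 = embed (geo z \<xi> 0)" using \<gamma>0 geo_0[OF z \<xi>] by simp
  qed (rule t)
  then show ?thesis by (simp add: embed_inject)
qed

lemma mexp_eq:
  fixes z :: "('n, 'r) frames"
  assumes z: "z \<in> frame_pairs" and \<xi>: "\<xi> \<in> tangent (range_of2 z)"
  shows "mexp nabla (range_of2 z) \<xi> = range_of2 (geo_frames \<xi> z)"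
  unfolding mexp_def
proof (rule the_equality)
  show "\<exists>\<gamma>. geodesic nabla {0..1} \<gamma> \<and> \<gamma> 0 = range_of2 z \<and> velocity {0..1} \<gamma> 0 = \<xi> \<and> \<gamma> 1 = range_of2 (geo_frames \<xi> z)"
    using geodesic_geo[OF z \<xi>] geo_0[OF z \<xi>] by (intro exI[of _ "geo z \<xi>"]) (simp add: geo_def[OF z \<xi>])
  fix q assume "\<exists>\<gamma>. geodesic nabla {0..1} \<gamma> \<and> \<gamma> 0 = range_of2 z \<and> velocity {0..1} \<gamma> 0 = \<xi> \<and> \<gamma> 1 = q"
  then show "q = range_of2 (geo_frames \<xi> z)"
    using geodesic_unique[OF z, of _ \<xi> 1] by (auto simp: geo_def[OF z \<xi>])
qed

end

text \<open>\<open>frechet_derivative\<close> selects one of possibly many derivatives within the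
  subspace, since the values off a proper subspace are not determined. On \<open>h\<close> inside
  the subspace they all equal the derivative along the line.\<close>

lemma frechet_derivative_within_subspace:
  fixes F :: "'a::real_normed_vector \<Rightarrow> 'b::real_normed_vector"
  assumes S: "subspace S" "x \<in> S" "h \<in> S" and F: "(F has_derivative D) (at x within S)"
    and line: "((\<lambda>t. F (x + t *\<^sub>R h)) has_vector_derivative v) (at 0)"
  shows "frechet_derivative F (at x within S) h = v"
proof -
  let ?D = "frechet_derivative F (at x within S)"
  have D: "(F has_derivative ?D) (at x within S)"
    using F by (meson differentiableI frechet_derivative_works)
  interpret bounded_linear ?D using D by (rule has_derivative_bounded_linear)
  have "(F has_derivative ?D) (at (x + 0 *\<^sub>R h) within range (\<lambda>t. x + t *\<^sub>R h))"
    using has_derivative_subset[OF D, of "range (\<lambda>t. x + t *\<^sub>R h)"] S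
    by (auto intro: subspace_add subspace_scale)
  moreover have "((\<lambda>t. x + t *\<^sub>R h) has_derivative (\<lambda>t. t *\<^sub>R h)) (at 0)"
    by (auto intro!: derivative_eq_intros)
  ultimately have "((\<lambda>t. F (x + t *\<^sub>R h)) has_derivative (\<lambda>t. ?D (t *\<^sub>R h))) (at 0)"
    by (rule has_derivative_in_compose[where f = "\<lambda>t. x + t *\<^sub>R h" and g = F, rotated])
  then have "((\<lambda>t. F (x + t *\<^sub>R h)) has_vector_derivative ?D h) (at 0)"
    by (simp add: has_vector_derivative_def scaleR)
  then show ?thesis using line by (rule vector_derivative_unique_at)
qed

lemma C_k_frechet_derivative_apply:
  fixes F :: "'a::euclidean_space \<Rightarrow> 'b::real_normed_vector"
  assumes F: "C_k (Suc k) S F" and S: "open S" and H: "C_k k S H"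
  shows "C_k k S (\<lambda>x. frechet_derivative F (at x) (H x))"
proof (rule C_dirs_cong[OF S])
  show "C_k k S (\<lambda>x. \<Sum>b\<in>Basis. (H x \<bullet> b) *\<^sub>R frechet_derivative F (at x) b)"
    by (intro C_dirs_sum C_dirs_scaleR C_dirs_linear_comp[OF bounded_linear_inner_left] H
        C_k_Suc_frechet_derivative(2)[OF F S])
  fix x assume "x \<in> S"
  then interpret bounded_linear "frechet_derivative F (at x)"
    using C_k_Suc_frechet_derivative(1)[OF F S] by (blast intro: has_derivative_bounded_linear)
  have "frechet_derivative F (at x) (\<Sum>b\<in>Basis. (H x \<bullet> b) *\<^sub>R b) = (\<Sum>b\<in>Basis. (H x \<bullet> b) *\<^sub>R frechet_derivative F (at x) b)"
    by (simp add: sum scaleR)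
  then show "(\<Sum>b\<in>Basis. (H x \<bullet> b) *\<^sub>R frechet_derivative F (at x) b) = frechet_derivative F (at x) (H x)"
    by (simp add: euclidean_representation)
qed

section \<open>Derivatives along geodesics\<close>

context grassmann_connection
begin

text \<open>Stated without frames: \<open>brk \<xi> (embed p)\<close> is the fixed generator of the
  rotations, and its commutator with the current point is the velocity there.\<close>

definition geo_vel :: "('n, 'r) pt \<Rightarrow> 'n tvec \<Rightarrow> real \<Rightarrow> 'n tvec" where
  "geo_vel p \<xi> t = brk (brk \<xi> (embed p)) (embed (mexp nabla p (t *\<^sub>R \<xi>)))"

lemma mexp_geo:
  assumes z: "z \<in> frame_pairs" and \<xi>: "\<xi> \<in> tangent (range_of2 z)"
  shows "mexp nabla (range_of2 z) (t *\<^sub>R \<xi>) = geo z \<xi> t"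
  using mexp_eq[OF z subspace_scale[OF subspace_tangent \<xi>], of t] by (simp add: geo_def[OF z \<xi>])

context
  fixes p :: "('n, 'r) pt" and \<xi>
  assumes \<xi>: "\<xi> \<in> tangent p"
begin

lemma mexp_0: "mexp nabla p 0 = p"
proof -
  obtain z where z: "z \<in> frame_pairs" "range_of2 z = p" by (rule frames_ex)
  have "\<xi> \<in> tangent (range_of2 z)" using z \<xi> by simp
  from mexp_geo[OF z(1) this, of 0] geo_0[OF z(1) this] show ?thesis by (simp add: z(2))
qed

lemma geo_vel_0: "geo_vel p \<xi> 0 = \<xi>"
  using brk_tangent(2)[OF \<xi>] by (simp add: geo_vel_def mexp_0)

lemma
  shows mexp_has_velocity: "t \<in> {0..T} \<Longrightarrow>
      ((\<lambda>s. embed (mexp nabla p (s *\<^sub>R \<xi>))) has_vector_derivative geo_vel p \<xi> t) (at t within {0..T})"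
    and geo_vel_tangent: "0 \<le> t \<Longrightarrow> geo_vel p \<xi> t \<in> tangent (mexp nabla p (t *\<^sub>R \<xi>))"
    and geo_vel_deriv: "t \<in> {0..T} \<Longrightarrow>
      (geo_vel p \<xi> has_vector_derivative brk (brk \<xi> (embed p)) (geo_vel p \<xi> t)) (at t within {0..T})"
    and geo_vel_normal: "0 \<le> t \<Longrightarrow>
      tproj2 (embed (mexp nabla p (t *\<^sub>R \<xi>))) (brk (brk \<xi> (embed p)) (geo_vel p \<xi> t)) = 0"
proof -
  obtain z where z: "z \<in> frame_pairs" "range_of2 z = p" by (rule frames_ex)
  have \<xi>': "\<xi> \<in> tangent (range_of2 z)" using z \<xi> by simp
  note g = mexp_geo[OF z(1) \<xi>', unfolded z(2)]
  note v = geo_vel_def[of p \<xi>, unfolded g]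
  have v': "geo_vel p \<xi> = (\<lambda>s. brk (brk \<xi> (embed p)) (embed (geo z \<xi> s)))"
    by (rule ext) (rule v)
  show "t \<in> {0..T} \<Longrightarrow> ((\<lambda>s. embed (mexp nabla p (s *\<^sub>R \<xi>))) has_vector_derivative geo_vel p \<xi> t) (at t within {0..T})"
    unfolding g v using embed_geo_deriv[OF z(1) \<xi>', unfolded z(2)] .
  show "0 \<le> t \<Longrightarrow> geo_vel p \<xi> t \<in> tangent (mexp nabla p (t *\<^sub>R \<xi>))"
    unfolding g v using geo_velocity_tangent[OF z(1) \<xi>', unfolded z(2)] .
  show "t \<in> {0..T} \<Longrightarrow> (geo_vel p \<xi> has_vector_derivative brk (brk \<xi> (embed p)) (geo_vel p \<xi> t)) (at t within {0..T})"
    unfolding v' using geo_velocity_deriv[OF z(1) \<xi>', unfolded z(2)] .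
  show "0 \<le> t \<Longrightarrow> tproj2 (embed (mexp nabla p (t *\<^sub>R \<xi>))) (brk (brk \<xi> (embed p)) (geo_vel p \<xi> t)) = 0"
    unfolding g v using geo_acceleration[OF z(1) \<xi>', unfolded z(2)] .
qed

lemma norm_geo_vel: "0 \<le> t \<Longrightarrow> norm (geo_vel p \<xi> t) = norm \<xi>"
  using norm_const_of_normal_deriv[of 0 t "geo_vel p \<xi>" _ "\<lambda>s. mexp nabla p (s *\<^sub>R \<xi>)", OF geo_vel_deriv geo_vel_normal geo_vel_tangent]
  by (simp add: geo_vel_0)

text \<open>The curve from time 0 to 1 runs through the geodesic at speed factor \<open>a\<close>,
  so its velocity is \<open>a *\<^sub>R \<zeta> s\<close>. The field is defined by
  \<open>geo_vel\<close> rather than by dividing this velocity by \<open>a\<close>, which also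
  covers \<open>a = 0\<close>.\<close>

lemma parallel_transl_eq:
  assumes a: "0 \<le> a"
  shows "parallel_transl nabla p (a *\<^sub>R \<xi>) \<xi> = geo_vel p \<xi> a"
proof -
  let ?\<Omega> = "brk \<xi> (embed p)" and ?I = "{0..1::real}"
  define c where "c s = mexp nabla p (s *\<^sub>R (a *\<^sub>R \<xi>))" for s
  have c_eq: "c s = mexp nabla p ((s * a) *\<^sub>R \<xi>)" for s by (simp add: c_def)
  define \<zeta> where "\<zeta> s = geo_vel p \<xi> (s * a)" for s
  have \<zeta>_eq: "\<zeta> s = brk ?\<Omega> (embed (c s))" for s by (simp add: \<zeta>_def geo_vel_def c_eq)
  have nb: "at s within ?I \<noteq> bot" if "s \<in> ?I" for s using that by (intro at_within_Icc_neq_bot) auto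
  have sub: "(\<lambda>s. s * a) ` ?I \<subseteq> {0..a}" using a by (auto intro: mult_left_le_one_le)
  have lin: "((\<lambda>s. s * a) has_vector_derivative a) (at s within ?I)" for s
    by (auto intro!: derivative_eq_intros)
  have in_a: "s * a \<in> {0..a}" if "s \<in> ?I" for s using sub that by blast
  have c': "((\<lambda>s. embed (c s)) has_vector_derivative a *\<^sub>R \<zeta> s) (at s within ?I)" if "s \<in> ?I" for s
    using vector_diff_chain_within[OF lin has_vector_derivative_within_subset[OF mexp_has_velocity[OF in_a[OF that]] sub]]
    by (simp add: o_def c_eq \<zeta>_def)
  have \<zeta>': "(\<zeta> has_vector_derivative a *\<^sub>R brk ?\<Omega> (\<zeta> s)) (at s within ?I)" if "s \<in> ?I" for s
    using vector_diff_chain_within[OF lin has_vector_derivative_within_subset[OF geo_vel_deriv[OF in_a[OF that]] sub]]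
    by (simp add: o_def \<zeta>_def[abs_def])
  have pos: "0 \<le> s * a" if "s \<in> ?I" for s using that a by simp
  have tan: "\<zeta> s \<in> tangent (c s)" if "s \<in> ?I" for s
    using geo_vel_tangent[OF pos[OF that]] by (simp add: c_eq \<zeta>_def)
  have normal: "tproj2 (embed (c s)) (a *\<^sub>R brk ?\<Omega> (\<zeta> s)) = 0" if "s \<in> ?I" for s
  proof -
    interpret bounded_linear "tproj2 (embed (c s))" by (rule bounded_linear_tproj2)
    show ?thesis using geo_vel_normal[OF pos[OF that]] unfolding scaleR by (simp add: c_eq \<zeta>_def)
  qed
  have cov: "has_covariant_deriv nabla ?I c \<zeta> 0 s" if "s \<in> ?I" for s
    using has_covariant_derivI[OF c'[OF that] that nb[OF that] \<zeta>'[OF that] tan] normal[OF that] by simp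
  show ?thesis
    unfolding parallel_transl_def c_def[symmetric]
  proof (rule the_equality)
    show "\<exists>\<zeta>. (\<forall>t\<in>?I. \<zeta> t \<in> tangent (c t) \<and> has_covariant_deriv nabla ?I c \<zeta> 0 t) \<and> \<zeta> 0 = \<xi> \<and> \<zeta> 1 = geo_vel p \<xi> a"
      using tan cov by (intro exI[of _ \<zeta>]) (simp add: \<zeta>_def geo_vel_0)
    fix v assume "\<exists>\<zeta>. (\<forall>t\<in>?I. \<zeta> t \<in> tangent (c t) \<and> has_covariant_deriv nabla ?I c \<zeta> 0 t) \<and> \<zeta> 0 = \<xi> \<and> \<zeta> 1 = v"
    then obtain \<omega> where \<omega>: "\<And>t. t \<in> ?I \<Longrightarrow> \<omega> t \<in> tangent (c t)"
      "\<And>t. t \<in> ?I \<Longrightarrow> has_covariant_deriv nabla ?I c \<omega> 0 t" "\<omega> 0 = \<xi>" "\<omega> 1 = v" by blast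
    have "\<exists>\<omega>'. \<forall>t\<in>?I. (\<omega> has_vector_derivative \<omega>' t) (at t within ?I) \<and> 0 = tproj2 (embed (c t)) (\<omega>' t)"
    proof (rule bchoice, rule ballI)
      fix t assume t: "t \<in> ?I"
      from has_covariant_derivD[OF \<omega>(2)[OF t] c'[OF t] t nb[OF t]]
      show "\<exists>y. (\<omega> has_vector_derivative y) (at t within ?I) \<and> 0 = tproj2 (embed (c t)) y" by metis
    qed
    then obtain \<omega>' where \<omega>': "\<And>t. t \<in> ?I \<Longrightarrow> (\<omega> has_vector_derivative \<omega>' t) (at t within ?I)"
      "\<And>t. t \<in> ?I \<Longrightarrow> tproj2 (embed (c t)) (\<omega>' t) = 0" by metis
    \<comment> \<open>Uniqueness: the difference of two parallel fields has a normal derivative,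
      hence constant norm, and it starts at 0.\<close>
    have "norm (\<omega> 1 - \<zeta> 1) = norm (\<omega> 0 - \<zeta> 0)"
    proof (rule norm_const_of_normal_deriv[where \<gamma> = c and u = "\<lambda>t. \<omega> t - \<zeta> t" and b = 1])
      fix t :: real assume t: "t \<in> ?I"
      interpret bounded_linear "tproj2 (embed (c t))" by (rule bounded_linear_tproj2)
      show "((\<lambda>t. \<omega> t - \<zeta> t) has_vector_derivative \<omega>' t - a *\<^sub>R brk ?\<Omega> (\<zeta> t)) (at t within ?I)"
        by (intro has_vector_derivative_diff \<omega>'(1) \<zeta>' t)
      show "tproj2 (embed (c t)) (\<omega>' t - a *\<^sub>R brk ?\<Omega> (\<zeta> t)) = 0"
        using \<omega>'(2)[OF t] normal[OF t] by (simp add: diff)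
      show "\<omega> t - \<zeta> t \<in> tangent (c t)"
        using subspace_diff[OF subspace_tangent \<omega>(1)[OF t] tan[OF t]] .
    qed simp
    then show "v = geo_vel p \<xi> a" using \<omega>(3,4) by (simp add: \<zeta>_def geo_vel_0)
  qed
qed

text \<open>The formula by rotated frames is differentiable on the whole matrix space but represents
  \<open>mexp\<close> only for tangent matrices, so differentiability is claimed within the tangent
  space.\<close>

lemma mexp_comp_differentiable:
  assumes F: "C_k_near (Suc k) (mexp nabla p \<xi>) F"
  obtains D where "((\<lambda>\<zeta>. F (mexp nabla p \<zeta>)) has_derivative D) (at \<xi> within tangent p)"
proof -
  obtain z where z: "z \<in> frame_pairs" "range_of2 z = p" by (rule frames_ex)
  let ?F = "\<lambda>z. F (range_of2 z)" and ?w = "geo_frames \<xi> z"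
  have \<xi>': "\<xi> \<in> tangent (range_of2 z)" using z \<xi> by simp
  have w: "?w \<in> frame_pairs" using geo_frames_full[OF z(1) \<xi>', of 1] by simp
  have "mexp nabla p \<xi> = range_of2 ?w" using mexp_eq[OF z(1) \<xi>'] z(2) by simp
  then have F': "(?F has_derivative frechet_derivative ?F (at ?w)) (at ?w)"
    using C_k_near_has_derivative[of k ?w F] F w by simp
  obtain R where "(rot has_derivative R) (at (brk \<xi> (pr2 z)))" by (rule rot_differentiable)
  from has_derivative_compose[OF bounded_linear.has_derivative[OF bounded_bilinear.bounded_linear_left[OF bounded_bilinear_brk] has_derivative_ident] this]
  have "((\<lambda>\<zeta>. geo_frames \<zeta> z) has_derivative (\<lambda>h. act (R (brk h (pr2 z))) z)) (at \<xi>)"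
    unfolding geo_frames_def by (rule bounded_linear.has_derivative[OF bounded_bilinear.bounded_linear_left[OF bounded_bilinear_act]])
  from has_derivative_compose[OF this F']
  have "((\<lambda>\<zeta>. ?F (geo_frames \<zeta> z)) has_derivative (\<lambda>h. frechet_derivative ?F (at ?w) (act (R (brk h (pr2 z))) z))) (at \<xi> within tangent p)"
    by (rule has_derivative_at_withinI)
  then have "((\<lambda>\<zeta>. F (mexp nabla p \<zeta>)) has_derivative (\<lambda>h. frechet_derivative ?F (at ?w) (act (R (brk h (pr2 z))) z))) (at \<xi> within tangent p)"
    by (rule has_derivative_transform[OF \<xi>, rotated]) (use mexp_eq[OF z(1)] z(2) in simp)
  then show thesis by (rule that)
qed

end

text \<open>The curve calculus gives the value within an interval to the right of 0;
  differentiability of the exponential map gives a two-sided derivative, which must have the same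
  value. At \<open>a = 0\<close> this is the slope that the Wolfe conditions refer to.\<close>

lemma mexp_comp_has_vector_derivative:
  assumes \<xi>: "\<xi> \<in> tangent p" and a: "0 \<le> a" and F: "C_k_near (Suc k) (mexp nabla p (a *\<^sub>R \<xi>)) F"
  shows "((\<lambda>a. F (mexp nabla p (a *\<^sub>R \<xi>))) has_vector_derivative
      mderiv F (mexp nabla p (a *\<^sub>R \<xi>)) (geo_vel p \<xi> a)) (at a)"
proof -
  have in_I: "a \<in> {0..a + 1}" using a by simp
  have one: "((\<lambda>a. F (mexp nabla p (a *\<^sub>R \<xi>))) has_vector_derivative
      mderiv F (mexp nabla p (a *\<^sub>R \<xi>)) (geo_vel p \<xi> a)) (at a within {0..a + 1})"
    by (rule mderiv_along_curve[OF F mexp_has_velocity[OF \<xi> in_I] in_I geo_vel_tangent[OF \<xi> a]])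
  have a\<xi>: "a *\<^sub>R \<xi> \<in> tangent p" by (rule subspace_scale[OF subspace_tangent \<xi>])
  obtain D where D: "((\<lambda>\<zeta>. F (mexp nabla p \<zeta>)) has_derivative D) (at (a *\<^sub>R \<xi>) within tangent p)"
    using mexp_comp_differentiable[OF a\<xi> F] .
  interpret bounded_linear D using D by (rule has_derivative_bounded_linear)
  have "((\<lambda>\<zeta>. F (mexp nabla p \<zeta>)) has_derivative D) (at (a *\<^sub>R \<xi>) within range (\<lambda>a. a *\<^sub>R \<xi>))"
    by (rule has_derivative_subset[OF D]) (auto intro: subspace_scale[OF subspace_tangent \<xi>])
  moreover have "((\<lambda>a. a *\<^sub>R \<xi>) has_derivative (\<lambda>h. h *\<^sub>R \<xi>)) (at a)"
    by (auto intro!: derivative_eq_intros)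
  ultimately have "((\<lambda>a. F (mexp nabla p (a *\<^sub>R \<xi>))) has_derivative (\<lambda>h. D (h *\<^sub>R \<xi>))) (at a)"
    by (rule has_derivative_in_compose[where f = "\<lambda>a. a *\<^sub>R \<xi>" and g = "\<lambda>\<zeta>. F (mexp nabla p \<zeta>)", rotated])
  then have two: "((\<lambda>a. F (mexp nabla p (a *\<^sub>R \<xi>))) has_vector_derivative D \<xi>) (at a)"
    by (simp add: has_vector_derivative_def scaleR)
  have "at a within {0..a + 1} \<noteq> bot" using in_I by (intro at_within_Icc_neq_bot) auto
  then have "D \<xi> = mderiv F (mexp nabla p (a *\<^sub>R \<xi>)) (geo_vel p \<xi> a)"
    using vector_derivative_unique_within one has_vector_derivative_at_within[OF two] by blast
  then show ?thesis using two by simp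
qed

lemma frechet_derivative_mexp:
  assumes \<xi>: "\<xi> \<in> tangent p" and a: "0 \<le> a" and F: "C_k_near (Suc k) (mexp nabla p (a *\<^sub>R \<xi>)) F"
  shows "frechet_derivative (F \<circ> mexp nabla p) (at (a *\<^sub>R \<xi>) within tangent p) \<xi> =
    mderiv F (mexp nabla p (a *\<^sub>R \<xi>)) (geo_vel p \<xi> a)"
proof -
  have a\<xi>: "a *\<^sub>R \<xi> \<in> tangent p" by (rule subspace_scale[OF subspace_tangent \<xi>])
  obtain D where D: "((\<lambda>\<zeta>. F (mexp nabla p \<zeta>)) has_derivative D) (at (a *\<^sub>R \<xi>) within tangent p)"
    using mexp_comp_differentiable[OF a\<xi> F] .
  have "((\<lambda>t. a + t) has_vector_derivative 1) (at 0)" by (auto intro!: derivative_eq_intros)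
  from vector_diff_chain_at[OF this, of "\<lambda>a. F (mexp nabla p (a *\<^sub>R \<xi>))"] mexp_comp_has_vector_derivative[OF assms]
  have "((\<lambda>t. F (mexp nabla p (a *\<^sub>R \<xi> + t *\<^sub>R \<xi>))) has_vector_derivative mderiv F (mexp nabla p (a *\<^sub>R \<xi>)) (geo_vel p \<xi> a)) (at 0)"
    by (simp add: o_def scaleR_add_left)
  with frechet_derivative_within_subspace[OF subspace_tangent a\<xi> \<xi>, of "F \<circ> mexp nabla p" D] D
  show ?thesis by (simp add: o_def)
qed

section \<open>Gradient and Hessian\<close>

text \<open>The sum over the basis represents the differential with respect to the Frobenius
  product, projection makes it tangent, and the factor 2 compensates for the metric being half that
  product.\<close>

lemma grad_eq:
  fixes J :: "('n, 'r) pt \<Rightarrow> real"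
  assumes J: "C_k_near (Suc k) p J" and z: "z \<in> frame_pairs" "range_of2 z = p"
  defines "DJ \<equiv> frechet_derivative (\<lambda>z. J (range_of2 z)) (at z)"
  shows "grad J p = 2 *\<^sub>R tproj2 (embed p) (\<Sum>b\<in>Basis. DJ (act b z) *\<^sub>R b)"
    and "grad J p \<in> tangent p"
    and "\<zeta> \<in> tangent p \<Longrightarrow> metric p (grad J p) \<zeta> = mderiv J p \<zeta>"
proof -
  let ?X = "2 *\<^sub>R tproj2 (embed p) (\<Sum>b\<in>Basis. DJ (act b z) *\<^sub>R b)"
  have X: "?X \<in> tangent p" by (intro subspace_scale[OF subspace_tangent] tproj2_in)
  have lin: "linear (\<lambda>\<zeta>. DJ (act \<zeta> z))"
  proof -
    have "bounded_linear DJ"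
      using C_k_near_has_derivative[of k z J] J z unfolding DJ_def by (auto intro: has_derivative_bounded_linear)
    from bounded_linear_compose[OF this bounded_bilinear.bounded_linear_left[OF bounded_bilinear_act]]
    show ?thesis by (rule bounded_linear.linear)
  qed
  have m: "metric p ?X \<zeta> = mderiv J p \<zeta>" if \<zeta>: "\<zeta> \<in> tangent p" for \<zeta>
  proof -
    have "metric p ?X \<zeta> = \<zeta> \<bullet> (\<Sum>b\<in>Basis. DJ (act b z) *\<^sub>R b)"
      using metric_eq[OF X \<zeta>] inner_tproj2[OF \<zeta>] by (simp add: inner_commute)
    also have "\<dots> = (\<Sum>b\<in>Basis. (\<zeta> \<bullet> b) *\<^sub>R DJ (act b z))"
      by (simp add: inner_sum_right mult.commute)
    also have "\<dots> = DJ (act (\<Sum>b\<in>Basis. (\<zeta> \<bullet> b) *\<^sub>R b) z)"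
      by (simp only: linear_sum[OF lin] linear_scale[OF lin])
    also have "\<dots> = mderiv J p \<zeta>"
      using mderiv_frechet[of k z J \<zeta>] J z \<zeta> by (simp add: euclidean_representation DJ_def)
    finally show ?thesis .
  qed
  have "grad J p = ?X"
    unfolding grad_def
  proof (rule the_equality)
    show "?X \<in> tangent p \<and> (\<forall>\<zeta>\<in>tangent p. metric p ?X \<zeta> = mderiv J p \<zeta>)" using X m by blast
    fix \<xi> assume \<xi>: "\<xi> \<in> tangent p \<and> (\<forall>\<zeta>\<in>tangent p. metric p \<xi> \<zeta> = mderiv J p \<zeta>)"
    then have d: "\<xi> - ?X \<in> tangent p" using X subspace_diff[OF subspace_tangent] by blast
    have "metric p \<xi> (\<xi> - ?X) = metric p ?X (\<xi> - ?X)" using \<xi> m[OF d] d by simp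
    then have "(\<xi> - ?X) \<bullet> (\<xi> - ?X) = 0"
      using metric_eq[OF _ d] \<xi> X by (simp add: inner_diff_left)
    then show "\<xi> = ?X" by simp
  qed
  then show "grad J p = ?X" "grad J p \<in> tangent p" "\<zeta> \<in> tangent p \<Longrightarrow> metric p (grad J p) \<zeta> = mderiv J p \<zeta>"
    using X m by simp_all
qed

lemma C_k_near_open:
  assumes "C_k_near k (p :: ('n, 'r) pt) F"
  obtains U where "open U" "p \<in> U" "\<And>q. q \<in> U \<Longrightarrow> C_k_near k q F"
    "C_k k {z \<in> frame_pairs. range_of2 z \<in> U} (\<lambda>z. F (range_of2 z))"
proof -
  obtain U where U: "open U" "p \<in> U" "C_k k {z \<in> frame_pairs. range_of2 z \<in> U} (\<lambda>z. F (range_of2 z))"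
    using assms unfolding C_k_near_def by blast
  then show thesis using that[of U] unfolding C_k_near_def by blast
qed

text \<open>In the closed form of the gradient the frame \<open>z\<close> itself is taken as the
  variable. The formula contains first derivatives of \<open>J\<close> and smooth functions of
  \<open>z\<close>, so one order of regularity is lost.\<close>

lemma C1_field_grad:
  fixes J :: "('n, 'r) pt \<Rightarrow> real"
  assumes J: "C_k_near 2 p J"
  shows "C1_field_near p (grad J)"
proof -
  obtain U where U: "open U" "p \<in> U" "\<And>q. q \<in> U \<Longrightarrow> C_k_near 2 q J"
    and C2: "C_k 2 {z \<in> frame_pairs. range_of2 z \<in> U} (\<lambda>z. J (range_of2 z))"
    by (rule C_k_near_open[OF J]) (rule that)
  let ?S = "{z \<in> frame_pairs. range_of2 z \<in> U}" and ?J = "\<lambda>z :: ('n, 'r) frames. J (range_of2 z)"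
  have S: "open ?S" using U(1) by (rule open_preimage_range_of2)
  have J2: "C_k_near (Suc 1) q J" if "q \<in> U" for q using U(3)[OF that] by (simp only: numeral_2_eq_2 One_nat_def)
  have C2': "C_k (Suc 1) ?S ?J" using C2 by (simp only: numeral_2_eq_2 One_nat_def)
  have "C_k 1 ?S (\<lambda>z. 2 *\<^sub>R tproj2 (pr2 z) (\<Sum>b\<in>Basis. frechet_derivative ?J (at z) (act b z) *\<^sub>R b))"
    by (intro C_dirs_scaleR[OF C_dirs_const] C_dirs_tproj2 C_dirs_subset[OF C_k_pr2] C_dirs_sum
        C_dirs_scaleR[OF _ C_dirs_const] C_k_frechet_derivative_apply[OF C2' S] C_dirs_bounded_linear
        bounded_bilinear.bounded_linear_right[OF bounded_bilinear_act]) auto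
  then have C1: "C_k 1 ?S (\<lambda>z. grad J (range_of2 z))"
  proof (rule C_dirs_cong[OF S, rotated])
    fix z assume "z \<in> ?S"
    then show "2 *\<^sub>R tproj2 (pr2 z) (\<Sum>b\<in>Basis. frechet_derivative ?J (at z) (act b z) *\<^sub>R b) = grad J (range_of2 z)"
      using grad_eq(1)[OF J2, of "range_of2 z" z] by (simp add: embed_range_of2)
  qed
  have "grad J q \<in> tangent q" if "q \<in> U" for q
  proof -
    obtain z where "z \<in> frame_pairs" "range_of2 z = q" by (rule frames_ex)
    then show ?thesis using grad_eq(2)[OF J2[OF that]] by blast
  qed
  with C1 U show ?thesis unfolding C1_field_near_def C_k_near_def by blast
qed

section \<open>Compactness and the bound on the Hessian\<close>

lemma continuous_at_frames:
  fixes w :: "('n, 'r) frames"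
  assumes "C_k_near k (range_of2 w) F" "w \<in> frame_pairs"
  shows "isCont (\<lambda>z. F (range_of2 z)) w"
proof -
  obtain S where "open S" "w \<in> S" "S \<subseteq> frame_pairs" "C_k k S (\<lambda>z. F (range_of2 z))"
    by (rule C_k_nearE[OF assms]) (rule that)
  then show ?thesis
    using C_dirs_imp_continuous_on continuous_on_eq_continuous_at by blast
qed

text \<open>A set of frames that lies over \<open>K\<close> and covers it, compact when
  \<open>K\<close> is. Extremal values over \<open>K\<close> are taken here, because regularity on
  the manifold is defined through frames.\<close>

definition orthonormal_over :: "('n, 'r) pt set \<Rightarrow> ('n, 'r) frames set" where
  "orthonormal_over K = {w. transpose (fst w) ** fst w = mat 1 \<and> transpose (snd w) ** snd w = mat 1 \<and> range_of2 w \<in> K}"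

lemma orthonormal_over_full: "w \<in> orthonormal_over K \<Longrightarrow> w \<in> frame_pairs"
  by (simp add: orthonormal_over_def mem_Times_iff full_rank_iff_det)

lemma orthonormal_over_ex:
  assumes "p \<in> K"
  obtains w where "w \<in> orthonormal_over K" "range_of2 w = p"
proof -
  obtain \<Phi> \<Psi> :: "real ^ 'r ^ 'n" where "transpose \<Phi> ** \<Phi> = mat 1" "range_of \<Phi> = fst p"
    "transpose \<Psi> ** \<Psi> = mat 1" "range_of \<Psi> = snd p"
    using orthonormal_frame[OF le] by metis
  then show thesis using assms by (intro that[of "(\<Phi>, \<Psi>)"]) (auto simp: orthonormal_over_def range_of2_def)
qed

lemma compact_orthonormal_over:
  assumes K: "compact K"
  shows "compact (orthonormal_over K)"
proof -
  let ?O = "{w :: ('n, 'r) frames. transpose (fst w) ** fst w = mat 1 \<and> transpose (snd w) ** snd w = mat 1}"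
  have "C_k 0 UNIV (\<lambda>w :: ('n, 'r) frames. transpose (fst w) ** fst w)"
    "C_k 0 UNIV (\<lambda>w :: ('n, 'r) frames. transpose (snd w) ** snd w)"
    by (intro C_dirs_matmul C_dirs_transpose C_dirs_bounded_linear bounded_linear_fst bounded_linear_snd)+
  then have clO: "closed ?O"
    by (intro closed_Collect_conj closed_Collect_eq continuous_on_const) simp_all
  have "norm w \<le> sqrt (trace (mat 1 :: real ^ 'r ^ 'r) + trace (mat 1 :: real ^ 'r ^ 'r))" if "w \<in> ?O" for w
    using that by (cases w) (simp add: norm_Pair power2_norm_eq_inner inner_matrix_trace)
  then have "bounded ?O" unfolding bounded_iff by blast
  then have O: "compact ?O" using clO by (simp add: compact_eq_bounded_closed)
  have full: "w \<in> frame_pairs" if "w \<in> ?O" for w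
    using that by (simp add: mem_Times_iff full_rank_iff_det)
  have "compact (embed ` K)"
    using K continuous_on_subset[OF continuous_on_embed] by (intro compact_continuous_image) auto
  then have "closed (?O \<inter> pr2 -` (embed ` K))"
    using full by (intro continuous_closed_preimage continuous_on_subset[OF C_dirs_imp_continuous_on[OF C_k_pr2]] clO)
      (auto intro: compact_imp_closed)
  moreover have "orthonormal_over K = ?O \<inter> (?O \<inter> pr2 -` (embed ` K))"
    using full by (auto simp: orthonormal_over_def embed_inject simp flip: embed_range_of2)
  ultimately show ?thesis by (simp only: compact_Int_closed[OF O])
qed

text \<open>Tangency is the closed condition of being fixed by the projection \<open>tproj2\<close>.
  The radius is \<open>sqrt 2\<close>, because \<open>tnorm\<close> is the Frobenius norm divided by
  \<open>sqrt 2\<close>.\<close>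

lemma compact_unit_tangents:
  assumes K: "compact K"
  shows "compact {x. fst x \<in> orthonormal_over K \<and> snd x \<in> tangent (range_of2 (fst x)) \<and> norm (snd x) = sqrt 2}"
proof -
  let ?C = "orthonormal_over K \<times> sphere (0 :: 'n tvec) (sqrt 2)"
  have C: "compact ?C" by (intro compact_Times compact_orthonormal_over K) simp
  have "continuous_on ?C (\<lambda>x. pr2 (fst x))"
    by (rule continuous_on_compose2[OF C_dirs_imp_continuous_on[OF C_k_pr2] continuous_on_fst[OF continuous_on_id]])
      (auto dest: orthonormal_over_full)
  then have "C_k 0 ?C (\<lambda>x. pr2 (fst x))" "C_k 0 ?C snd"
    by (auto intro: continuous_intros)
  from C_dirs_tproj2[OF this] have "continuous_on ?C (\<lambda>x. tproj2 (pr2 (fst x)) (snd x) - snd x)"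
    by (auto intro!: continuous_intros)
  then have "closed (?C \<inter> (\<lambda>x. tproj2 (pr2 (fst x)) (snd x) - snd x) -` {0})"
    using C by (intro continuous_closed_preimage compact_imp_closed) auto
  moreover have "{x. fst x \<in> orthonormal_over K \<and> snd x \<in> tangent (range_of2 (fst x)) \<and> norm (snd x) = sqrt 2}
      = ?C \<inter> (?C \<inter> (\<lambda>x. tproj2 (pr2 (fst x)) (snd x) - snd x) -` {0})"
  proof -
    have "\<xi> \<in> tangent (range_of2 w) \<longleftrightarrow> tproj2 (pr2 w) \<xi> = \<xi>" if "w \<in> orthonormal_over K" for w \<xi>
      using tproj2_id[of \<xi> "range_of2 w"] tproj2_in[of "range_of2 w" \<xi>] embed_range_of2[OF orthonormal_over_full[OF that]]
      by auto
    then show ?thesis by auto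
  qed
  ultimately show ?thesis by (simp only: compact_Int_closed[OF C])
qed

lemma tnorm_eq_1: "\<xi> \<in> tangent p \<Longrightarrow> tnorm p \<xi> = 1 \<longleftrightarrow> norm \<xi> = sqrt 2" for p :: "('n, 'r) pt"
  by (auto simp: tnorm_eq)

text \<open>The set of Hessian norms is the image of a compact set of orthonormal frames with unit
  tangent vectors under a continuous function. The nonzero \<open>\<xi>0\<close> ensures that this
  set is nonempty.\<close>

lemma hess_norms_max:
  fixes J :: "('n, 'r) pt \<Rightarrow> real"
  assumes K: "compact K" and J: "\<And>p. p \<in> K \<Longrightarrow> C_k_near 2 p J"
    and ne: "p0 \<in> K" "\<xi>0 \<in> tangent p0" "\<xi>0 \<noteq> 0"
  shows "\<exists>L\<in>hess_norms nabla J K. \<forall>s\<in>hess_norms nabla J K. s \<le> L"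
proof -
  let ?Q = "{x. fst x \<in> orthonormal_over K \<and> snd x \<in> tangent (range_of2 (fst x)) \<and> norm (snd x) = sqrt 2}"
  let ?G = "\<lambda>z :: ('n, 'r) frames. grad J (range_of2 z)"
  define N where "N x = tproj2 (pr2 (fst x)) (frechet_derivative ?G (at (fst x)) (act (snd x) (fst x)))" for x
  have field: "C1_field_near (range_of2 w) (grad J)" if "w \<in> orthonormal_over K" for w
    using that J by (intro C1_field_grad) (auto simp: orthonormal_over_def)
  have N: "tnorm (range_of2 (fst x)) (nabla (range_of2 (fst x)) (snd x) (grad J)) = norm (N x) / sqrt 2" if "x \<in> ?Q" for x
  proof -
    have x: "fst x \<in> frame_pairs" "snd x \<in> tangent (range_of2 (fst x))" using that orthonormal_over_full[of "fst x" K] by auto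
    note f = field[of "fst x"]
    have "nabla (range_of2 (fst x)) (snd x) (grad J) = N x"
      using nabla_eq[OF x(2) f] mderiv_frechet[OF C1_field_nearD(1)[OF f] x] that x
      by (simp add: N_def embed_range_of2)
    then show ?thesis using tnorm_eq[OF nabla_tangent[OF x(2) f]] that by simp
  qed
  have "isCont N x" if x: "x \<in> ?Q" for x
  proof -
    have w: "fst x \<in> frame_pairs" using x orthonormal_over_full[of "fst x" K] by auto
    obtain S where S: "open S" "fst x \<in> S" "S \<subseteq> frame_pairs" "C_k (Suc 0) S ?G"
      by (rule C_k_nearE[OF C1_field_nearD(1)[OF field] w]) (use x that in auto)
    let ?T = "S \<times> (UNIV :: 'n tvec set)"
    have "continuous_on ?T (\<lambda>x. pr2 (fst x))"
      by (rule continuous_on_compose2[OF C_dirs_imp_continuous_on[OF C_k_pr2] continuous_on_fst[OF continuous_on_id]])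
        (use S(3) in auto)
    \<comment> \<open>Base point and direction vary together; expanding the direction in the basis
      leaves derivatives in fixed directions, which are continuous in the base point.\<close>
    moreover have "continuous_on ?T (\<lambda>x. frechet_derivative ?G (at (fst x)) (act (snd x) (fst x)))"
    proof -
      have "continuous_on ?T (\<lambda>x. \<Sum>b\<in>Basis. (act (snd x) (fst x) \<bullet> b) *\<^sub>R frechet_derivative ?G (at (fst x)) b)"
        by (intro continuous_intros bounded_bilinear.continuous_on[OF bounded_bilinear_act]
            continuous_on_compose2[OF C_dirs_imp_continuous_on[OF C_k_Suc_frechet_derivative(2)[OF S(4,1)]]]) auto
      then show ?thesis
      proof (rule continuous_on_eq)
        fix x assume "x \<in> ?T"
        then have "fst x \<in> S" by auto
        then interpret bounded_linear "frechet_derivative ?G (at (fst x))"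
          by (rule has_derivative_bounded_linear[OF C_k_Suc_frechet_derivative(1)[OF S(4,1)]])
        have "frechet_derivative ?G (at (fst x)) (\<Sum>b\<in>Basis. (act (snd x) (fst x) \<bullet> b) *\<^sub>R b)
          = (\<Sum>b\<in>Basis. (act (snd x) (fst x) \<bullet> b) *\<^sub>R frechet_derivative ?G (at (fst x)) b)"
          by (simp only: sum scaleR)
        then show "(\<Sum>b\<in>Basis. (act (snd x) (fst x) \<bullet> b) *\<^sub>R frechet_derivative ?G (at (fst x)) b) =
          frechet_derivative ?G (at (fst x)) (act (snd x) (fst x))"
          by (simp only: euclidean_representation)
      qed
    qed
    ultimately have "C_k 0 ?T N"
      unfolding N_def[abs_def] by (intro C_dirs_tproj2) simp_all
    then have "continuous_on ?T N" by simp
    moreover have "open ?T" using S(1) by (intro open_Times) auto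
    moreover have "x \<in> ?T" using S(2) by (simp add: mem_Times_iff)
    ultimately show ?thesis using continuous_on_eq_continuous_at by blast
  qed
  then have "continuous_on ?Q N" by (intro continuous_at_imp_continuous_on) blast
  then have "continuous_on ?Q (\<lambda>x. norm (N x) / sqrt 2)" by (intro continuous_intros) auto
  moreover have "?Q \<noteq> {}"
  proof -
    obtain w where w: "w \<in> orthonormal_over K" "range_of2 w = p0" using orthonormal_over_ex[OF ne(1)] .
    have "(w, (sqrt 2 / norm \<xi>0) *\<^sub>R \<xi>0) \<in> ?Q"
      using w ne by (simp add: subspace_scale[OF subspace_tangent])
    then show ?thesis by blast
  qed
  ultimately have "\<exists>x\<in>?Q. \<forall>y\<in>?Q. norm (N y) / sqrt 2 \<le> norm (N x) / sqrt 2"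
    by (intro continuous_attains_sup compact_unit_tangents K)
  then obtain x where x: "x \<in> ?Q" "\<forall>y\<in>?Q. norm (N y) / sqrt 2 \<le> norm (N x) / sqrt 2"
    by (rule bexE)
  have eq: "hess_norms nabla J K = (\<lambda>x. norm (N x) / sqrt 2) ` ?Q"
  proof (intro set_eqI iffI)
    fix s assume "s \<in> hess_norms nabla J K"
    then obtain p \<xi> where p: "s = tnorm p (nabla p \<xi> (grad J))" "p \<in> K" "\<xi> \<in> tangent p" "tnorm p \<xi> = 1"
      unfolding hess_norms_def by blast
    obtain w where w: "w \<in> orthonormal_over K" "range_of2 w = p" using orthonormal_over_ex[OF p(2)] .
    have "(w, \<xi>) \<in> ?Q" using p w by (simp add: tnorm_eq_1)
    moreover from N[OF this] have "s = norm (N (w, \<xi>)) / sqrt 2" using p(1) w(2) by simp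
    ultimately show "s \<in> (\<lambda>x. norm (N x) / sqrt 2) ` ?Q" by (rule rev_image_eqI)
  next
    fix s assume "s \<in> (\<lambda>x. norm (N x) / sqrt 2) ` ?Q"
    then obtain x where x: "x \<in> ?Q" "s = norm (N x) / sqrt 2" by blast
    then have "s = tnorm (range_of2 (fst x)) (nabla (range_of2 (fst x)) (snd x) (grad J))" using N by simp
    moreover have "range_of2 (fst x) \<in> K" "snd x \<in> tangent (range_of2 (fst x))" "tnorm (range_of2 (fst x)) (snd x) = 1"
      using x(1) by (auto simp: orthonormal_over_def tnorm_eq_1)
    ultimately show "s \<in> hess_norms nabla J K" unfolding hess_norms_def by blast
  qed
  show ?thesis
    unfolding eq
  proof (intro bexI[of _ "norm (N x) / sqrt 2"] ballI)
    show "norm (N x) / sqrt 2 \<in> (\<lambda>x. norm (N x) / sqrt 2) ` ?Q" using x(1) by (rule imageI)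
    fix s assume "s \<in> (\<lambda>x. norm (N x) / sqrt 2) ` ?Q"
    then obtain y where y: "s = norm (N y) / sqrt 2" "y \<in> ?Q" by (rule imageE)
    show "s \<le> norm (N x) / sqrt 2" unfolding y(1) using y(2) by (rule bspec[OF x(2)])
  qed
qed

lemma C_k_near_bounded_below:
  fixes J :: "('n, 'r) pt \<Rightarrow> real"
  assumes K: "compact K" and J: "\<And>p. p \<in> K \<Longrightarrow> C_k_near k p J"
  obtains B where "\<And>p. p \<in> K \<Longrightarrow> B \<le> J p"
proof -
  have "continuous_on (orthonormal_over K) (\<lambda>w. J (range_of2 w))"
  proof (intro continuous_at_imp_continuous_on ballI)
    fix w assume "w \<in> orthonormal_over K"
    then show "isCont (\<lambda>w. J (range_of2 w)) w"
      using J orthonormal_over_full[of w K]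
      by (intro continuous_at_frames[where k = k]) (simp_all add: orthonormal_over_def)
  qed
  from compact_imp_bounded[OF compact_continuous_image[OF this compact_orthonormal_over[OF K]]]
  obtain B where B: "\<And>w. w \<in> orthonormal_over K \<Longrightarrow> \<bar>J (range_of2 w)\<bar> \<le> B"
    by (auto simp: bounded_iff)
  have "- B \<le> J p" if "p \<in> K" for p
  proof -
    obtain w where "w \<in> orthonormal_over K" "range_of2 w = p" using orthonormal_over_ex[OF \<open>p \<in> K\<close>] .
    then show ?thesis using B[of w] by auto
  qed
  then show thesis by (rule that)
qed

text \<open>The slope is half the product of gradient and velocity. The velocity has a normal
  derivative, so only the gradient contributes to the derivative of the slope, and against the
  tangent velocity only its covariant part \<open>h t\<close> counts. The mean value inequality
  finishes.\<close>

lemma gradient_lipschitz_along_geodesic: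
  fixes J :: "('n, 'r) pt \<Rightarrow> real"
  assumes J: "\<And>p. p \<in> K \<Longrightarrow> C_k_near 2 p J"
    and L: "\<And>s. s \<in> hess_norms nabla J K \<Longrightarrow> s \<le> L"
    and \<xi>: "\<xi> \<in> tangent p" and a: "0 \<le> a" and K: "\<And>t. t \<in> {0..a} \<Longrightarrow> mexp nabla p (t *\<^sub>R \<xi>) \<in> K"
  shows "\<bar>mderiv J (mexp nabla p (a *\<^sub>R \<xi>)) (geo_vel p \<xi> a) - mderiv J p \<xi>\<bar> \<le> L * a * (tnorm p \<xi>)\<^sup>2"
proof -
  let ?\<gamma> = "\<lambda>t. mexp nabla p (t *\<^sub>R \<xi>)" and ?V = "geo_vel p \<xi>" and ?G = "\<lambda>t. grad J (mexp nabla p (t *\<^sub>R \<xi>))"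
  have J2: "C_k_near (Suc 1) q J" if "q \<in> K" for q using J[OF that] by (simp only: numeral_2_eq_2 One_nat_def)
  have grad: "grad J q \<in> tangent q" "\<And>\<zeta>. \<zeta> \<in> tangent q \<Longrightarrow> metric q (grad J q) \<zeta> = mderiv J q \<zeta>" if "q \<in> K" for q
  proof -
    obtain z where z: "z \<in> frame_pairs" "range_of2 z = q" by (rule frames_ex)
    show "grad J q \<in> tangent q" by (rule grad_eq(2)[OF J2[OF that] z])
    show "\<And>\<zeta>. \<zeta> \<in> tangent q \<Longrightarrow> metric q (grad J q) \<zeta> = mderiv J q \<zeta>" by (rule grad_eq(3)[OF J2[OF that] z])
  qed
  have tan: "?V t \<in> tangent (?\<gamma> t)" if "t \<in> {0..a}" for t using that by (intro geo_vel_tangent[OF \<xi>]) auto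
  have slope: "mderiv J (?\<gamma> t) (?V t) = (?G t \<bullet> ?V t) / 2" if "t \<in> {0..a}" for t
    using grad[OF K[OF that]] tan[OF that] by (simp add: metric_eq flip: grad(2)[OF K[OF that]])
  define h where "h t = nabla (?\<gamma> t) (?V t) (grad J)" for t
  have h_tan: "h t \<in> tangent (?\<gamma> t)" if "t \<in> {0..a}" for t
    unfolding h_def using tan[OF that] J[OF K[OF that]] by (intro nabla_tangent C1_field_grad)
  have der: "((\<lambda>t. (?G t \<bullet> ?V t) / 2) has_derivative (\<lambda>s. s * ((h t \<bullet> ?V t) / 2))) (at t within {0..a})"
    if t: "t \<in> {0..a}" for t
  proof -
    let ?V' = "brk (brk \<xi> (embed p)) (?V t)"
    have field: "C1_field_near (?\<gamma> t) (grad J)" using C1_field_grad[OF J[OF K[OF t]]] .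
    have G': "(?G has_vector_derivative mderiv (grad J) (?\<gamma> t) (?V t)) (at t within {0..a})"
      by (rule mderiv_along_curve[OF C1_field_nearD(1)[OF field] mexp_has_velocity[OF \<xi> t] t tan[OF t]])
    have "?G t \<bullet> ?V' = ?G t \<bullet> tproj2 (embed (?\<gamma> t)) ?V'"
      using inner_tproj2[OF grad(1)[OF K[OF t]]] by simp
    then have 0: "?G t \<bullet> ?V' = 0" using geo_vel_normal[OF \<xi>, of t] t by simp
    have "mderiv (grad J) (?\<gamma> t) (?V t) \<bullet> ?V t = h t \<bullet> ?V t"
      unfolding h_def nabla_eq[OF tan[OF t] field]
      using inner_tproj2[OF tan[OF t]] by (simp add: inner_commute)
    with 0 bounded_bilinear.has_vector_derivative[OF bounded_bilinear_inner G' geo_vel_deriv[OF \<xi> t]]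
    have "((\<lambda>t. ?G t \<bullet> ?V t) has_vector_derivative h t \<bullet> ?V t) (at t within {0..a})" by simp
    from bounded_linear.has_vector_derivative[OF bounded_linear_divide[of 2] this]
    show ?thesis by (simp add: has_vector_derivative_def)
  qed
  have bnd: "\<bar>(h t \<bullet> ?V t) / 2\<bar> \<le> L * (tnorm p \<xi>)\<^sup>2" if t: "t \<in> {0..a}" for t
  proof (cases "\<xi> = 0")
    case True
    then have "norm (?V t) = 0" using norm_geo_vel[OF \<xi>, of t] t by simp
    then show ?thesis using True subspace_0[OF subspace_tangent, of p] by (simp add: tnorm_eq)
  next
    case False
    \<comment> \<open>Normalizes the velocity, whose norm is constant, to a vector of
      \<open>tnorm\<close> 1, as \<open>hess_norms\<close> requires.\<close>
    let ?c = "sqrt 2 / norm \<xi>"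
    have nV: "norm (?V t) = norm \<xi>" using norm_geo_vel[OF \<xi>] t by simp
    have "tnorm (?\<gamma> t) (?c *\<^sub>R ?V t) = 1"
      using False nV tnorm_eq[OF subspace_scale[OF subspace_tangent tan[OF t]]] by simp
    then have "tnorm (?\<gamma> t) (nabla (?\<gamma> t) (?c *\<^sub>R ?V t) (grad J)) \<in> hess_norms nabla J K"
      unfolding hess_norms_def using K[OF t] subspace_scale[OF subspace_tangent tan[OF t]] by blast
    moreover have "nabla (?\<gamma> t) (?c *\<^sub>R ?V t) (grad J) = ?c *\<^sub>R h t"
    proof -
      \<comment> \<open>Homogeneity in the direction is the linearity axiom of the connection with
        second coefficient 0.\<close>
      have "nabla (?\<gamma> t) (?c *\<^sub>R ?V t + 0 *\<^sub>R ?V t) (grad J) = ?c *\<^sub>R h t + 0 *\<^sub>R h t"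
        using conn tan[OF t] C1_field_grad[OF J[OF K[OF t]]] unfolding riemannian_connection_def h_def by blast
      then show ?thesis by simp
    qed
    moreover have "tnorm (?\<gamma> t) (?c *\<^sub>R h t) = norm (h t) / norm \<xi>"
      using tnorm_eq[OF subspace_scale[OF subspace_tangent h_tan[OF t]]] by simp
    ultimately have "norm (h t) / norm \<xi> \<le> L" using L by metis
    then have hL: "norm (h t) \<le> L * norm \<xi>" using False by (simp add: field_simps)
    have "\<bar>h t \<bullet> ?V t\<bar> \<le> norm (h t) * norm (?V t)" by (rule Cauchy_Schwarz_ineq2)
    also have "\<dots> \<le> (L * norm \<xi>) * norm \<xi>" unfolding nV using hL by (intro mult_right_mono) auto
    finally have "\<bar>h t \<bullet> ?V t\<bar> \<le> L * (norm \<xi>)\<^sup>2" by (simp add: power2_eq_square mult.assoc)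
    moreover have "(norm \<xi>)\<^sup>2 = 2 * (tnorm p \<xi>)\<^sup>2" by (simp add: tnorm_eq[OF \<xi>] power_divide)
    ultimately show ?thesis by simp
  qed
  have "norm ((?G a \<bullet> ?V a) / 2 - (?G 0 \<bullet> ?V 0) / 2) \<le> (L * (tnorm p \<xi>)\<^sup>2) * norm (a - 0)"
  proof (rule differentiable_bound[OF _ der])
    fix t assume t: "t \<in> {0..a}"
    show "onorm (\<lambda>s. s * ((h t \<bullet> ?V t) / 2)) \<le> L * (tnorm p \<xi>)\<^sup>2"
    proof (rule onorm_le)
      fix s :: real
      have "norm (s * ((h t \<bullet> ?V t) / 2)) = \<bar>(h t \<bullet> ?V t) / 2\<bar> * norm s"
        unfolding real_norm_def abs_mult by (rule mult.commute)
      also have "\<dots> \<le> L * (tnorm p \<xi>)\<^sup>2 * norm s" by (rule mult_right_mono[OF bnd[OF t]]) simp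
      finally show "norm (s * ((h t \<bullet> ?V t) / 2)) \<le> L * (tnorm p \<xi>)\<^sup>2 * norm s" .
    qed
  qed (use a in auto)
  then show ?thesis
    using slope[of a] slope[of 0] a by (simp add: geo_vel_0[OF \<xi>] mexp_0[OF \<xi>] algebra_simps)
qed

end

section \<open>Regularity of the cost\<close>

lemma frame_change:
  fixes \<Phi> \<Phi>' :: "real ^ 'r ^ 'n"
  assumes \<Phi>: "\<Phi> \<in> full_rank" and \<Phi>': "\<Phi>' \<in> full_rank" and eq: "range_of \<Phi> = range_of \<Phi>'"
  obtains A where "\<Phi>' = \<Phi> ** A" "det A \<noteq> 0"
proof -
  let ?A = "matrix_inv (transpose \<Phi> ** \<Phi>) ** transpose \<Phi> ** \<Phi>'"
  have "pr \<Phi> = pr \<Phi>'" using orth_proj_range_of[OF \<Phi>] orth_proj_range_of[OF \<Phi>'] eq by simp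
  then have *: "\<Phi>' = \<Phi> ** ?A"
    using pr_mult_frame[OF \<Phi>'] by (simp add: pr_def oblique_def matrix_mul_assoc)
  have "c = 0" if "?A *v c = 0" for c
  proof -
    have "\<Phi>' *v c = \<Phi> *v (?A *v c)" using * by (metis matrix_vector_mul_assoc)
    then show ?thesis using that \<Phi>' by (simp add: full_rank_iff_ker)
  qed
  then have "det ?A \<noteq> 0" unfolding det_nz_iff_ker by blast
  with * show thesis by (rule that)
qed

text \<open>In terms of an orthonormal frame \<open>Q\<close> of the same space,
  \<open>\<Phi> = Q ** A\<close>, and the determinant is the square of \<open>det A\<close>.\<close>

lemma det_gram_pos:
  fixes \<Phi> :: "real ^ 'r ^ 'n"
  assumes \<Phi>: "\<Phi> \<in> full_rank"
  shows "det (transpose \<Phi> ** \<Phi>) > 0"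
proof -
  obtain Q :: "real ^ 'r ^ 'n" where Q: "transpose Q ** Q = mat 1" "Q \<in> full_rank" "range_of Q = range_of \<Phi>"
    using orthonormal_frame[OF CARD_le_of_full_rank[OF \<Phi>], of "range_of \<Phi>"] by metis
  obtain A where A: "\<Phi> = Q ** A" "det A \<noteq> 0" using frame_change[OF Q(2) \<Phi> Q(3)] .
  have "transpose \<Phi> ** \<Phi> = transpose A ** (transpose Q ** Q) ** A"
    unfolding A(1) by (simp only: transpose_simps matrix_mul_assoc)
  then show ?thesis using A(2) Q(1) by (simp add: det_mul power2_eq_square[symmetric])
qed

definition grassmann_reg :: "real ^ 'r ^ 'n \<Rightarrow> real ^ 'r ^ 'n \<Rightarrow> real" where
  "grassmann_reg \<Phi> \<Psi> = - ln ((det (transpose \<Psi> ** \<Phi>))\<^sup>2 / (det (transpose \<Phi> ** \<Phi>) * det (transpose \<Psi> ** \<Psi>)))"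

text \<open>Numerator and denominator both acquire the factor
  \<open>(det A)\<^sup>2 * (det B)\<^sup>2\<close>.\<close>

lemma grassmann_reg_frame_change:
  fixes \<Phi> \<Psi> :: "real ^ 'r ^ 'n"
  assumes "det A \<noteq> 0" "det B \<noteq> 0"
  shows "grassmann_reg (\<Phi> ** A) (\<Psi> ** B) = grassmann_reg \<Phi> \<Psi>"
proof -
  have "det (transpose (X ** C) ** (Y ** E)) = det C * det (transpose X ** Y) * det E"
    for X Y :: "real ^ 'r ^ 'n" and C E :: "real ^ 'r ^ 'r"
  proof -
    have "transpose (X ** C) ** (Y ** E) = transpose C ** (transpose X ** Y) ** E"
      by (simp only: transpose_simps matrix_mul_assoc)
    then show ?thesis by (simp add: det_mul)
  qed
  then show ?thesis using assms by (simp add: grassmann_reg_def power2_eq_square field_simps)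
qed

context grassmannian
begin

lemma regularizer_eq:
  fixes z :: "('n, 'r) frames"
  assumes z: "z \<in> frame_pairs"
  shows "regularizer (range_of2 z) = grassmann_reg (fst z) (snd z)"
proof -
  obtain A where A: "some_basis (range_of (fst z)) = fst z ** A" "det A \<noteq> 0"
    using frame_change[of "fst z" "some_basis (range_of (fst z))"] some_basis[OF le, of "range_of (fst z)"] z
    by (metis SigmaE fst_conv)
  obtain B where B: "some_basis (range_of (snd z)) = snd z ** B" "det B \<noteq> 0"
    using frame_change[of "snd z" "some_basis (range_of (snd z))"] some_basis[OF le, of "range_of (snd z)"] z
    by (metis SigmaE snd_conv)
  have "regularizer (range_of2 z) = grassmann_reg (fst z ** A) (snd z ** B)"
    by (simp add: regularizer_def Let_def range_of2_def A(1) B(1) grassmann_reg_def)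
  then show ?thesis by (simp only: grassmann_reg_frame_change[OF A(2) B(2)])
qed

lemma C_k_grassmann_reg:
  "C_k k {z :: ('n, 'r) frames. det (transpose (snd z) ** fst z) \<noteq> 0} (\<lambda>z. grassmann_reg (fst z) (snd z))"
proof -
  have *: "det (transpose (fst z) ** fst z) > 0" "det (transpose (snd z) ** snd z) > 0"
    if "det (transpose (snd z) ** fst z) \<noteq> 0" for z :: "('n, 'r) frames"
    using full_rank_oblique[OF that] det_gram_pos by auto
  show ?thesis
    unfolding grassmann_reg_def power2_eq_square
  proof (intro C_dirs_minus C_dirs_ln C_dirs_divide C_dirs_mult C_dirs_det_comp C_dirs_matmul C_dirs_transpose
      C_dirs_bounded_linear bounded_linear_fst bounded_linear_snd)
    fix z :: "('n, 'r) frames" assume z: "z \<in> {z. det (transpose (snd z) ** fst z) \<noteq> 0}"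
    then show "det (transpose (fst z) ** fst z) * det (transpose (snd z) ** snd z) \<noteq> 0"
      using *[of z] by auto
    show "0 < det (transpose (snd z) ** fst z) * det (transpose (snd z) ** fst z) /
      (det (transpose (fst z) ** fst z) * det (transpose (snd z) ** snd z))"
      using *[of z] z by (auto simp flip: power2_eq_square)
  qed
qed

text \<open>The subspaces enter the reduced model through the projector, in the initial value and in
  the right-hand side. Adjoining the projector to the state moves all dependence into the initial
  value \<open>Y z\<close>, a smooth function of the frames, and the theorem on initial values
  applies.\<close>

theorem cost_C2:
  fixes f :: "real ^ 'n \<Rightarrow> real ^ 'd \<Rightarrow> real ^ 'n" and g :: "real ^ 'n \<Rightarrow> real ^ 'm"
    and Ly :: "real ^ 'm \<Rightarrow> real" and p :: "('n, 'r) pt"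
  assumes L: "L \<ge> 1" and ts: "strict_mono_on {..<L} ts"
    and f: "C_dirs state_dirs 2 (UNIV \<times> {ts 0..ts (L - 1)}) (\<lambda>(x, t). f x (u t))"
    and g: "C_k 2 UNIV g" and Ly: "C_k 2 UNIV Ly"
    and p: "p \<in> rom_domain f u x0 (ts 0) (ts (L - 1))"
  shows "C_k_near 2 p (cost f g u x0 L ts y Ly \<kappa>)"
proof -
  define a b where "a = ts 0" and "b = ts (L - 1)"
  have ts_le: "ts i \<le> ts j" if "i \<le> j" "j < L" for i j
    using strict_mono_onD[OF ts, of i j] that by (cases "i = j") auto
  have ab: "a \<le> b" using ts_le[of 0 "L - 1"] L by (simp add: a_def b_def)
  have ts_in: "ts l \<in> {a..b}" if "l < L" for l
    using ts_le[of 0 l] ts_le[of l "L - 1"] that by (auto simp: a_def b_def)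
  \<comment> \<open>The second component is the projector, with derivative 0; this right-hand side
    is the same for all subspaces.\<close>
  define H where "H q = (snd (fst q) *v f (fst (fst q)) (u (snd q)), 0 :: real ^ 'n ^ 'n)"
    for q :: "((real ^ 'n) \<times> (real ^ 'n ^ 'n)) \<times> real"
  have "C_dirs state_dirs 2 (UNIV \<times> {a..b}) (\<lambda>q :: ((real ^ 'n) \<times> (real ^ 'n ^ 'n)) \<times> real.
      (\<lambda>(x, t). f x (u t)) (fst (fst q), snd q))" (is "C_dirs _ _ _ ?f")
    by (rule C_dirs_affine_comp[OF _ _ _ _ f, where A' = "\<lambda>c. (fst (fst c), 0)"])
      (auto simp: Basis_prod_def zero_prod_def a_def b_def intro!: continuous_intros)
  moreover have "C_dirs state_dirs 2 (UNIV \<times> {a..b}) (\<lambda>q :: ((real ^ 'n) \<times> (real ^ 'n ^ 'n)) \<times> real. snd (fst q))"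
    by (intro C_dirs_bounded_linear bounded_linear_intros)
  ultimately have "C_dirs state_dirs 2 (UNIV \<times> {a..b}) (\<lambda>q. snd (fst q) *v ?f q)"
    by (rule C_dirs_bilinear[OF bounded_bilinear_matrix_vector_mult, rotated])
  from C_dirs_Pair[OF this C_dirs_const[of _ _ _ 0]]
  have H: "C_dirs state_dirs 2 (UNIV \<times> {a..b}) H" by (simp only: H_def[abs_def] prod.case)
  obtain G where "C1_ivp H G a b"
    by (rule C1_ivp_of_C_dirs[OF ab H[unfolded numeral_2_eq_2]]) (rule that)
  then interpret C1_ivp H G a b .
  let ?S = "{z :: ('n, 'r) frames. det (transpose (snd z) ** fst z) \<noteq> 0}"
  define Obl where "Obl z = oblique (fst z) (snd z)" for z :: "('n, 'r) frames"
  define Y where "Y z = (Obl z *v x0, Obl z)" for z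
  have C_Obl: "C_k k ?S Obl" for k unfolding Obl_def[abs_def] by (rule C_k_oblique)
  have C_Y: "C_k k ?S Y" for k
    unfolding Y_def[abs_def]
    by (intro C_dirs_Pair C_dirs_bilinear[OF bounded_bilinear_matrix_vector_mult] C_Obl C_dirs_const)
  have full: "z \<in> frame_pairs" if "z \<in> ?S" for z
    using full_rank_oblique[of "snd z" "fst z"] that by (simp add: mem_Times_iff)
  have proj: "oblique_proj (space_of (fst (range_of2 z))) (space_of (snd (range_of2 z))) = Obl z" if "z \<in> ?S" for z
    using that full_rank_oblique[of "snd z" "fst z"]
    by (simp add: range_of2_def space_of_range_of oblique_proj_eq Obl_def)
  have rom_iff: "rom_solution f u x0 a b (range_of2 z) x \<longleftrightarrow> solves_ivp H a b (Y z) (\<lambda>t. (x t, Obl z))"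
    if z: "z \<in> ?S" for z x
  proof -
    have "((\<lambda>t. (x t, Obl z)) has_vector_derivative (v, 0)) (at t within {a..b}) \<longleftrightarrow>
      (x has_vector_derivative v) (at t within {a..b})" for t v
      using has_vector_derivative_Pair[OF _ has_vector_derivative_const, of x v t "{a..b}" "Obl z"]
        bounded_linear.has_vector_derivative[OF bounded_linear_fst, of "\<lambda>t. (x t, Obl z)" "(v, 0)" "at t within {a..b}"]
      by auto
    then show ?thesis
      unfolding rom_solution_def proj[OF z] by (simp add: Let_def solves_ivp_def H_def Y_def)
  qed
  obtain z0 where z0: "z0 \<in> frame_pairs" "range_of2 z0 = p" by (rule frames_ex)
  have "p \<in> admissible_pairs" using p by (simp add: rom_domain_def)
  then have z0S: "z0 \<in> ?S"
    using admissible_iff[of "fst z0" "snd z0"] z0 by (auto simp: range_of2_def mem_Times_iff)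
  obtain x where "rom_solution f u x0 a b p x" using p by (auto simp: rom_domain_def a_def b_def)
  then have "solves_ivp H a b (Y z0) (\<lambda>t. (x t, Obl z0))" using rom_iff[OF z0S] z0(2) by simp
  then obtain d \<phi> where d: "d > 0" and \<phi>: "\<And>y. y \<in> ball (Y z0) d \<Longrightarrow> solves_ivp H a b y (\<phi> y)"
    and C_\<phi>: "\<And>t. t \<in> {a..b} \<Longrightarrow> C_k 2 (ball (Y z0) d) (\<lambda>y. \<phi> y t)"
    by (rule C2_dependence[OF ab H]) (rule that)
  \<comment> \<open>The frames whose initial value lies in the domain of the flow.\<close>
  let ?O = "?S \<inter> Y -` ball (Y z0) d"
  have O: "open ?O" by (rule continuous_open_preimage[OF C_dirs_imp_continuous_on[OF C_Y[of 0]] open_det_nz open_ball])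
  \<comment> \<open>\<open>rom_state\<close> is an arbitrary choice of a solution. The flow shows
    that one exists also for nearby frames, and uniqueness makes the choice coincide with
    it.\<close>
  have state: "rom_state f u x0 a b (range_of2 z) t = fst (\<phi> (Y z) t)" if z: "z \<in> ?O" and t: "t \<in> {a..b}" for z t
  proof -
    have zS: "z \<in> ?S" using z by blast
    have sol: "solves_ivp H a b (Y z) (\<phi> (Y z))" using z by (intro \<phi>) simp
    have const: "((\<lambda>t. snd (\<phi> (Y z) t)) has_vector_derivative 0) (at t within {a..b})" if "t \<in> {a..b}" for t
      using bounded_linear.has_vector_derivative[OF bounded_linear_snd solves_ivpD(2)[OF sol that]] by (simp add: H_def)
    have "snd (\<phi> (Y z) t) = Obl z" if "t \<in> {a..b}" for t
      using zero_derivative_const[OF const that] solves_ivpD(1)[OF sol] by (simp add: Y_def)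
    then have split: "\<phi> (Y z) t = (fst (\<phi> (Y z) t), Obl z)" if "t \<in> {a..b}" for t
      using that by (metis prod.collapse)
    have "solves_ivp H a b (Y z) (\<lambda>t. (fst (\<phi> (Y z) t), Obl z))"
      unfolding solves_ivp_def
    proof (intro conjI ballI)
      show "(fst (\<phi> (Y z) a), Obl z) = Y z" using split[of a] ab solves_ivpD(1)[OF sol] by simp
      fix t assume t: "t \<in> {a..b}"
      have "((\<lambda>t. (fst (\<phi> (Y z) t), Obl z)) has_vector_derivative H (\<phi> (Y z) t, t)) (at t within {a..b})"
        by (rule has_vector_derivative_transform[OF t _ solves_ivpD(2)[OF sol t]]) (rule split[symmetric])
      then show "((\<lambda>t. (fst (\<phi> (Y z) t), Obl z)) has_vector_derivative H ((fst (\<phi> (Y z) t), Obl z), t)) (at t within {a..b})"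
        by (simp only: split[OF t, symmetric])
    qed
    then have "rom_solution f u x0 a b (range_of2 z) (\<lambda>t. fst (\<phi> (Y z) t))" using rom_iff[OF zS] by simp
    then have "rom_solution f u x0 a b (range_of2 z) (rom_state f u x0 a b (range_of2 z))"
      unfolding rom_state_def by (rule someI[of "rom_solution f u x0 a b (range_of2 z)"])
    then have "solves_ivp H a b (Y z) (\<lambda>t. (rom_state f u x0 a b (range_of2 z) t, Obl z))" using rom_iff[OF zS] by simp
    from ivp_unique[OF this sol t] show ?thesis by (metis fst_conv)
  qed
  have "C_k 2 ?O (\<lambda>z. 1 / real L * (\<Sum>l<L. Ly (g (fst (\<phi> (Y z) (ts l))) - y l)) + \<kappa> * grassmann_reg (fst z) (snd z))"
  proof (intro C_dirs_add C_dirs_mult C_dirs_const C_dirs_sum)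
    show "C_k 2 ?O (\<lambda>z. grassmann_reg (fst z) (snd z))" by (rule C_dirs_subset[OF C_k_grassmann_reg]) blast
    fix l assume "l \<in> {..<L}"
    then have "C_k 2 ?O (\<lambda>z. \<phi> (Y z) (ts l))"
      using C_dirs_compose[OF open_ball _ C_\<phi>[OF ts_in[of l]] C_dirs_subset[OF C_Y, of ?O]] by auto
    from C_dirs_compose[OF open_UNIV _ g C_dirs_fst[OF this]]
    have "C_k 2 ?O (\<lambda>z. g (fst (\<phi> (Y z) (ts l))) - y l)" by (intro C_dirs_diff C_dirs_const) simp
    from C_dirs_compose[OF open_UNIV _ Ly this] show "C_k 2 ?O (\<lambda>z. Ly (g (fst (\<phi> (Y z) (ts l))) - y l))" by simp
  qed
  then have "C_k 2 ?O (\<lambda>z. cost f g u x0 L ts y Ly \<kappa> (range_of2 z))"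
  proof (rule C_dirs_cong[OF O, rotated])
    fix z assume z: "z \<in> ?O"
    then have "rom_state f u x0 (ts 0) (ts (L - 1)) (range_of2 z) (ts l) = fst (\<phi> (Y z) (ts l))" if "l < L" for l
      using state[OF z ts_in[OF that]] by (simp add: a_def b_def)
    then show "1 / real L * (\<Sum>l<L. Ly (g (fst (\<phi> (Y z) (ts l))) - y l)) + \<kappa> * grassmann_reg (fst z) (snd z)
      = cost f g u x0 L ts y Ly \<kappa> (range_of2 z)"
      using z full[of z] by (simp add: cost_def regularizer_eq)
  qed
  then have "C_k_near 2 (range_of2 z0) (cost f g u x0 L ts y Ly \<kappa>)"
    using z0S d full by (intro C_k_nearI[OF O]) auto
  then show ?thesis by (simp add: z0(2))
qed

end

section \<open>Convergence\<close>

text \<open>The convergence argument in terms of numbers: \<open>G k\<close>, \<open>d k\<close> and \<open>N k\<close> stand for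
  \<open>|grad J(p k)|\<^sup>2\<close>, \<open>\<langle>grad J(p k), \<eta> k\<rangle>\<close> and \<open>|\<eta> k|\<^sup>2\<close>, and \<open>t k\<close> for the
  directional derivative at the end of step \<open>k\<close>.\<close>

locale dai_yuan_sequence =
  fixes G d N t \<alpha> j :: "nat \<Rightarrow> real" and c1 c2 M B :: real
  assumes G_nonneg: "G k \<ge> 0" and N_nonneg: "N k \<ge> 0" and \<alpha>_nonneg: "\<alpha> k \<ge> 0"
    and c: "0 < c1" "c1 < c2" "c2 < 1"
    and armijo: "j (Suc k) \<le> j k + c1 * \<alpha> k * d k" and curvature: "t k \<ge> c2 * d k"
    and below: "j k \<ge> B"
    and lipschitz: "\<bar>t k - d k\<bar> \<le> M * \<alpha> k * N k"
    and denom: "t k - d k \<noteq> 0"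
    and d_0: "d 0 = - G 0" and N_0: "N 0 = G 0"
    and d_Suc: "d (Suc k) = - G (Suc k) + G (Suc k) / (t k - d k) * t k"
    and N_Suc: "N (Suc k) = G (Suc k) - 2 * (G (Suc k) / (t k - d k)) * t k + (G (Suc k) / (t k - d k))\<^sup>2 * N k"
begin

text \<open>If \<open>N k\<close> were 0, the Lipschitz bound would force \<open>t k = d k\<close>,
  against the nonzero denominator.\<close>

lemma N_nz: "N k > 0"
  using lipschitz[of k] denom[of k] N_nonneg[of k] by (cases "N k = 0") auto

text \<open>A zero gradient makes the Dai-Yuan coefficient 0 and hence the next search direction 0,
  which \<open>N_nz\<close> excludes.\<close>

lemma G_pos: "G k > 0"
proof (rule ccontr)
  assume "\<not> G k > 0"
  then have "G k = 0" using G_nonneg[of k] by simp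
  then have "N k = 0" by (cases k) (simp_all add: N_0 N_Suc)
  then show False using N_nz[of k] by simp
qed

text \<open>If \<open>d k\<close> is negative, the curvature condition gives
  \<open>t k - d k \<ge> (c2 - 1) * d k > 0\<close>, so the denominator is positive and
  \<open>d (Suc k)\<close> is a positive multiple of \<open>d k\<close>.\<close>

lemma d_neg: "d k < 0"
proof (induction k)
  case 0
  then show ?case using G_pos by (simp add: d_0)
next
  case (Suc k)
  have "t k - d k \<ge> (c2 - 1) * d k" using curvature[of k] by (simp add: algebra_simps)
  moreover have "(c2 - 1) * d k > 0" using c Suc by (simp add: mult_neg_neg)
  ultimately have pos: "t k - d k > 0" by linarith
  then have "d (Suc k) = G (Suc k) / (t k - d k) * d k"
    by (simp add: d_Suc field_simps)
  then show ?case using pos G_pos[of "Suc k"] Suc by (simp add: mult_pos_neg divide_neg_pos)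
qed

lemma d_Suc': "d (Suc k) = G (Suc k) / (t k - d k) * d k"
  using denom[of k] by (simp add: d_Suc field_simps)

text \<open>The Dai-Yuan coefficient equals \<open>d (Suc k) / d k\<close>. Dividing the recursion
  for \<open>N\<close> by \<open>(d (Suc k))\<^sup>2\<close> therefore reproduces the previous ratio
  exactly and leaves a remainder of at most \<open>1 / G (Suc k)\<close>.\<close>

lemma ratio_le: "N k / (d k)\<^sup>2 \<le> (\<Sum>i\<le>k. 1 / G i)"
proof (induction k)
  case 0
  then show ?case using G_pos[of 0] by (simp add: d_0 N_0 power2_eq_square)
next
  case (Suc k)
  let ?b = "G (Suc k) / (t k - d k)" and ?d = "d (Suc k)" and ?G = "G (Suc k)"
  have "?b \<noteq> 0" using G_pos[of "Suc k"] denom[of k] by simp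
  have bt: "?b * t k = ?d + ?G" by (simp add: d_Suc)
  have "N (Suc k) = ?G - 2 * (?b * t k) + ?b\<^sup>2 * N k" by (simp only: N_Suc mult.assoc)
  then have "N (Suc k) = ?b\<^sup>2 * N k - 2 * ?d - ?G" unfolding bt by simp
  then have "N (Suc k) / ?d\<^sup>2 = ?b\<^sup>2 * N k / ?d\<^sup>2 + (- 2 * ?d - ?G) / ?d\<^sup>2"
    by (simp add: add_divide_distrib diff_divide_distrib)
  also have "?b\<^sup>2 * N k / ?d\<^sup>2 = N k / (d k)\<^sup>2"
    unfolding d_Suc' power_mult_distrib using \<open>?b \<noteq> 0\<close> by (intro mult_divide_mult_cancel_left) simp
  \<comment> \<open>Completing the square in \<open>1 / ?d\<close>.\<close>
  also have "(- 2 * ?d - ?G) / ?d\<^sup>2 = 1 / ?G - (?d + ?G)\<^sup>2 / (?G * ?d\<^sup>2)"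
    using G_pos[of "Suc k"] d_neg[of "Suc k"] by (simp add: divide_simps) (simp add: power2_eq_square algebra_simps)
  also have "\<dots> \<le> 1 / ?G"
    using G_pos[of "Suc k"] by simp
  finally show ?case using Suc by simp
qed

text \<open>Curvature condition and Lipschitz bound force the step size to be at least
  \<open>(1 - c2) * (- d k) / (M * N k)\<close>; the sufficient decrease condition turns this into a
  decrease of \<open>j\<close>. Positivity of \<open>M\<close> follows from the same
  comparison.\<close>

lemma zoutendijk: "M > 0" "c1 * (1 - c2) / M * ((d k)\<^sup>2 / N k) \<le> j k - j (Suc k)"
proof -
  have *: "(1 - c2) * (- d k) \<le> M * \<alpha> k * N k"
    using curvature[of k] lipschitz[of k] by (simp add: algebra_simps)
  moreover have "(1 - c2) * (- d k) > 0" using c d_neg[of k] by (intro mult_pos_pos) auto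
  ultimately have "0 < M * \<alpha> k * N k" by linarith
  then show M: "M > 0"
    using N_nz[of k] \<alpha>_nonneg[of k] by (metis less_eq_real_def mult_nonneg_nonneg mult_pos_pos not_less zero_less_mult_pos2 mult.assoc zero_less_mult_iff)
  have "(1 - c2) * (- d k) / (M * N k) \<le> \<alpha> k"
  proof (subst pos_divide_le_eq)
    show "0 < M * N k" using M N_nz[of k] by simp
    have "M * \<alpha> k * N k = \<alpha> k * (M * N k)" by simp
    then show "(1 - c2) * (- d k) \<le> \<alpha> k * (M * N k)" using * by linarith
  qed
  then have "c1 * (- d k) * ((1 - c2) * (- d k) / (M * N k)) \<le> c1 * (- d k) * \<alpha> k"
  proof (rule mult_left_mono)
    show "0 \<le> c1 * (- d k)" using c d_neg[of k] by (intro mult_nonneg_nonneg) auto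
  qed
  moreover have "c1 * (- d k) * ((1 - c2) * (- d k) / (M * N k)) = c1 * (1 - c2) / M * ((d k)\<^sup>2 / N k)"
    by (simp add: power2_eq_square)
  ultimately have "c1 * (1 - c2) / M * ((d k)\<^sup>2 / N k) \<le> c1 * (- d k) * \<alpha> k" by (simp only:)
  moreover have "c1 * (- d k) * \<alpha> k = - (c1 * \<alpha> k * d k)" by simp
  ultimately show "c1 * (1 - c2) / M * ((d k)\<^sup>2 / N k) \<le> j k - j (Suc k)"
    using armijo[of k] by linarith
qed

theorem gradient_small:
  assumes e: "e > 0"
  shows "\<exists>k. G k < e"
proof (rule ccontr)
  assume "\<not> (\<exists>k. G k < e)"
  then have G: "G k \<ge> e" for k by (simp add: not_less)
  \<comment> \<open>If all \<open>G i\<close> are at least \<open>e\<close>, the sum of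
    \<open>Suc k\<close> reciprocals is at most \<open>Suc k / e\<close>, so step \<open>k\<close>
    lowers \<open>j\<close> by at least \<open>C / Suc k\<close>, while \<open>j\<close> is bounded
    below.\<close>
  define C where "C = c1 * (1 - c2) / M * e"
  have C: "C > 0" using c zoutendijk(1) e by (simp add: C_def)
  have step: "C * inverse (real (Suc k)) \<le> j k - j (Suc k)" for k
  proof -
    have "N k / (d k)\<^sup>2 \<le> (\<Sum>i\<le>k. 1 / e)"
      using ratio_le[of k] by (rule order_trans) (intro sum_mono frac_le, use e G in auto)
    also have "\<dots> = real (Suc k) / e" by simp
    finally have "N k / (d k)\<^sup>2 \<le> real (Suc k) / e" .
    moreover have "0 < N k / (d k)\<^sup>2" using N_nz[of k] d_neg[of k] by simp
    ultimately have "inverse (real (Suc k) / e) \<le> inverse (N k / (d k)\<^sup>2)"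
      by (rule le_imp_inverse_le)
    then have "e * inverse (real (Suc k)) \<le> (d k)\<^sup>2 / N k" by (simp add: field_simps)
    then have "c1 * (1 - c2) / M * (e * inverse (real (Suc k))) \<le> c1 * (1 - c2) / M * ((d k)\<^sup>2 / N k)"
      using c zoutendijk(1) by (intro mult_left_mono) auto
    then show ?thesis using zoutendijk(2)[of k] by (simp add: C_def mult.assoc)
  qed
  have "(\<Sum>k<n. C * inverse (real (Suc k))) \<le> j 0 - B" for n
  proof -
    have "(\<Sum>k<n. C * inverse (real (Suc k))) \<le> (\<Sum>k<n. j k - j (Suc k))" by (intro sum_mono step)
    also have "\<dots> = j 0 - j n" by (rule sum_lessThan_telescope')
    finally show ?thesis using below[of n] by simp
  qed
  from this[of "Suc n" for n] have "summable (\<lambda>k. C * inverse (real (Suc k)))"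
    unfolding lessThan_Suc_atMost using C by (intro bounded_imp_summable[of _ "j 0 - B"]) simp_all
  then have "summable (\<lambda>k. inverse (real (Suc k)))" using C by (simp add: summable_cmult_iff)
  then have "summable (\<lambda>k. inverse (real k))" by (subst (asm) summable_Suc_iff[of "\<lambda>k. inverse (real k)"])
  then show False using not_summable_harmonic[where 'a = real] by simp
qed

lemma liminf_eq_0: "liminf (\<lambda>k. ereal (sqrt (G k))) = 0"
proof (rule antisym)
  show "0 \<le> liminf (\<lambda>k. ereal (sqrt (G k)))"
    by (intro Liminf_bounded always_eventually) (use G_nonneg in auto)
  show "liminf (\<lambda>k. ereal (sqrt (G k))) \<le> 0"
  proof (rule ccontr)
    assume "\<not> liminf (\<lambda>k. ereal (sqrt (G k))) \<le> 0"
    then obtain e where e: "ereal e < liminf (\<lambda>k. ereal (sqrt (G k)))" "0 < e"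
      using ereal_dense2[of 0 "liminf (\<lambda>k. ereal (sqrt (G k)))"] by (auto simp: not_le)
    from less_LiminfD[OF e(1)] obtain K where K: "\<And>k. k \<ge> K \<Longrightarrow> e < sqrt (G k)"
      by (auto simp: eventually_sequentially)
    \<comment> \<open>\<open>gradient_small\<close> gives an index but no control over its size.
      Lowering the threshold below the finitely many positive early values excludes indices before
      \<open>K\<close>.\<close>
    define e' where "e' = Min (insert (e\<^sup>2) (G ` {..<K}))"
    have "e' > 0" unfolding e'_def using e(2) G_pos by (subst Min_gr_iff) auto
    then obtain k where k: "G k < e'" using gradient_small by blast
    show False
    proof (cases "k < K")
      case True
      then have "e' \<le> G k" unfolding e'_def by (intro Min_le) auto
      then show ?thesis using k by simp
    next
      case False
      then have "e < sqrt (G k)" using K by simp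
      then have "e\<^sup>2 < G k" using e(2) by (metis less_imp_le real_less_rsqrt real_sqrt_less_iff real_sqrt_unique)
      moreover have "e' \<le> e\<^sup>2" unfolding e'_def by (intro Min_le) auto
      ultimately show ?thesis using k by simp
    qed
  qed
qed

end

theorem theorem4p5:
  fixes f :: "real ^ 'n \<Rightarrow> real ^ 'd \<Rightarrow> real ^ 'n"
    and g :: "real ^ 'n \<Rightarrow> real ^ 'm"
    and u :: "real \<Rightarrow> real ^ 'd"
    and x0 :: "real ^ 'n"
    and L :: nat
    and ts :: "nat \<Rightarrow> real"
    and x :: "real \<Rightarrow> real ^ 'n"
    and y :: "nat \<Rightarrow> real ^ 'm"
    and Ly :: "real ^ 'm \<Rightarrow> real"
    and \<kappa> c1 c2 :: real
    and J :: "('n::finite, 'r::finite) pt \<Rightarrow> real"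
    and D Dc :: "('n::finite, 'r::finite) pt set"
    and nabla :: "('n::finite, 'r::finite) conn"
    and p :: "nat \<Rightarrow> ('n::finite, 'r::finite) pt"
    and \<eta> :: "nat \<Rightarrow> 'n tvec"
    and \<alpha> :: "nat \<Rightarrow> real"
  assumes r_le_n: "CARD('r) \<le> CARD('n)"
    and L_pos: "L \<ge> 1"
    and ts_incr: "strict_mono_on {..<L} ts"
    and f_C2: "C_dirs ((\<lambda>b. (b, 0)) ` Basis) 2 (UNIV \<times> {ts 0..ts (L - 1)}) (\<lambda>(x, t). f x (u t))"
    and g_C2: "C_k 2 UNIV g"
    and x_fom: "fom_solution f u x0 (ts 0) (ts (L - 1)) x"
    and y_obs: "\<forall>l<L. y l = g (x (ts l))"
    and Ly_nonneg: "\<forall>v. Ly v \<ge> 0"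
    and Ly_smooth: "\<forall>k. C_k k UNIV Ly"
    and \<kappa>_pos: "\<kappa> > 0"
    and D_eq: "D = rom_domain f u x0 (ts 0) (ts (L - 1))"
    and J_eq: "J = cost f g u x0 L ts y Ly \<kappa>"
    and c12: "0 < c1" "c1 < c2" "c2 < 1"
    and conn: "riemannian_connection nabla"
    and alg: "geometric_cg nabla J D c1 c2 p \<eta> \<alpha>"
    and Dc_compact: "compact Dc"
    and Dc_sub: "Dc \<subseteq> D"
    and in_Dc: "\<forall>k. \<forall>t\<in>{0..\<alpha> k}. mexp nabla (p k) (t *\<^sub>R \<eta> k) \<in> Dc"
  shows "(\<exists>LJ. LJ \<in> hess_norms nabla J Dc \<and> (\<forall>s\<in>hess_norms nabla J Dc. s \<le> LJ) \<and>
           (\<forall>k. \<bar>frechet_derivative (J \<circ> mexp nabla (p k)) (at (\<alpha> k *\<^sub>R \<eta> k) within tangent (p k)) (\<eta> k)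
                - frechet_derivative (J \<circ> mexp nabla (p k)) (at 0 within tangent (p k)) (\<eta> k)\<bar>
              \<le> LJ * \<alpha> k * (tnorm (p k) (\<eta> k))\<^sup>2)) \<and>
         liminf (\<lambda>k. ereal (tnorm (p k) (grad J (p k)))) = 0"
proof -
  interpret grassmannian "TYPE('n \<times> 'r)" by unfold_locales (rule r_le_n)
  interpret grassmann_connection "TYPE('n \<times> 'r)" nabla by unfold_locales (rule conn)
  have J2: "C_k_near 2 q J" if "q \<in> D" for q
    unfolding J_eq
    by (rule cost_C2[OF L_pos ts_incr f_C2 g_C2 Ly_smooth[rule_format]]) (use that in \<open>simp add: D_eq\<close>)
  then have J1: "C_k_near (Suc 1) q J" if "q \<in> D" for q
    using that by (simp only: numeral_2_eq_2 One_nat_def)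
  have grad: "grad J q \<in> tangent q" "\<And>\<zeta>. \<zeta> \<in> tangent q \<Longrightarrow> metric q (grad J q) \<zeta> = mderiv J q \<zeta>"
    if q: "q \<in> D" for q
  proof -
    obtain z where z: "z \<in> frame_pairs" "range_of2 z = q" by (rule frames_ex)
    show "grad J q \<in> tangent q" by (rule grad_eq(2)[OF J1[OF q] z])
    show "\<And>\<zeta>. \<zeta> \<in> tangent q \<Longrightarrow> metric q (grad J q) \<zeta> = mderiv J q \<zeta>" by (rule grad_eq(3)[OF J1[OF q] z])
  qed
  have init: "\<eta> 0 = - grad J (p 0)"
    and \<alpha>: "\<And>k. \<alpha> k \<ge> 0" and wolfe: "\<And>k. wolfe c1 c2 (\<lambda>a. J (mexp nabla (p k) (a *\<^sub>R \<eta> k))) (\<alpha> k)"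
    and p_Suc: "\<And>k. p (Suc k) = mexp nabla (p k) (\<alpha> k *\<^sub>R \<eta> k)"
    and denom: "\<And>k. dai_yuan_denom nabla J (p k) (\<eta> k) (\<alpha> k) (p (Suc k)) \<noteq> 0"
    and \<eta>_Suc: "\<And>k. \<eta> (Suc k) = - grad J (p (Suc k)) +
      dai_yuan nabla J (p k) (\<eta> k) (\<alpha> k) (p (Suc k)) *\<^sub>R parallel_transl nabla (p k) (\<alpha> k *\<^sub>R \<eta> k) (\<eta> k)"
    using alg unfolding geometric_cg_def by blast+
  \<comment> \<open>The hypothesis at time 0. It uses the exponential of the zero vector, as the
    tangency of \<open>\<eta> k\<close> is not yet known.\<close>
  have p_Dc: "p k \<in> Dc" for k
    using in_Dc[rule_format, of 0 k] \<alpha>[of k] mexp_0[OF subspace_0[OF subspace_tangent], of "p k"] by simp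
  then have p_D: "p k \<in> D" for k using Dc_sub by blast
  define T where "T k = geo_vel (p k) (\<eta> k) (\<alpha> k)" for k
  \<comment> \<open>The closed forms of exponential map and parallel translation hold for tangent
    vectors, so tangency has to be carried through the recursion first.\<close>
  have \<eta>_tan: "\<eta> k \<in> tangent (p k)" for k
  proof (induction k)
    case 0
    then show ?case unfolding init using subspace_neg[OF subspace_tangent grad(1)[OF p_D]] .
  next
    case (Suc k)
    have "T k \<in> tangent (p (Suc k))"
      unfolding T_def p_Suc by (rule geo_vel_tangent[OF Suc \<alpha>])
    then show ?case
      unfolding \<eta>_Suc parallel_transl_eq[OF Suc \<alpha>] T_def[symmetric]
      by (intro subspace_add[OF subspace_tangent] subspace_neg[OF subspace_tangent grad(1)[OF p_D]]
          subspace_scale[OF subspace_tangent])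
  qed
  have T_tan: "T k \<in> tangent (p (Suc k))" for k
    unfolding T_def p_Suc by (rule geo_vel_tangent[OF \<eta>_tan \<alpha>])
  have transl: "parallel_transl nabla (p k) (\<alpha> k *\<^sub>R \<eta> k) (\<eta> k) = T k" for k
    unfolding T_def by (rule parallel_transl_eq[OF \<eta>_tan \<alpha>])
  have norm_T: "norm (T k) = norm (\<eta> k)" for k
    unfolding T_def by (rule norm_geo_vel[OF \<eta>_tan \<alpha>])
  have in_D: "mexp nabla (p k) (a *\<^sub>R \<eta> k) \<in> D" if "a \<in> {0..\<alpha> k}" for k a
    using in_Dc that Dc_sub by blast
  define G where "G k = metric (p k) (grad J (p k)) (grad J (p k))" for k
  define d where "d k = metric (p k) (grad J (p k)) (\<eta> k)" for k
  define N where "N k = metric (p k) (\<eta> k) (\<eta> k)" for k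
  define t where "t k = metric (p (Suc k)) (grad J (p (Suc k))) (T k)" for k
  have d_mderiv: "d k = mderiv J (p k) (\<eta> k)" for k
    unfolding d_def by (rule grad(2)[OF p_D \<eta>_tan])
  have t_mderiv: "t k = mderiv J (p (Suc k)) (T k)" for k
    unfolding t_def by (rule grad(2)[OF p_D T_tan])
  have G: "G k = (norm (grad J (p k)))\<^sup>2 / 2" "tnorm (p k) (grad J (p k)) = sqrt (G k)" for k
    using metric_eq[OF grad(1)[OF p_D] grad(1)[OF p_D]] by (simp_all add: G_def tnorm_def power2_norm_eq_inner)
  have N: "N k = (norm (\<eta> k))\<^sup>2 / 2" "(tnorm (p k) (\<eta> k))\<^sup>2 = N k" for k
    by (simp_all add: N_def tnorm_def metric_eq[OF \<eta>_tan \<eta>_tan] power2_norm_eq_inner)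
  have denom': "dai_yuan_denom nabla J (p k) (\<eta> k) (\<alpha> k) (p (Suc k)) = t k - d k" for k
    by (simp add: dai_yuan_denom_def transl t_def d_def)
  \<comment> \<open>A zero direction would make both terms of the Dai-Yuan denominator vanish.
    Together with \<open>p_Dc\<close> this gives the unit tangent vector needed for the maximum of
    the Hessian norms to exist.\<close>
  have \<eta>_nz: "\<eta> k \<noteq> 0" for k
  proof
    assume 0: "\<eta> k = 0"
    then have "T k = 0" using norm_T[of k] by simp
    then have "t k = 0" using metric_eq[OF grad(1)[OF p_D] T_tan, of k] by (simp add: t_def)
    moreover have "d k = 0" using metric_eq[OF grad(1)[OF p_D] \<eta>_tan, of k] 0 by (simp add: d_def)
    ultimately show False using denom[of k] denom'[of k] by simp
  qed
  obtain LJ where LJ: "LJ \<in> hess_norms nabla J Dc" "\<And>s. s \<in> hess_norms nabla J Dc \<Longrightarrow> s \<le> LJ"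
    using hess_norms_max[OF Dc_compact J2 p_Dc \<eta>_tan \<eta>_nz] Dc_sub by blast
  have lip: "\<bar>t k - d k\<bar> \<le> LJ * \<alpha> k * N k" for k
    unfolding t_mderiv d_mderiv T_def p_Suc N(2)[symmetric]
  proof (rule gradient_lipschitz_along_geodesic[where K = Dc, OF _ LJ(2) \<eta>_tan \<alpha>])
    show "C_k_near 2 q J" if "q \<in> Dc" for q using J2 Dc_sub that by blast
    show "mexp nabla (p k) (a *\<^sub>R \<eta> k) \<in> Dc" if "a \<in> {0..\<alpha> k}" for a using in_Dc that by blast
  qed
  have slope: "((\<lambda>a. J (mexp nabla (p k) (a *\<^sub>R \<eta> k))) has_real_derivative
      mderiv J (mexp nabla (p k) (a *\<^sub>R \<eta> k)) (geo_vel (p k) (\<eta> k) a)) (at a)" if "a \<in> {0..\<alpha> k}" for k a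
    unfolding has_real_derivative_iff_has_vector_derivative
    by (rule mexp_comp_has_vector_derivative[OF \<eta>_tan _ J1[OF in_D[OF that]]]) (use that in simp)
  \<comment> \<open>\<open>deriv\<close> is two-sided, so the two-sided derivative along the
    geodesic is needed at both ends of the step.\<close>
  have slope_0: "deriv (\<lambda>a. J (mexp nabla (p k) (a *\<^sub>R \<eta> k))) 0 = d k"
    and slope_\<alpha>: "deriv (\<lambda>a. J (mexp nabla (p k) (a *\<^sub>R \<eta> k))) (\<alpha> k) = t k" for k
    using DERIV_imp_deriv[OF slope[of 0 k]] DERIV_imp_deriv[OF slope[of "\<alpha> k" k]] \<alpha>[of k]
    by (simp_all add: mexp_0[OF \<eta>_tan] geo_vel_0[OF \<eta>_tan] d_mderiv t_mderiv T_def p_Suc)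
  obtain B where B: "\<And>q. q \<in> Dc \<Longrightarrow> B \<le> J q"
    using C_k_near_bounded_below[OF Dc_compact J2] Dc_sub by blast
  have \<eta>_Suc': "\<eta> (Suc k) = (G (Suc k) / (t k - d k)) *\<^sub>R T k - grad J (p (Suc k))" for k
    unfolding \<eta>_Suc transl by (simp add: dai_yuan_def denom' G_def)
  have "dai_yuan_sequence G d N t \<alpha> (\<lambda>k. J (p k)) c1 c2 LJ B"
  proof
    fix k
    let ?g = "grad J (p (Suc k))"
    define b where "b = G (Suc k) / (t k - d k)"
    have e: "\<eta> (Suc k) = b *\<^sub>R T k - ?g" unfolding b_def by (rule \<eta>_Suc')
    have tk: "t k = (?g \<bullet> T k) / 2" unfolding t_def by (rule metric_eq[OF grad(1)[OF p_D] T_tan])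
    have Gk: "G (Suc k) = (?g \<bullet> ?g) / 2" by (simp add: G(1) power2_norm_eq_inner)
    show "G k \<ge> 0" "N k \<ge> 0" by (simp_all add: G(1) N(1))
    show "J (p (Suc k)) \<le> J (p k) + c1 * \<alpha> k * d k" "c2 * d k \<le> t k"
      using wolfe[of k] by (simp_all add: wolfe_def slope_0 slope_\<alpha> p_Suc mexp_0[OF \<eta>_tan])
    show "B \<le> J (p k)" by (rule B[OF p_Dc])
    show "t k - d k \<noteq> 0" using denom[of k] denom' by simp
    show "d 0 = - G 0" "N 0 = G 0"
      using metric_eq[OF grad(1)[OF p_D[of 0]] \<eta>_tan[of 0]] by (simp_all add: d_def G N init power2_norm_eq_inner)
    have "d (Suc k) = (?g \<bullet> \<eta> (Suc k)) / 2" unfolding d_def by (rule metric_eq[OF grad(1)[OF p_D] \<eta>_tan])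
    then show "d (Suc k) = - G (Suc k) + G (Suc k) / (t k - d k) * t k"
      unfolding b_def[symmetric] by (simp add: e tk Gk inner_diff_right diff_divide_distrib)
    have "(norm (b *\<^sub>R T k - ?g))\<^sup>2 = b\<^sup>2 * (norm (T k))\<^sup>2 - 2 * b * (?g \<bullet> T k) + ?g \<bullet> ?g"
      unfolding power2_norm_eq_inner
      by (simp add: inner_diff_left inner_diff_right inner_commute power2_eq_square algebra_simps)
    then show "N (Suc k) = G (Suc k) - 2 * (G (Suc k) / (t k - d k)) * t k + (G (Suc k) / (t k - d k))\<^sup>2 * N k"
      unfolding b_def[symmetric]
      by (simp add: N(1) e tk Gk norm_T diff_divide_distrib add_divide_distrib)
  qed (use \<alpha> c12 lip in auto)
  then interpret dai_yuan_sequence G d N t \<alpha> "\<lambda>k. J (p k)" c1 c2 LJ B .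
  have frechet: "frechet_derivative (J \<circ> mexp nabla (p k)) (at (\<alpha> k *\<^sub>R \<eta> k) within tangent (p k)) (\<eta> k) = t k"
    "frechet_derivative (J \<circ> mexp nabla (p k)) (at 0 within tangent (p k)) (\<eta> k) = d k" for k
    using frechet_derivative_mexp[OF \<eta>_tan \<alpha> J1[OF in_D[of "\<alpha> k" k]]]
      frechet_derivative_mexp[OF \<eta>_tan order_refl J1[OF in_D[of 0 k]]] \<alpha>[of k]
    by (simp_all add: mexp_0[OF \<eta>_tan] geo_vel_0[OF \<eta>_tan] d_mderiv t_mderiv T_def p_Suc)
  have "\<bar>frechet_derivative (J \<circ> mexp nabla (p k)) (at (\<alpha> k *\<^sub>R \<eta> k) within tangent (p k)) (\<eta> k)
      - frechet_derivative (J \<circ> mexp nabla (p k)) (at 0 within tangent (p k)) (\<eta> k)\<bar>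
    \<le> LJ * \<alpha> k * (tnorm (p k) (\<eta> k))\<^sup>2" for k
    unfolding frechet N(2) by (rule lip)
  moreover have "liminf (\<lambda>k. ereal (tnorm (p k) (grad J (p k)))) = 0"
    unfolding G(2) by (rule liminf_eq_0)
  ultimately show ?thesis using LJ by blast
qed

end
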